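(* Let $n$ be a positive integer and let $K\subset S^2\times S^1$ be the torus knot $K_{1,2n}$ in $S^2\times S^1$. If $n$ is not a square, then $K$ does not bound a locally-flat Möbius band in $D^3\times S^1$.
   Context: Identify $S^2=\mathbb{C}\cup\{\infty\}$ and regard $S^1$ as the unit circle in $\mathbb{C}$. For coprime integers $p,q$, the torus knot $K_{p,q}$ in $S^2\times S^1$ is $\{(e^{2\pi i p t},e^{2\pi i q t})\mid t\in\mathbb{R}\}\subset S^2\times S^1$ (and $K_{1,2n}$ denotes the knot given by this formula with $p=1$, $q=2n$). Here $S^2\times S^1=\partial(D^3\times S^1)$. A knot $K\subset \partial X$ bounds a locally-flat Möbius band in a $4$-manifold $X$ if there is a properly embedded, locally-flat (topological) submanifold $M\subset X$ homeomorphic to the compact Möbius band with $\partial M=M\cap\partial X=K$; locally-flat means that each point of $M$ has a neighbourhood $U$ in $X$ such that $(U,U\cap M)$ is homeomorphic to an open subset of the standard pair $(\mathbb{R}^4,\mathbb{R}^2\times\{0\})$ at interior points, and of the standard half-space pair $(\mathbb{R}_{\ge0}\times\mathbb{R}^3,\mathbb{R}_{\ge0}\times\mathbb{R}\times\{0\})$ at boundary points. *)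

theory Defs
  imports "HOL-Analysis.Analysis"
begin

definition quotient_topology :: "'a topology \<Rightarrow> ('a \<times> 'a) set \<Rightarrow> 'a set topology" where
  "quotient_topology T r =
     topology (\<lambda>\<U>. \<U> \<subseteq> topspace T // r \<and> openin T {x \<in> topspace T. r `` {x} \<in> \<U>})"

lemma istopology_quotient:
  "istopology (\<lambda>\<U>. \<U> \<subseteq> topspace T // r \<and> openin T {x \<in> topspace T. r `` {x} \<in> \<U>})"
  unfolding istopology_def
proof (intro conjI allI impI; (elim conjE)?)
  fix S S' :: "'a set set"
  assume "S \<subseteq> topspace T // r" "S' \<subseteq> topspace T // r"
  then show "S \<inter> S' \<subseteq> topspace T // r" by blast
next
  fix S S' :: "'a set set"
  assume "openin T {x \<in> topspace T. r `` {x} \<in> S}" "openin T {x \<in> topspace T. r `` {x} \<in> S'}"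
  then have "openin T ({x \<in> topspace T. r `` {x} \<in> S} \<inter> {x \<in> topspace T. r `` {x} \<in> S'})"
    by blast
  moreover have "{x \<in> topspace T. r `` {x} \<in> S} \<inter> {x \<in> topspace T. r `` {x} \<in> S'} =
      {x \<in> topspace T. r `` {x} \<in> S \<inter> S'}" by blast
  ultimately show "openin T {x \<in> topspace T. r `` {x} \<in> S \<inter> S'}" by simp
next
  fix \<K> :: "'a set set set"
  assume *: "\<forall>K\<in>\<K>. K \<subseteq> topspace T // r \<and> openin T {x \<in> topspace T. r `` {x} \<in> K}"
  then show "\<Union>\<K> \<subseteq> topspace T // r" by blast
  have "openin T (\<Union>K\<in>\<K>. {x \<in> topspace T. r `` {x} \<in> K})"
    using * by blast
  moreover have "(\<Union>K\<in>\<K>. {x \<in> topspace T. r `` {x} \<in> K}) = {x \<in> topspace T. r `` {x} \<in> \<Union>\<K>}"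
    by blast
  ultimately show "openin T {x \<in> topspace T. r `` {x} \<in> \<Union>\<K>}" by simp
qed

lemma openin_quotient_topology:
  "openin (quotient_topology T r) \<U> \<longleftrightarrow>
     \<U> \<subseteq> topspace T // r \<and> openin T {x \<in> topspace T. r `` {x} \<in> \<U>}"
  unfolding quotient_topology_def by (subst topology_inverse'[OF istopology_quotient]) (rule refl)

lemma topspace_quotient_topology: "topspace (quotient_topology T r) = topspace T // r"
proof -
  have "{x \<in> topspace T. r `` {x} \<in> topspace T // r} = topspace T"
    by (auto simp: quotient_def)
  then have "openin (quotient_topology T r) (topspace T // r)"
    by (simp add: openin_quotient_topology)
  then show ?thesis
    by (meson openin_quotient_topology openin_subset openin_topspace subset_antisym)
qed

lemma quotient_map_quotient_topology:
  "quotient_map T (quotient_topology T r) (\<lambda>x. r `` {x})"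
  by (auto simp: quotient_map_def topspace_quotient_topology openin_quotient_topology quotient_def)

definition moebius_rel :: "((real \<times> real) \<times> (real \<times> real)) set" where
  "moebius_rel = {(u, v). u \<in> {0..1} \<times> {0..1} \<and> v \<in> {0..1} \<times> {0..1} \<and>
     (u = v \<or> {fst u, fst v} = {0, 1} \<and> snd v = 1 - snd u)}"

lemma equiv_moebius_rel: "equiv ({0..1} \<times> {0..1}) moebius_rel"
proof (rule equivI)
  show "moebius_rel \<subseteq> ({0..1} \<times> {0..1}) \<times> ({0..1} \<times> {0..1})"
    by (auto simp: moebius_rel_def)
  show "refl_on ({0..1} \<times> {0..1}) moebius_rel"
    by (auto simp: moebius_rel_def refl_on_def)
  show "sym moebius_rel"
    by (auto simp: moebius_rel_def sym_def doubleton_eq_iff)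
  show "trans moebius_rel"
    by (auto simp: moebius_rel_def trans_def doubleton_eq_iff)
qed

definition moebius_band :: "(real \<times> real) set topology" where
  "moebius_band = quotient_topology (top_of_set ({0..1} \<times> {0..1})) moebius_rel"

text \<open>The intrinsic boundary of a subspace that is a topological surface: the points that some
  chart to the closed half-plane sends to the boundary line.\<close>

definition surface_boundary :: "'a::topological_space set \<Rightarrow> 'a set" where
  "surface_boundary M =
     {p \<in> M. \<exists>U V f g. openin (top_of_set M) U \<and> p \<in> U \<and>
        openin (top_of_set {x :: real^2. 0 \<le> x $ 1}) V \<and>
        homeomorphism U V f g \<and> f p $ 1 = 0}"

text \<open>The pair \<open>(X, M)\<close> looks near \<open>p\<close> like an open piece of the model pair \<open>(H, P)\<close>.\<close>

definition locally_modelled_at ::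
  "'a::topological_space set \<Rightarrow> 'a set \<Rightarrow> 'b::topological_space set \<Rightarrow> 'b set \<Rightarrow> 'a \<Rightarrow> bool" where
  "locally_modelled_at X M H P p \<longleftrightarrow>
     (\<exists>U V f g. openin (top_of_set X) U \<and> p \<in> U \<and> openin (top_of_set H) V \<and>
        homeomorphism U V f g \<and> f ` (U \<inter> M) = V \<inter> P)"

text \<open>\<open>M\<close> is a surface in a 4-manifold \<open>X\<close> with boundary \<open>B\<close>.\<close>

definition locally_flat_surface ::
  "'a::topological_space set \<Rightarrow> 'a set \<Rightarrow> 'a set \<Rightarrow> bool" where
  "locally_flat_surface X B M \<longleftrightarrow>
     (\<forall>p \<in> M - B. locally_modelled_at X M
        (UNIV :: (real^4) set) {x. x $ 3 = 0 \<and> x $ 4 = 0} p) \<and>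
     (\<forall>p \<in> M \<inter> B. locally_modelled_at X M
        {x :: real^4. 0 \<le> x $ 1} {x. 0 \<le> x $ 1 \<and> x $ 3 = 0 \<and> x $ 4 = 0} p)"

definition bounds_locally_flat_moebius_band ::
  "'a::topological_space set \<Rightarrow> 'a set \<Rightarrow> 'a set \<Rightarrow> bool" where
  "bounds_locally_flat_moebius_band X B K \<longleftrightarrow>
     (\<exists>M \<subseteq> X. moebius_band homeomorphic_space top_of_set M \<and>
        surface_boundary M = M \<inter> B \<and> M \<inter> B = K \<and>
        locally_flat_surface X B M)"

abbreviation D3_times_S1 :: "((real^3) \<times> complex) set" where
  "D3_times_S1 \<equiv> cball 0 1 \<times> sphere 0 1"

abbreviation S2_times_S1 :: "((real^3) \<times> complex) set" where
  "S2_times_S1 \<equiv> sphere 0 1 \<times> sphere 0 1"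

text \<open>Inverse stereographic projection from the north pole: the identification of
  \<open>\<complex> \<union> {\<infinity>}\<close> with the unit sphere, restricted to \<open>\<complex>\<close> (the point \<open>\<infinity>\<close>
  corresponds to \<open>(0, 0, 1)\<close>). It maps the unit circle to the equator.\<close>

definition sphere_of_complex :: "complex \<Rightarrow> real^3" where
  "sphere_of_complex z =
     vector [2 * Re z / ((cmod z)\<^sup>2 + 1), 2 * Im z / ((cmod z)\<^sup>2 + 1),
             ((cmod z)\<^sup>2 - 1) / ((cmod z)\<^sup>2 + 1)]"

definition torus_knot :: "int \<Rightarrow> int \<Rightarrow> ((real^3) \<times> complex) set" where
  "torus_knot p q =
     range (\<lambda>t :: real. (sphere_of_complex (exp (2 * of_real pi * \<i> * of_int p * of_real t)),
                         exp (2 * of_real pi * \<i> * of_int q * of_real t)))"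

lemma sphere_of_complex_in_sphere: "sphere_of_complex z \<in> sphere 0 1"
proof -
  define s where "s = (cmod z)\<^sup>2"
  have s: "s \<ge> 0" "(Re z)\<^sup>2 + (Im z)\<^sup>2 = s" by (simp_all add: s_def cmod_power2)
  have "(norm (sphere_of_complex z))\<^sup>2 = (4 * ((Re z)\<^sup>2 + (Im z)\<^sup>2) + (s - 1)\<^sup>2) / (s + 1)\<^sup>2"
    by (simp add: norm_vec_def L2_set_def sum_3 sphere_of_complex_def power_divide
        power_mult_distrib add_divide_distrib flip: s_def)
  also have "\<dots> = 1"
    unfolding s(2) using s(1) by (simp add: divide_simps) (simp add: power2_eq_square algebra_simps)
  finally have "norm (sphere_of_complex z) = 1"
    by (metis norm_ge_zero one_power2 power2_eq_iff_nonneg zero_le_one)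
  then show ?thesis by simp
qed

lemma torus_knot_subset: "torus_knot p q \<subseteq> S2_times_S1"
  using sphere_of_complex_in_sphere by (auto simp: torus_knot_def norm_exp_eq_Re)

end

(* Pull a Moebius band M in D^3 x S^1 with boundary K_{1,2n} back to the universal cover D^3 x R.
   Since the core of M winds n times around S^1, the preimage consists of n disjoint strips, permuted
   cyclically by the deck transformation. Rotating the slice at height t by - pi t / n makes their 2n
   edges vertical, the k-th strip having the opposite edges k and k + n, and continuing the strips
   radially outside the ball yields n disjoint properly embedded planes in R^4 together with a screw
   motion that carries each plane to the next one.
   By Alexander duality the complement of finitely many of these planes has H_2 = 0 and a free H_1, with
   one meridian per plane as basis. Let l_i be the homomorphism dual to the meridian y_i of the plane i.
   As H_2 = 0, the cup product of l_i and l_j has a primitive b_ij that vanishes on y_i and y_j; let p_ij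
   be its value on the meridian y_{i+n} at the opposite edge of the plane i. The cup products l_i b_jk + b_ij l_k
   of three planes have a primitive as well, and comparing it with its image under the n-th power of the screw
   motion shows that p_ij = p_jk implies p_ij = p_ik modulo 2. By screw invariance
   p_{0,d} is therefore even for all 0 < d < n or odd for all of them. On the other hand
   p_{0,1} + p_{0,n-1} = p_{0,1} + p_{1,n} = -1. *)
theory Submission
  imports Defs "HOL-Homology.Homology" "HOL-Complex_Analysis.Riemann_Mapping"
begin

subsection \<open>Mayer--Vietoris arguments\<close>

text \<open>Outside the ball every slice at constant height meets the n planes in 2n rays, and the
  product of the 2n meridians around them, in cyclic order, is contractible. The two meridians of
  one plane have opposite linking numbers, so linking numbers do not see this relation; the
  primitives b_ij do, and expanding b_ij along the relation is the source of the -1. These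
  identities compare p_{0,d} with p_{0,n-d} only, and the triple products serve to compare different
  d. The n-th power S of the screw motion maps each plane to itself and exchanges its two edges, so
  it changes the sign of every l_i. Hence it fixes the products of two and, up to such products,
  negates those of three. If M is the primitive of a triple product, M o S + M is therefore a
  homomorphism up to multiples of the b's; evaluated at y_i and y_{i+n} it leaves twice an integer,
  which is why the congruence is modulo 2. Inside the ball nothing but homeomorphism types is at
  hand, so every loop is drawn outside it, and cochains are functions of based loops: explicit loops
  can be inserted, and the screw motion acts on them by a vertical change of base point.\<close>

definition vanishing_homology :: "nat \<Rightarrow> 'a::topological_space set \<Rightarrow> bool" where
  "vanishing_homology p U \<longleftrightarrow>
     (\<forall>c. singular_relcycle p (top_of_set U) {} c \<longrightarrow> singular_relboundary p (top_of_set U) {} c)"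

lemma image_eq_singleton_iff: "z \<in> Z \<Longrightarrow> h ` Z = {b} \<longleftrightarrow> (\<forall>c\<in>Z. h c = b)"
  by auto

lemma conj_absorb_left: "P \<Longrightarrow> (P \<and> Q) \<longleftrightarrow> Q"
  by simp

text \<open>The bridge to homology groups: contractibility and duality enter through the groups, the
  Mayer--Vietoris arguments through chains.\<close>

lemma vanishing_homology_iff_trivial:
  "vanishing_homology p U \<longleftrightarrow> trivial_group (homology_group (int p) (top_of_set U))"
proof -
  let ?X = "top_of_set U" and ?B = "singular_relboundary_set p (top_of_set U) {}"
  let ?h = "homologous_rel_set p ?X {}" and ?Z = "singular_relcycle_set p ?X {}"
  have "0 \<in> ?Z"
    by simp
  then have "?h ` ?Z = {?B} \<longleftrightarrow> (\<forall>c\<in>?Z. ?h c = ?B)"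
    by (rule image_eq_singleton_iff)
  moreover have "trivial_group (homology_group (int p) ?X) \<longleftrightarrow> ?h ` ?Z = {?B}"
    unfolding trivial_group_def one_relative_homology_group carrier_relative_homology_group
    using group_relative_homology_group [of "int p" ?X "{}"] by (rule conj_absorb_left)
  ultimately show ?thesis
    unfolding vanishing_homology_def homologous_rel_set_eq_relboundary by simp
qed

lemma vanishing_homology_contractible:
  fixes U :: "'a::topological_space set"
  assumes "contractible_space (top_of_set U)" "p > 0"
  shows "vanishing_homology p U"
  using trivial_reduced_homology_group_contractible_space [OF assms(1), of "int p"] assms(2)
  by (simp add: vanishing_homology_iff_trivial un_reduced_homology_group)

lemma singular_chain_Int:
  "singular_chain p (top_of_set A) c \<Longrightarrow> singular_chain p (top_of_set B) c
    \<Longrightarrow> singular_chain p (top_of_set (A \<inter> B)) c"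
  by (auto simp: singular_chain_subtopology)

lemma singular_chain_subdivision_power:
  "singular_chain p X c \<Longrightarrow> singular_chain p X ((singular_subdivision p ^^ n) c)"
  by (induction n) (auto simp: singular_chain_singular_subdivision)

lemma chain_boundary_subdivision_power:
  assumes "singular_chain p X c"
  shows "chain_boundary p ((singular_subdivision p ^^ n) c) =
    (singular_subdivision (p - 1) ^^ n) (chain_boundary p c)"
proof (induction n)
  case (Suc n)
  then show ?case
    using chain_boundary_singular_subdivision [OF singular_chain_subdivision_power [OF assms, of n]]
    by simp
qed simp

lemma subdivision_power_homologous:
  assumes "singular_relcycle p X {} c"
  shows "singular_relboundary p X {} ((singular_subdivision p ^^ n) c - c)"
proof (induction n)
  case (Suc n)
  let ?d = "(singular_subdivision p ^^ n) c"
  have "singular_relcycle p X {} ?d"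
    using assms Suc homologous_rel_def homologous_rel_singular_relcycle by metis
  then have "singular_relboundary p X {} (singular_subdivision p ?d - ?d)"
    using homologous_rel_singular_subdivision homologous_rel_def by metis
  then have "singular_relboundary p X {} ((singular_subdivision p ?d - ?d) + (?d - c))"
    using Suc singular_relboundary_add by blast
  then show ?case by simp
qed simp

text \<open>Small simplices for a cover by two open sets: after enough subdivisions every simplex
  lies in \<open>A\<close> or in \<open>B\<close>.\<close>

lemma subdivided_chain_split:
  assumes "open A" "open B" and c: "singular_chain p (top_of_set (A \<union> B)) c"
  obtains n a b where "singular_chain p (top_of_set A) a" "singular_chain p (top_of_set B) b"
    "(singular_subdivision p ^^ n) c = a + b"
proof -
  let ?X = "top_of_set (A \<union> B)"
  have op: "openin ?X V" if "V \<in> {A, B}" for V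
    by (rule open_subset) (use that assms in auto)
  obtain n where n: "\<And>m f. \<lbrakk>n \<le> m; f \<in> Poly_Mapping.keys ((singular_subdivision p ^^ m) c)\<rbrakk>
      \<Longrightarrow> \<exists>V \<in> {A, B}. f \<in> standard_simplex p \<rightarrow> V"
    by (rule sufficient_iterated_singular_subdivision_exists [of "{A, B}" ?X, OF op _ c]) auto
  let ?c = "(singular_subdivision p ^^ n) c"
  have sc: "singular_chain p ?X ?c"
    by (rule singular_chain_subdivision_power [OF c])
  have "Poly_Mapping.keys ?c \<subseteq> singular_simplex_set p (top_of_set A) \<union> singular_simplex_set p (top_of_set B)"
  proof
    fix f assume f: "f \<in> Poly_Mapping.keys ?c"
    then have "singular_simplex p ?X f"
      using sc by (auto simp: singular_chain_def)
    then show "f \<in> singular_simplex_set p (top_of_set A) \<union> singular_simplex_set p (top_of_set B)"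
      using n [OF order_refl f] by (auto simp: singular_simplex_subtopology)
  qed
  then obtain a b where "Poly_Mapping.keys a \<subseteq> singular_simplex_set p (top_of_set A)"
    "Poly_Mapping.keys b \<subseteq> singular_simplex_set p (top_of_set B)" "a + b = ?c"
    by (rule frag_split)
  then show thesis
    using that [of a b n] by (simp add: singular_chain_def)
qed

text \<open>The fillings of \<open>c\<close> in \<open>A\<close> and in \<open>B\<close> differ by a
  cycle of the union. A filling of that cycle, subdivided and split, corrects the filling in
  \<open>A\<close> so that it lies in the intersection.\<close>

lemma Mayer_Vietoris_injective:
  assumes "open A" "open B" and van: "vanishing_homology (Suc p) (A \<union> B)"
    and c: "singular_relcycle p (top_of_set (A \<inter> B)) {} c"
    and cA: "singular_relboundary p (top_of_set A) {} c"
    and cB: "singular_relboundary p (top_of_set B) {} c"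
  shows "singular_relboundary p (top_of_set (A \<inter> B)) {} c"
proof -
  obtain a where a: "singular_chain (Suc p) (top_of_set A) a" "chain_boundary (Suc p) a = c"
    using cA by (auto simp: singular_boundary)
  obtain b where b: "singular_chain (Suc p) (top_of_set B) b" "chain_boundary (Suc p) b = c"
    using cB by (auto simp: singular_boundary)
  have "singular_chain (Suc p) (top_of_set (A \<union> B)) (a - b)"
    by (rule singular_chain_diff singular_chain_mono [OF a(1)] singular_chain_mono [OF b(1)] Un_upper1 Un_upper2)+
  then have "singular_relcycle (Suc p) (top_of_set (A \<union> B)) {} (a - b)"
    by (simp add: singular_cycle chain_boundary_diff a b)
  then obtain d where d: "singular_chain (Suc (Suc p)) (top_of_set (A \<union> B)) d"
      "chain_boundary (Suc (Suc p)) d = a - b"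
    using van by (auto simp: vanishing_homology_def singular_boundary)
  obtain n dA dB where dA: "singular_chain (Suc (Suc p)) (top_of_set A) dA"
      and dB: "singular_chain (Suc (Suc p)) (top_of_set B) dB"
      and dd: "(singular_subdivision (Suc (Suc p)) ^^ n) d = dA + dB"
    by (rule subdivided_chain_split [OF assms(1,2) d(1)])
  let ?S = "singular_subdivision (Suc p) ^^ n"
  have "chain_boundary (Suc (Suc p)) dA + chain_boundary (Suc (Suc p)) dB = ?S (a - b)"
    using chain_boundary_subdivision_power [OF d(1), of n] d(2) dd
    by (simp add: chain_boundary_add)
  then have eq: "?S a - chain_boundary (Suc (Suc p)) dA = ?S b + chain_boundary (Suc (Suc p)) dB"
    by (simp add: singular_subdivision_power_diff algebra_simps)
  define e where "e = ?S a - chain_boundary (Suc (Suc p)) dA"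
  have "singular_chain (Suc p) (top_of_set A) e"
    unfolding e_def
    by (intro singular_chain_diff singular_chain_subdivision_power a singular_chain_boundary_alt dA)
  moreover have "singular_chain (Suc p) (top_of_set B) e"
    unfolding e_def eq
    by (intro singular_chain_add singular_chain_subdivision_power b singular_chain_boundary_alt dB)
  ultimately have e: "singular_chain (Suc p) (top_of_set (A \<inter> B)) e"
    by (rule singular_chain_Int)
  have "chain_boundary (Suc p) (chain_boundary (Suc (Suc p)) dA) = 0"
    using chain_boundary_boundary [OF dA] by simp
  then have "chain_boundary (Suc p) e = (singular_subdivision p ^^ n) c"
    using chain_boundary_subdivision_power [OF a(1), of n] a(2)
    by (simp add: e_def chain_boundary_diff)
  with e have 1: "singular_relboundary p (top_of_set (A \<inter> B)) {} ((singular_subdivision p ^^ n) c)"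
    by (auto simp: singular_boundary)
  have 2: "singular_relboundary p (top_of_set (A \<inter> B)) {} ((singular_subdivision p ^^ n) c - c)"
    by (rule subdivision_power_homologous [OF c])
  show ?thesis
    using singular_relboundary_diff [OF 1 2] by simp
qed

text \<open>\<open>c\<close> bounds in the union. The part in \<open>B\<close> of a split filling
  has a boundary that lies in \<open>B\<close> by construction and in \<open>A\<close> because it is
  homologous to \<open>c\<close> through the other part.\<close>

lemma Mayer_Vietoris_surjective:
  assumes "open A" "open B" and van: "vanishing_homology p (A \<union> B)"
    and c: "singular_relcycle p (top_of_set A) {} c"
  obtains c' where "singular_relcycle p (top_of_set (A \<inter> B)) {} c'"
    "singular_relboundary p (top_of_set A) {} (c - c')"
proof -
  have "singular_relcycle p (top_of_set (A \<union> B)) {} c"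
    by (rule singular_cycle_mono [OF c]) auto
  then obtain d where d: "singular_chain (Suc p) (top_of_set (A \<union> B)) d" "chain_boundary (Suc p) d = c"
    using van by (auto simp: vanishing_homology_def singular_boundary)
  obtain n dA dB where dA: "singular_chain (Suc p) (top_of_set A) dA"
      and dB: "singular_chain (Suc p) (top_of_set B) dB"
      and dd: "(singular_subdivision (Suc p) ^^ n) d = dA + dB"
    by (rule subdivided_chain_split [OF assms(1,2) d(1)])
  let ?S = "singular_subdivision p ^^ n"
  have sum: "chain_boundary (Suc p) dA + chain_boundary (Suc p) dB = ?S c"
    using chain_boundary_subdivision_power [OF d(1), of n] d(2) dd
    by (simp add: chain_boundary_add)
  define c' where "c' = chain_boundary (Suc p) dB"
  have eq: "c' = ?S c - chain_boundary (Suc p) dA"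
    using sum by (simp add: c'_def algebra_simps)
  have "singular_chain p (top_of_set A) c'"
    unfolding eq using c
    by (intro singular_chain_diff singular_chain_subdivision_power singular_chain_boundary_alt dA)
      (simp add: singular_cycle)
  moreover have "singular_chain p (top_of_set B) c'"
    unfolding c'_def by (intro singular_chain_boundary_alt dB)
  ultimately have "singular_chain p (top_of_set (A \<inter> B)) c'"
    by (rule singular_chain_Int)
  moreover have "chain_boundary p c' = 0"
    using chain_boundary_boundary [OF dB] by (simp add: c'_def)
  ultimately have cyc: "singular_relcycle p (top_of_set (A \<inter> B)) {} c'"
    by (simp add: singular_cycle)
  have 1: "singular_relboundary p (top_of_set A) {} (?S c - c)"
    by (rule subdivision_power_homologous [OF c])
  have 2: "singular_relboundary p (top_of_set A) {} (chain_boundary (Suc p) dA)"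
    using dA by (auto simp: singular_boundary)
  have "singular_relboundary p (top_of_set A) {} (chain_boundary (Suc p) dA - (?S c - c))"
    by (rule singular_relboundary_diff [OF 2 1])
  then show thesis
    using that [OF cyc] by (simp add: eq algebra_simps)
qed

text \<open>The connecting homomorphism: the boundary of one half of a split cycle is a cycle of the
  intersection, and a filling \<open>e\<close> of it closes up both halves.\<close>

lemma vanishing_homology_Un:
  assumes "open A" "open B" "vanishing_homology (Suc p) A" "vanishing_homology (Suc p) B"
    and van: "vanishing_homology p (A \<inter> B)"
  shows "vanishing_homology (Suc p) (A \<union> B)"
  unfolding vanishing_homology_def
proof (intro allI impI)
  fix z assume z: "singular_relcycle (Suc p) (top_of_set (A \<union> B)) {} z"
  then have zc: "singular_chain (Suc p) (top_of_set (A \<union> B)) z" "chain_boundary (Suc p) z = 0"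
    by (auto simp: singular_cycle)
  obtain n a b where a: "singular_chain (Suc p) (top_of_set A) a"
      and b: "singular_chain (Suc p) (top_of_set B) b"
      and ab: "(singular_subdivision (Suc p) ^^ n) z = a + b"
    by (rule subdivided_chain_split [OF assms(1,2) zc(1)])
  have s: "chain_boundary (Suc p) a + chain_boundary (Suc p) b = 0"
    using chain_boundary_subdivision_power [OF zc(1), of n] zc(2) ab
    by (simp add: chain_boundary_add)
  then have eq: "chain_boundary (Suc p) a = - chain_boundary (Suc p) b"
    by (simp add: eq_neg_iff_add_eq_0)
  have "singular_chain p (top_of_set (A \<inter> B)) (chain_boundary (Suc p) a)"
  proof (rule singular_chain_Int)
    show "singular_chain p (top_of_set A) (chain_boundary (Suc p) a)"
      by (intro singular_chain_boundary_alt a)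
    show "singular_chain p (top_of_set B) (chain_boundary (Suc p) a)"
      unfolding eq singular_chain_minus by (intro singular_chain_boundary_alt b)
  qed
  moreover have "chain_boundary p (chain_boundary (Suc p) a) = 0"
    using chain_boundary_boundary [OF a] by simp
  ultimately have "singular_relboundary p (top_of_set (A \<inter> B)) {} (chain_boundary (Suc p) a)"
    using van by (simp add: vanishing_homology_def singular_cycle)
  then obtain e where e: "singular_chain (Suc p) (top_of_set (A \<inter> B)) e"
      "chain_boundary (Suc p) e = chain_boundary (Suc p) a"
    by (auto simp: singular_boundary)
  have eA: "singular_chain (Suc p) (top_of_set A) e" and eB: "singular_chain (Suc p) (top_of_set B) e"
    by (rule singular_chain_mono [OF e(1)]; blast)+
  have "singular_relboundary (Suc p) (top_of_set A) {} (a - e)"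
    using assms(3) a eA e(2)
    by (simp add: vanishing_homology_def singular_cycle chain_boundary_diff singular_chain_diff)
  then have 1: "singular_relboundary (Suc p) (top_of_set (A \<union> B)) {} (a - e)"
    using singular_boundary_mono [of A "A \<union> B"] by blast
  have "singular_relboundary (Suc p) (top_of_set B) {} (b + e)"
    using assms(4) b eB e(2) s
    by (simp add: vanishing_homology_def singular_cycle chain_boundary_add singular_chain_add add.commute)
  then have 2: "singular_relboundary (Suc p) (top_of_set (A \<union> B)) {} (b + e)"
    using singular_boundary_mono [of B "A \<union> B"] by blast
  have "singular_relboundary (Suc p) (top_of_set (A \<union> B)) {} ((a - e) + (b + e))"
    by (rule singular_relboundary_add [OF 1 2])
  then have 3: "singular_relboundary (Suc p) (top_of_set (A \<union> B)) {} ((singular_subdivision (Suc p) ^^ n) z)"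
    by (simp add: ab)
  show "singular_relboundary (Suc p) (top_of_set (A \<union> B)) {} z"
    using singular_relboundary_diff [OF 3 subdivision_power_homologous [OF z, of n]] by simp
qed

subsection \<open>Cochains on based loops\<close>

text \<open>The weights are added, not selected by nested conditionals, so that \<open>i = j\<close>
  gives the constant path at vertex \<open>i\<close>.\<close>

definition simplex_edge :: "((nat \<Rightarrow> real) \<Rightarrow> 'a) \<Rightarrow> nat \<Rightarrow> nat \<Rightarrow> real \<Rightarrow> 'a" where
  "simplex_edge \<sigma> i j = (\<lambda>t. \<sigma> (\<lambda>k. (if k = i then 1 - t else 0) + (if k = j then t else 0)))"

text \<open>Restricted because singular simplices are extensional functions on the standard
  simplex.\<close>

definition path_simplex :: "(real \<Rightarrow> 'a) \<Rightarrow> (nat \<Rightarrow> real) \<Rightarrow> 'a" where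
  "path_simplex g = restrict (\<lambda>x. g (x 1)) (standard_simplex 1)"

lemma continuous_on_singular_simplex:
  assumes "singular_simplex p (top_of_set Y) \<sigma>"
  shows "continuous_on (standard_simplex p) \<sigma>" "\<sigma> ` standard_simplex p \<subseteq> Y"
  using assms by (auto simp: singular_simplex_def euclidean_product_topology continuous_map_in_subtopology)

lemma singular_simplexI:
  assumes "continuous_on (standard_simplex p) f" "f ` standard_simplex p \<subseteq> Y"
  shows "singular_simplex p (top_of_set Y) (restrict f (standard_simplex p))"
proof -
  have "continuous_on (standard_simplex p) (restrict f (standard_simplex p))"
    using assms(1) by (rule continuous_on_eq) simp
  then show ?thesis
    using assms(2) by (auto simp: singular_simplex_def euclidean_product_topology continuous_map_in_subtopology)
qed

lemma continuous_on_proj_simplex: "continuous_on S (\<lambda>x::nat \<Rightarrow> real. x i)"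
  by (rule continuous_on_subset [OF continuous_on_product_coordinates]) simp

lemma edge_point_in_simplex:
  assumes "t \<in> {0..1}" "i \<le> p" "j \<le> p"
  shows "(\<lambda>k. (if k = i then 1 - t else 0) + (if k = j then t else 0)) \<in> standard_simplex p"
  using assms by (auto simp: standard_simplex_def sum.distrib)

lemma edge_singular_face:
  assumes "t \<in> {0..1}" "i < p" "j < p"
  shows "simplex_edge (singular_face p k \<sigma>) i j t =
    simplex_edge \<sigma> (if i < k then i else Suc i) (if j < k then j else Suc j) t"
proof -
  let ?q = "\<lambda>k. (if k = i then 1 - t else 0) + (if k = j then t else 0)"
  have "?q \<in> standard_simplex (p - Suc 0)"
    using assms by (intro edge_point_in_simplex) auto
  moreover have "simplical_face k ?q = (\<lambda>m. (if m = (if i < k then i else Suc i) then 1 - t else 0) +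
      (if m = (if j < k then j else Suc j) then t else 0))"
    by (rule ext) (auto simp: simplical_face_def)
  ultimately show ?thesis
    by (simp add: simplex_edge_def singular_face_def)
qed

lemma continuous_on_if_const:
  "continuous_on S f \<Longrightarrow> continuous_on S g \<Longrightarrow> continuous_on S (\<lambda>x. if b then f x else g x)"
  by (cases b) auto

text \<open>In the convex triangle \<open>T\<close> two sides are homotopic to the third; the affine
  map \<open>tri\<close> carries the corners of \<open>T\<close> to the vertices \<open>i\<close>,
  \<open>j\<close> and \<open>l\<close>.\<close>

lemma edges_homotopic:
  fixes Y :: "'a::real_normed_vector set"
  assumes \<sigma>: "singular_simplex p (top_of_set Y) \<sigma>" and ij: "i \<le> p" "j \<le> p" "l \<le> p"
  shows "homotopic_paths Y (simplex_edge \<sigma> i j +++ simplex_edge \<sigma> j l) (simplex_edge \<sigma> i l)"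
proof -
  define T where "T = {z::real \<times> real. 0 \<le> fst z \<and> 0 \<le> snd z \<and> fst z + snd z \<le> 1}"
  define tri where "tri = (\<lambda>z::real\<times>real. \<lambda>k. (if k = i then 1 - fst z - snd z else 0) +
     (if k = j then fst z else 0) + (if k = l then snd z else 0))"
  have "convex T"
  proof (rule convexI)
    fix x y :: "real \<times> real" and u v :: real
    assume xy: "x \<in> T" "y \<in> T" and uv: "0 \<le> u" "0 \<le> v" "u + v = 1"
    have "u * (fst x + snd x) \<le> u" "v * (fst y + snd y) \<le> v"
      using xy uv by (auto simp: T_def intro: mult_left_le)
    then have "u * fst x + v * fst y + (u * snd x + v * snd y) \<le> 1"
      using uv by (simp add: distrib_left)
    then show "u *\<^sub>R x + v *\<^sub>R y \<in> T"
      using xy uv by (simp add: T_def)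
  qed
  have tri_in: "tri z \<in> standard_simplex p" if "z \<in> T" for z
    using that ij by (auto simp: standard_simplex_def tri_def T_def sum.distrib)
  have "continuous_on T tri"
    unfolding tri_def by (intro continuous_on_coordinatewise_then_product continuous_intros continuous_on_if_const)
  then have cont: "continuous_on T (\<sigma> \<circ> tri)"
    using continuous_on_singular_simplex [OF \<sigma>] tri_in
    by (intro continuous_on_compose) (auto intro: continuous_on_subset)
  have im: "\<sigma> \<circ> tri \<in> T \<rightarrow> Y"
    using continuous_on_singular_simplex [OF \<sigma>] tri_in by auto
  let ?A = "linepath (0,0) (1,0) :: real \<Rightarrow> real \<times> real" and ?B = "linepath (1,0) (0,1) :: real \<Rightarrow> real \<times> real"
  let ?C = "linepath (0,0) (0,1) :: real \<Rightarrow> real \<times> real"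
  have pts: "(0,0) \<in> T" "(1,0) \<in> T" "(0,1) \<in> T"
    by (auto simp: T_def)
  have seg: "closed_segment x y \<subseteq> T" if "x \<in> T" "y \<in> T" for x y
    using that \<open>convex T\<close> by (simp add: closed_segment_subset)
  have "path_image (?A +++ ?B) \<subseteq> T" "path_image ?C \<subseteq> T"
    using seg pts by (auto simp: path_image_join path_image_linepath)
  then have "homotopic_paths T (?A +++ ?B) ?C"
    by (intro homotopic_paths_linear seg) (auto simp: path_image_def)
  then have "homotopic_paths Y ((\<sigma> \<circ> tri) \<circ> (?A +++ ?B)) ((\<sigma> \<circ> tri) \<circ> ?C)"
    by (rule homotopic_paths_continuous_image [OF _ cont im])
  moreover have "(\<sigma> \<circ> tri) \<circ> ?A = simplex_edge \<sigma> i j" "(\<sigma> \<circ> tri) \<circ> ?B = simplex_edge \<sigma> j l"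
    "(\<sigma> \<circ> tri) \<circ> ?C = simplex_edge \<sigma> i l"
    by (auto simp: fun_eq_iff simplex_edge_def tri_def linepath_def intro!: arg_cong [of _ _ \<sigma>])
  ultimately show ?thesis
    by (simp add: path_compose_join)
qed

lemma simplex_edge_path:
  fixes Y :: "'a::real_normed_vector set"
  assumes "singular_simplex p (top_of_set Y) \<sigma>" "i \<le> p" "j \<le> p"
  shows "path (simplex_edge \<sigma> i j)" "path_image (simplex_edge \<sigma> i j) \<subseteq> Y"
    "pathstart (simplex_edge \<sigma> i j) = simplex_edge \<sigma> i i 0"
    "pathfinish (simplex_edge \<sigma> i j) = simplex_edge \<sigma> j j 0"
proof -
  have "homotopic_paths Y (simplex_edge \<sigma> i j +++ simplex_edge \<sigma> j j) (simplex_edge \<sigma> i j)"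
    by (rule edges_homotopic [OF assms(1)]) (use assms in auto)
  then show "path (simplex_edge \<sigma> i j)" "path_image (simplex_edge \<sigma> i j) \<subseteq> Y"
    using homotopic_paths_imp_path homotopic_paths_imp_subset by blast+
  show "pathstart (simplex_edge \<sigma> i j) = simplex_edge \<sigma> i i 0"
    by (auto simp: simplex_edge_def pathstart_def intro!: arg_cong [of _ _ \<sigma>])
  show "pathfinish (simplex_edge \<sigma> i j) = simplex_edge \<sigma> j j 0"
    by (auto simp: simplex_edge_def pathfinish_def intro!: arg_cong [of _ _ \<sigma>])
qed

lemma singular_simplex_path_simplex:
  assumes "path g" "path_image g \<subseteq> Y"
  shows "singular_simplex 1 (top_of_set Y) (path_simplex g)"
  unfolding path_simplex_def
proof (rule singular_simplexI)
  have im: "(\<lambda>x. x 1) ` standard_simplex 1 \<subseteq> {0..1::real}"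
    by (auto simp: standard_simplex_def)
  show "continuous_on (standard_simplex 1) (\<lambda>x. g (x 1))"
    using assms(1) im unfolding path_def
    by (rule continuous_on_compose2 [OF _ continuous_on_proj_simplex])
  show "(\<lambda>x. g (x 1)) ` standard_simplex 1 \<subseteq> Y"
    using assms(2) im by (force simp: path_image_def)
qed

lemma simplex_edge_path_simplex:
  assumes "t \<in> {0..1}"
  shows "simplex_edge (path_simplex g) 0 1 t = g t"
  using edge_point_in_simplex [OF assms, of 0 1 1] by (simp add: simplex_edge_def path_simplex_def)

section \<open>Integer cochains evaluated on singular chains\<close>

definition chain_eval :: "('s \<Rightarrow> int) \<Rightarrow> ('s \<Rightarrow>\<^sub>0 int) \<Rightarrow> int" where
  "chain_eval f c = (\<Sum>s\<in>Poly_Mapping.keys c. Poly_Mapping.lookup c s * f s)"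

lemma chain_eval_superset:
  "finite S \<Longrightarrow> Poly_Mapping.keys c \<subseteq> S \<Longrightarrow> chain_eval f c = (\<Sum>s\<in>S. Poly_Mapping.lookup c s * f s)"
  unfolding chain_eval_def by (rule sum.mono_neutral_left) (auto simp: in_keys_iff)

lemma chain_eval_0 [simp]: "chain_eval f 0 = 0"
  by (simp add: chain_eval_def)

lemma chain_eval_of [simp]: "chain_eval f (frag_of s) = f s"
  by (simp add: chain_eval_def)

lemma chain_eval_diff: "chain_eval f (a - b) = chain_eval f a - chain_eval f b"
proof -
  let ?S = "Poly_Mapping.keys a \<union> Poly_Mapping.keys b"
  have "chain_eval f (a - b) = (\<Sum>s\<in>?S. Poly_Mapping.lookup (a - b) s * f s)"
    "chain_eval f a = (\<Sum>s\<in>?S. Poly_Mapping.lookup a s * f s)"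
    "chain_eval f b = (\<Sum>s\<in>?S. Poly_Mapping.lookup b s * f s)"
    by (rule chain_eval_superset; use keys_diff [of a b] in auto)+
  then show ?thesis
    by (simp add: lookup_minus left_diff_distrib sum_subtractf)
qed

lemma chain_eval_minus: "chain_eval f (- a) = - chain_eval f a"
  using chain_eval_diff [of f 0 a] by simp

lemma chain_eval_add: "chain_eval f (a + b) = chain_eval f a + chain_eval f b"
  using chain_eval_diff [of f a "- b"] by (simp add: chain_eval_minus)

lemma chain_eval_cmul: "chain_eval f (frag_cmul k a) = k * chain_eval f a"
proof -
  have "chain_eval f (frag_cmul k a) = (\<Sum>s\<in>Poly_Mapping.keys a. Poly_Mapping.lookup (frag_cmul k a) s * f s)"
    by (rule chain_eval_superset) (auto simp: keys_cmul)
  then show ?thesis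
    by (simp add: chain_eval_def sum_distrib_left mult.assoc)
qed

lemma chain_eval_sum: "chain_eval f (\<Sum>i\<in>I. g i) = (\<Sum>i\<in>I. chain_eval f (g i))"
  by (induction I rule: infinite_finite_induct) (auto simp: chain_eval_add)

lemma chain_eval_boundary_zero:
  assumes "singular_chain p X c"
    and "\<And>\<sigma>. singular_simplex p X \<sigma> \<Longrightarrow> chain_eval f (chain_boundary p (frag_of \<sigma>)) = 0"
  shows "chain_eval f (chain_boundary p c) = 0"
  using assms(1) unfolding singular_chain_def
proof (induction rule: frag_induction)
  case (one x)
  then show ?case using assms(2) by simp
next
  case (diff a b)
  then show ?case by (simp add: chain_boundary_diff chain_eval_diff)
qed auto

section \<open>Based loops and functions on them with prescribed coboundary\<close>

definition loops :: "'a::topological_space set \<Rightarrow> 'a \<Rightarrow> (real \<Rightarrow> 'a) set" where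
  "loops Y a = {g. path g \<and> path_image g \<subseteq> Y \<and> pathstart g = a \<and> pathfinish g = a}"

lemma loops_join: "u \<in> loops Y a \<Longrightarrow> v \<in> loops Y a \<Longrightarrow> u +++ v \<in> loops Y a"
  by (auto simp: loops_def path_image_join)

lemma loops_reverse: "u \<in> loops Y a \<Longrightarrow> reversepath u \<in> loops Y a"
  by (auto simp: loops_def)

lemma loops_const: "a \<in> Y \<Longrightarrow> linepath a a \<in> loops Y a"
  by (auto simp: loops_def)

lemma loops_base: "u \<in> loops Y a \<Longrightarrow> a \<in> Y"
  by (auto simp: loops_def)

lemma loops_homotopic: "homotopic_paths Y u v \<Longrightarrow> u \<in> loops Y a \<Longrightarrow> v \<in> loops Y a"
  unfolding loops_def
  by (simp add: homotopic_paths_imp_path homotopic_paths_imp_subset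
      homotopic_paths_imp_pathstart [symmetric] homotopic_paths_imp_pathfinish [symmetric])

text \<open>Up to sign, \<open>\<phi>\<close> is the coboundary of the cochain \<open>F\<close> on the fundamental group. Letting \<open>w\<close> range over a
  homotopy class builds the homotopy invariance of \<open>F\<close> into the condition.\<close>

definition crossed :: "'a::topological_space set \<Rightarrow> 'a \<Rightarrow> ((real \<Rightarrow> 'a) \<Rightarrow> (real \<Rightarrow> 'a) \<Rightarrow> int) \<Rightarrow> ((real \<Rightarrow> 'a) \<Rightarrow> int) \<Rightarrow> bool"
  where "crossed Y a \<phi> F \<longleftrightarrow>
    (\<forall>u\<in>loops Y a. \<forall>v\<in>loops Y a. \<forall>w. homotopic_paths Y (u +++ v) w \<longrightarrow> F w = F u + F v + \<phi> u v)"

definition normalised :: "'a::real_normed_vector set \<Rightarrow> 'a \<Rightarrow> ((real \<Rightarrow> 'a) \<Rightarrow> (real \<Rightarrow> 'a) \<Rightarrow> int) \<Rightarrow> bool"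
  where "normalised Y a \<phi> \<longleftrightarrow> (\<forall>u\<in>loops Y a. \<phi> u (linepath a a) = 0 \<and> \<phi> (linepath a a) u = 0)"

text \<open>The inhomogeneous 2-cocycles of the fundamental group. Homotopy invariance is a separate
  clause because the arguments are loops, not classes.\<close>

definition loop_cocycle :: "'a::real_normed_vector set \<Rightarrow> 'a \<Rightarrow> ((real \<Rightarrow> 'a) \<Rightarrow> (real \<Rightarrow> 'a) \<Rightarrow> int) \<Rightarrow> bool"
  where "loop_cocycle Y a \<phi> \<longleftrightarrow> normalised Y a \<phi> \<and>
    (\<forall>u\<in>loops Y a. \<forall>v\<in>loops Y a. \<forall>u' v'. homotopic_paths Y u u' \<longrightarrow> homotopic_paths Y v v' \<longrightarrow> \<phi> u' v' = \<phi> u v) \<and>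
    (\<forall>u\<in>loops Y a. \<forall>v\<in>loops Y a. \<forall>w\<in>loops Y a.
       \<phi> v w - \<phi> (u +++ v) w + \<phi> u (v +++ w) - \<phi> u v = 0)"

lemma crossed_const:
  assumes "crossed Y a \<phi> F" "normalised Y a \<phi>" "a \<in> Y"
  shows "F (linepath a a) = 0"
proof -
  have c: "linepath a a \<in> loops Y a" using assms loops_const by blast
  have "homotopic_paths Y (linepath a a +++ linepath a a) (linepath a a)"
    using c homotopic_paths_lid [of "linepath a a" Y] by (auto simp: loops_def)
  then have "F (linepath a a) = F (linepath a a) + F (linepath a a) + \<phi> (linepath a a) (linepath a a)"
    using assms(1) c unfolding crossed_def by blast
  then show ?thesis
    using assms(2) c by (simp add: normalised_def)
qed

lemma crossed_homotopic:
  assumes F: "crossed Y a \<phi> F" and \<phi>: "normalised Y a \<phi>" and u: "u \<in> loops Y a" and uv: "homotopic_paths Y u v"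
  shows "F v = F u"
proof -
  have a: "a \<in> Y" using u loops_base by blast
  have "homotopic_paths Y (u +++ linepath a a) u"
    using u homotopic_paths_rid [of u Y] by (auto simp: loops_def)
  then have "homotopic_paths Y (u +++ linepath a a) v"
    using uv homotopic_paths_trans by blast
  then have "F v = F u + F (linepath a a) + \<phi> u (linepath a a)"
    using F u loops_const [OF a] unfolding crossed_def by blast
  then show ?thesis
    using crossed_const [OF F \<phi> a] \<phi> u by (simp add: normalised_def)
qed

lemma crossed_join:
  assumes "crossed Y a \<phi> F" "u \<in> loops Y a" "v \<in> loops Y a"
  shows "F (u +++ v) = F u + F v + \<phi> u v"
proof -
  have "u +++ v \<in> loops Y a" using assms loops_join by blast
  then have "homotopic_paths Y (u +++ v) (u +++ v)" by (auto simp: loops_def)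
  then show ?thesis using assms unfolding crossed_def by blast
qed

section \<open>Closing up paths to based loops\<close>

definition reachable :: "'a::real_normed_vector set \<Rightarrow> 'a \<Rightarrow> 'a \<Rightarrow> bool" where
  "reachable Y a x \<longleftrightarrow> (\<exists>g. path g \<and> path_image g \<subseteq> Y \<and> pathstart g = a \<and> pathfinish g = x)"

text \<open>The constant path is prescribed at \<open>x = a\<close> so that \<open>based\<close>
  alters a loop at \<open>a\<close> only by a homotopy.\<close>

definition connector :: "'a::real_normed_vector set \<Rightarrow> 'a \<Rightarrow> 'a \<Rightarrow> real \<Rightarrow> 'a" where
  "connector Y a x = (if x = a then linepath a a else
     SOME g. path g \<and> path_image g \<subseteq> Y \<and> pathstart g = a \<and> pathfinish g = x)"

definition based :: "'a::real_normed_vector set \<Rightarrow> 'a \<Rightarrow> (real \<Rightarrow> 'a) \<Rightarrow> real \<Rightarrow> 'a" where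
  "based Y a e = connector Y a (pathstart e) +++ (e +++ reversepath (connector Y a (pathfinish e)))"

lemma connector:
  assumes "reachable Y a x"
  shows "path (connector Y a x)" "path_image (connector Y a x) \<subseteq> Y"
    "pathstart (connector Y a x) = a" "pathfinish (connector Y a x) = x"
proof -
  have "a \<in> Y" using assms by (auto simp: reachable_def)
  let ?P = "\<lambda>g. path g \<and> path_image g \<subseteq> Y \<and> pathstart g = a \<and> pathfinish g = x"
  have "?P (connector Y a x)"
  proof (cases "x = a")
    case True then show ?thesis using \<open>a \<in> Y\<close> by (auto simp: connector_def)
  next
    case False
    have "?P (SOME g. ?P g)" using assms unfolding reachable_def by (rule someI_ex)
    then show ?thesis using False by (simp add: connector_def)
  qed
  then show "path (connector Y a x)" "path_image (connector Y a x) \<subseteq> Y"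
    "pathstart (connector Y a x) = a" "pathfinish (connector Y a x) = x" by auto
qed

lemma reachable_along:
  assumes "path e" "path_image e \<subseteq> Y" "reachable Y a (pathstart e)"
  shows "reachable Y a (pathfinish e)"
proof -
  obtain g where "path g" "path_image g \<subseteq> Y" "pathstart g = a" "pathfinish g = pathstart e"
    using assms(3) by (auto simp: reachable_def)
  then show ?thesis
    unfolding reachable_def using assms
    by (intro exI [of _ "g +++ e"]) (auto simp: path_image_join)
qed

lemma reachable_base: "a \<in> Y \<Longrightarrow> reachable Y a a"
  unfolding reachable_def by (intro exI [of _ "linepath a a"]) auto

lemma based_in_loops:
  assumes "path e" "path_image e \<subseteq> Y" "reachable Y a (pathstart e)"
  shows "based Y a e \<in> loops Y a"
  using connector [OF assms(3)] connector [OF reachable_along [OF assms]] assms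
  by (auto simp: based_def loops_def path_image_join)

lemma based_homotopic:
  assumes "homotopic_paths Y e e'" "reachable Y a (pathstart e)"
  shows "homotopic_paths Y (based Y a e) (based Y a e')"
proof -
  have e: "path e" "path_image e \<subseteq> Y" "pathstart e' = pathstart e" "pathfinish e' = pathfinish e"
    using assms(1) homotopic_paths_imp_path homotopic_paths_imp_subset homotopic_paths_imp_pathstart
      homotopic_paths_imp_pathfinish by fastforce+
  note c0 = connector [OF assms(2)] and c1 = connector [OF reachable_along [OF e(1,2) assms(2)]]
  show ?thesis
    unfolding based_def e(3,4) using e c0 c1 assms(1)
    by (intro homotopic_paths_join) auto
qed

lemma homotopic_paths_cancel_middle:
  fixes Y :: "'a::real_normed_vector set"
  assumes "path p" "path q" "path r" "path_image p \<subseteq> Y" "path_image q \<subseteq> Y" "path_image r \<subseteq> Y"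
    "pathfinish p = pathfinish q" "pathfinish q = pathstart r"
  shows "homotopic_paths Y ((p +++ reversepath q) +++ (q +++ r)) (p +++ r)"
proof -
  have "homotopic_paths Y (reversepath q +++ (q +++ r)) ((reversepath q +++ q) +++ r)"
    using assms by (intro homotopic_paths_assoc) auto
  also have "homotopic_paths Y \<dots> (linepath (pathfinish q) (pathfinish q) +++ r)"
    using assms by (intro homotopic_paths_join homotopic_paths_linv) auto
  also have "homotopic_paths Y \<dots> r"
    using homotopic_paths_lid [of r Y] assms by simp
  finally have 1: "homotopic_paths Y (reversepath q +++ (q +++ r)) r" .
  have "homotopic_paths Y ((p +++ reversepath q) +++ (q +++ r)) (p +++ (reversepath q +++ (q +++ r)))"
    using assms by (subst homotopic_paths_sym_eq, intro homotopic_paths_assoc) (auto simp: path_image_join)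
  also have "homotopic_paths Y \<dots> (p +++ r)"
    using assms by (intro homotopic_paths_join 1) auto
  finally show ?thesis .
qed

text \<open>The connector to the common end point is run back and forth and cancels.\<close>

lemma based_join:
  assumes e: "path e" "path_image e \<subseteq> Y" and e': "path e'" "path_image e' \<subseteq> Y"
    and "pathfinish e = pathstart e'" and r: "reachable Y a (pathstart e)"
  shows "homotopic_paths Y (based Y a e +++ based Y a e') (based Y a (e +++ e'))"
proof -
  let ?g0 = "connector Y a (pathstart e)" and ?g1 = "connector Y a (pathfinish e)"
  let ?g2 = "connector Y a (pathfinish e')"
  have r1: "reachable Y a (pathfinish e)" using reachable_along [OF e r] .
  have r2: "reachable Y a (pathfinish e')" using reachable_along [OF e'] r1 assms by simp
  note c0 = connector [OF r] and c1 = connector [OF r1] and c2 = connector [OF r2]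
  note facts = e e' assms(5) c0 c1 c2
  let ?R = "e' +++ reversepath ?g2"
  have "homotopic_paths Y (?g0 +++ (e +++ reversepath ?g1)) ((?g0 +++ e) +++ reversepath ?g1)"
    using facts by (intro homotopic_paths_assoc) auto
  then have "homotopic_paths Y (based Y a e +++ based Y a e') (((?g0 +++ e) +++ reversepath ?g1) +++ (?g1 +++ ?R))"
    unfolding based_def by (rule homotopic_paths_join) (use facts in \<open>auto simp: path_image_join\<close>)
  also have "homotopic_paths Y \<dots> ((?g0 +++ e) +++ ?R)"
    using facts by (intro homotopic_paths_cancel_middle) (auto simp: path_image_join)
  also have "homotopic_paths Y \<dots> (?g0 +++ (e +++ ?R))"
    using facts by (subst homotopic_paths_sym_eq, intro homotopic_paths_assoc) (auto simp: path_image_join)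
  also have "homotopic_paths Y \<dots> (?g0 +++ ((e +++ e') +++ reversepath ?g2))"
    using facts by (intro homotopic_paths_join homotopic_paths_assoc) (auto simp: path_image_join)
  finally show ?thesis
    by (simp add: based_def)
qed

lemma based_loop:
  assumes "u \<in> loops Y a"
  shows "homotopic_paths Y (based Y a u) u"
proof -
  have u: "path u" "path_image u \<subseteq> Y" "pathstart u = a" "pathfinish u = a"
    using assms by (auto simp: loops_def)
  have a: "a \<in> Y" using assms loops_base by blast
  have "homotopic_paths Y (u +++ linepath a a) u"
    using homotopic_paths_rid [of u Y] u by simp
  then have "homotopic_paths Y (linepath a a +++ (u +++ linepath a a)) (linepath a a +++ u)"
    using u a by (intro homotopic_paths_join) auto
  also have "homotopic_paths Y \<dots> u"
    using homotopic_paths_lid [of u Y] u by simp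
  finally show ?thesis
    using u by (simp add: based_def connector_def)
qed

lemma based_eq_loop:
  assumes u: "u \<in> loops Y a" and eq: "\<And>t. t \<in> {0..1} \<Longrightarrow> e t = u t"
  shows "homotopic_paths Y u (based Y a e)"
proof -
  have ue: "homotopic_paths Y u e"
    using u eq by (intro homotopic_paths_eq) (auto simp: loops_def)
  have "reachable Y a (pathstart u)"
    using u loops_base [OF u] reachable_base by (auto simp: loops_def)
  then have "homotopic_paths Y (based Y a u) (based Y a e)"
    by (rule based_homotopic [OF ue])
  then show ?thesis
    using based_loop [OF u] homotopic_paths_sym homotopic_paths_trans by blast
qed

abbreviation based_edge :: "'a::real_normed_vector set \<Rightarrow> 'a \<Rightarrow> ((nat \<Rightarrow> real) \<Rightarrow> 'a) \<Rightarrow> nat \<Rightarrow> nat \<Rightarrow> real \<Rightarrow> 'a" where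
  "based_edge Y a \<sigma> i j \<equiv> based Y a (simplex_edge \<sigma> i j)"

abbreviation simplex_vertex :: "((nat \<Rightarrow> real) \<Rightarrow> 'a) \<Rightarrow> nat \<Rightarrow> 'a" where
  "simplex_vertex \<sigma> i \<equiv> simplex_edge \<sigma> i i 0"

lemma reachable_vertices:
  fixes Y :: "'a::real_normed_vector set"
  assumes "singular_simplex p (top_of_set Y) \<sigma>" "i \<le> p" "j \<le> p" "reachable Y a (simplex_vertex \<sigma> i)"
  shows "reachable Y a (simplex_vertex \<sigma> j)"
  using reachable_along [OF simplex_edge_path(1,2) [OF assms(1-3)]] assms(4)
    simplex_edge_path(3,4) [OF assms(1-3)] by simp

lemma based_edge_in_loops:
  assumes "singular_simplex p (top_of_set Y) \<sigma>" "i \<le> p" "j \<le> p" "reachable Y a (simplex_vertex \<sigma> i)"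
  shows "based_edge Y a \<sigma> i j \<in> loops Y a"
  using assms simplex_edge_path [OF assms(1-3)] by (intro based_in_loops) auto

lemma based_edges_homotopic:
  assumes \<sigma>: "singular_simplex p (top_of_set Y) \<sigma>" and "i \<le> p" "j \<le> p" "l \<le> p"
    and r: "reachable Y a (simplex_vertex \<sigma> i)"
  shows "homotopic_paths Y (based_edge Y a \<sigma> i j +++ based_edge Y a \<sigma> j l) (based_edge Y a \<sigma> i l)"
proof -
  note ij = simplex_edge_path [OF \<sigma> assms(2,3)] and jl = simplex_edge_path [OF \<sigma> assms(3,4)]
  have "homotopic_paths Y (based_edge Y a \<sigma> i j +++ based_edge Y a \<sigma> j l)
      (based Y a (simplex_edge \<sigma> i j +++ simplex_edge \<sigma> j l))"
    using ij jl r by (intro based_join) auto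
  also have "homotopic_paths Y \<dots> (based_edge Y a \<sigma> i l)"
    using ij r by (intro based_homotopic edges_homotopic [OF \<sigma>] assms) auto
  finally show ?thesis .
qed

lemma based_edge_face:
  assumes \<sigma>: "singular_simplex p (top_of_set Y) \<sigma>" and "k \<le> p" "i < p" "j < p"
    and "i' = (if i < k then i else Suc i)" "j' = (if j < k then j else Suc j)"
    and r: "reachable Y a (simplex_vertex \<sigma> i')"
  shows "homotopic_paths Y (based_edge Y a \<sigma> i' j') (based_edge Y a (singular_face p k \<sigma>) i j)"
    and "reachable Y a (simplex_vertex (singular_face p k \<sigma>) i)"
proof -
  have ij': "i' \<le> p" "j' \<le> p" using assms by auto
  show "homotopic_paths Y (based_edge Y a \<sigma> i' j') (based_edge Y a (singular_face p k \<sigma>) i j)"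
  proof (rule based_homotopic)
    show "homotopic_paths Y (simplex_edge \<sigma> i' j') (simplex_edge (singular_face p k \<sigma>) i j)"
      using simplex_edge_path [OF \<sigma> ij'] assms
      by (intro homotopic_paths_eq) (auto simp: edge_singular_face)
    show "reachable Y a (pathstart (simplex_edge \<sigma> i' j'))"
      using r simplex_edge_path [OF \<sigma> ij'] by simp
  qed
  show "reachable Y a (simplex_vertex (singular_face p k \<sigma>) i)"
    using r assms by (simp add: edge_singular_face)
qed

text \<open>Makes it consistent to extend cochains by zero to simplices outside the path component
  of the base point.\<close>

lemma reachable_face_iff:
  assumes "singular_simplex p (top_of_set Y) \<sigma>" "k \<le> p" "0 < p"
  shows "reachable Y a (simplex_vertex (singular_face p k \<sigma>) 0) \<longleftrightarrow> reachable Y a (simplex_vertex \<sigma> 0)"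
  using reachable_vertices [OF assms(1), of 0 1 a] reachable_vertices [OF assms(1), of 1 0 a] assms
  by (auto simp: edge_singular_face)

section \<open>Singular cochains from functions on loops\<close>

definition edge_cochain :: "'a::real_normed_vector set \<Rightarrow> 'a \<Rightarrow> ((real \<Rightarrow> 'a) \<Rightarrow> int) \<Rightarrow> ((nat \<Rightarrow> real) \<Rightarrow> 'a) \<Rightarrow> int" where
  "edge_cochain Y a F \<sigma> = (if reachable Y a (simplex_vertex \<sigma> 0) then F (based_edge Y a \<sigma> 0 1) else 0)"

text \<open>The comparison with the bar resolution: a 2-simplex becomes the pair of its first two
  edges, closed up to loops.\<close>

definition triangle_cochain :: "'a::real_normed_vector set \<Rightarrow> 'a \<Rightarrow> ((real \<Rightarrow> 'a) \<Rightarrow> (real \<Rightarrow> 'a) \<Rightarrow> int)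
    \<Rightarrow> ((nat \<Rightarrow> real) \<Rightarrow> 'a) \<Rightarrow> int" where
  "triangle_cochain Y a \<phi> \<sigma> =
     (if reachable Y a (simplex_vertex \<sigma> 0) then \<phi> (based_edge Y a \<sigma> 0 1) (based_edge Y a \<sigma> 1 2) else 0)"

abbreviation additive_on_loops :: "'a::real_normed_vector set \<Rightarrow> 'a \<Rightarrow> ((real \<Rightarrow> 'a) \<Rightarrow> int) \<Rightarrow> bool" where
  "additive_on_loops Y a \<equiv> crossed Y a (\<lambda>_ _. 0)"

lemma normalised_zero [simp]: "normalised Y a (\<lambda>_ _. 0)"
  by (simp add: normalised_def)

lemma chain_boundary_2:
  "chain_boundary 2 (frag_of \<sigma>) =
    frag_of (singular_face 2 0 \<sigma>) - frag_of (singular_face 2 1 \<sigma>) + frag_of (singular_face 2 2 \<sigma>)"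
  by (simp add: chain_boundary_of numeral_2_eq_2)

lemma chain_boundary_3:
  "chain_boundary 3 (frag_of \<sigma>) =
    frag_of (singular_face 3 0 \<sigma>) - frag_of (singular_face 3 1 \<sigma>) +
    frag_of (singular_face 3 2 \<sigma>) - frag_of (singular_face 3 3 \<sigma>)"
  by (simp add: chain_boundary_of numeral_3_eq_3 numeral_2_eq_2)

lemma edge_cochain_face:
  assumes \<sigma>: "singular_simplex 2 (top_of_set Y) \<sigma>" and "k \<le> 2"
    and r: "reachable Y a (simplex_vertex \<sigma> 0)" and F: "additive_on_loops Y a F"
    and ij: "i = (if 0 < k then 0 else 1)" "j = (if 1 < k then 1 else 2)"
  shows "edge_cochain Y a F (singular_face 2 k \<sigma>) = F (based_edge Y a \<sigma> i j)"
proof -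
  have ri: "reachable Y a (simplex_vertex \<sigma> i)"
    using reachable_vertices [OF \<sigma>, of 0 i a] r ij by simp
  have h: "homotopic_paths Y (based_edge Y a \<sigma> i j) (based_edge Y a (singular_face 2 k \<sigma>) 0 1)"
    by (rule based_edge_face(1) [OF \<sigma> assms(2)]) (use ij ri in auto)
  have "based_edge Y a \<sigma> i j \<in> loops Y a"
    by (rule based_edge_in_loops [OF \<sigma>]) (use ij ri in auto)
  then show ?thesis
    using crossed_homotopic [OF F normalised_zero _ h] reachable_face_iff [OF \<sigma> assms(2)] r
    by (simp add: edge_cochain_def)
qed

lemma edge_cochain_boundary:
  assumes \<sigma>: "singular_simplex 2 (top_of_set Y) \<sigma>" and F: "additive_on_loops Y a F"
  shows "chain_eval (edge_cochain Y a F) (chain_boundary 2 (frag_of \<sigma>)) = 0"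
proof (cases "reachable Y a (simplex_vertex \<sigma> 0)")
  case True
  note f = edge_cochain_face [OF \<sigma> _ True F]
  have l: "based_edge Y a \<sigma> 0 1 \<in> loops Y a" "based_edge Y a \<sigma> 1 2 \<in> loops Y a"
    by (rule based_edge_in_loops [OF \<sigma>]; use True reachable_vertices [OF \<sigma>, of 0 1 a] in simp)+
  have "F (based_edge Y a \<sigma> 0 2) = F (based_edge Y a \<sigma> 0 1) + F (based_edge Y a \<sigma> 1 2)"
    using F l based_edges_homotopic [OF \<sigma>, of 0 1 2 a] True by (simp add: crossed_def)
  then show ?thesis
    unfolding chain_boundary_2 chain_eval_add chain_eval_diff chain_eval_of
    by (simp add: f)
next
  case False
  then show ?thesis
    unfolding chain_boundary_2 chain_eval_add chain_eval_diff chain_eval_of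
    by (simp add: edge_cochain_def reachable_face_iff [OF \<sigma>])
qed

lemma triangle_cochain_face:
  assumes \<sigma>: "singular_simplex 3 (top_of_set Y) \<sigma>" and "k \<le> 3"
    and r: "reachable Y a (simplex_vertex \<sigma> 0)" and \<phi>: "loop_cocycle Y a \<phi>"
    and ij: "i = (if 0 < k then 0 else 1)" "j = (if 1 < k then 1 else 2)" "l = (if 2 < k then 2 else 3)"
  shows "triangle_cochain Y a \<phi> (singular_face 3 k \<sigma>) = \<phi> (based_edge Y a \<sigma> i j) (based_edge Y a \<sigma> j l)"
proof -
  have ri: "reachable Y a (simplex_vertex \<sigma> i)" "reachable Y a (simplex_vertex \<sigma> j)"
    using reachable_vertices [OF \<sigma>, of 0 i a] reachable_vertices [OF \<sigma>, of 0 j a] r ij by simp_all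
  have h: "homotopic_paths Y (based_edge Y a \<sigma> i j) (based_edge Y a (singular_face 3 k \<sigma>) 0 1)"
    "homotopic_paths Y (based_edge Y a \<sigma> j l) (based_edge Y a (singular_face 3 k \<sigma>) 1 2)"
    by (rule based_edge_face(1) [OF \<sigma> assms(2)]; use ij ri in \<open>auto simp: numeral_2_eq_2 numeral_3_eq_3\<close>)+
  have "based_edge Y a \<sigma> i j \<in> loops Y a" "based_edge Y a \<sigma> j l \<in> loops Y a"
    by (rule based_edge_in_loops [OF \<sigma>]; use ij ri in auto)+
  then show ?thesis
    using \<phi> h reachable_face_iff [OF \<sigma> assms(2)] r
    by (simp add: triangle_cochain_def loop_cocycle_def)
qed

text \<open>The four faces of a 3-simplex give the four terms of the cocycle identity, once the
  edges 02 and 13 are replaced by the homotopic concatenations.\<close>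

lemma triangle_cochain_boundary:
  assumes \<sigma>: "singular_simplex 3 (top_of_set Y) \<sigma>" and \<phi>: "loop_cocycle Y a \<phi>"
  shows "chain_eval (triangle_cochain Y a \<phi>) (chain_boundary 3 (frag_of \<sigma>)) = 0"
proof (cases "reachable Y a (simplex_vertex \<sigma> 0)")
  case True
  note f = triangle_cochain_face [OF \<sigma> _ True \<phi>]
  let ?L = "based_edge Y a \<sigma>"
  have r: "reachable Y a (simplex_vertex \<sigma> i)" if "i \<le> 3" for i
    using reachable_vertices [OF \<sigma>, of 0 i a] True that by simp
  have l: "?L i j \<in> loops Y a" if "i \<le> 3" "j \<le> 3" for i j
    by (rule based_edge_in_loops [OF \<sigma>]) (use that r in auto)
  have inv: "\<phi> u' v' = \<phi> u v" if "u \<in> loops Y a" "v \<in> loops Y a" "homotopic_paths Y u u'" "homotopic_paths Y v v'" for u v u' v'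
    using \<phi> that unfolding loop_cocycle_def by blast
  have refl: "homotopic_paths Y u u" if "u \<in> loops Y a" for u
    using that by (auto simp: loops_def)
  have "\<phi> (?L 0 2) (?L 2 3) = \<phi> (?L 0 1 +++ ?L 1 2) (?L 2 3)"
    by (intro inv loops_join l refl based_edges_homotopic [OF \<sigma>] r) auto
  moreover have "\<phi> (?L 0 1) (?L 1 3) = \<phi> (?L 0 1) (?L 1 2 +++ ?L 2 3)"
    by (intro inv loops_join l refl based_edges_homotopic [OF \<sigma>] r) auto
  moreover have "\<phi> (?L 1 2) (?L 2 3) - \<phi> (?L 0 1 +++ ?L 1 2) (?L 2 3) + \<phi> (?L 0 1) (?L 1 2 +++ ?L 2 3)
      - \<phi> (?L 0 1) (?L 1 2) = 0"
    using \<phi> l [of 0 1] l [of 1 2] l [of 2 3] unfolding loop_cocycle_def by simp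
  ultimately show ?thesis
    unfolding chain_boundary_3 chain_eval_add chain_eval_diff chain_eval_of
    by (simp add: f)
next
  case False
  then show ?thesis
    unfolding chain_boundary_3 chain_eval_add chain_eval_diff chain_eval_of
    by (simp add: triangle_cochain_def reachable_face_iff [OF \<sigma>])
qed

section \<open>Singular 2-simplices for concatenations and homotopies\<close>

lemma standard_simplex_1: "x \<in> standard_simplex 1 \<Longrightarrow> x 0 = 1 - x 1 \<and> 0 \<le> x 1 \<and> x 1 \<le> 1"
  by (auto simp: standard_simplex_def)

lemma standard_simplex_2:
  "x \<in> standard_simplex 2 \<Longrightarrow> 0 \<le> x 0 \<and> 0 \<le> x 1 \<and> 0 \<le> x 2 \<and> x 0 + x 1 + x 2 = 1"
  by (auto simp: standard_simplex_def numeral_2_eq_2)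

lemma simplical_face_2:
  "simplical_face 0 x 0 = 0" "simplical_face 0 x 1 = x 0" "simplical_face 0 x 2 = x 1"
  "simplical_face 1 x 0 = x 0" "simplical_face 1 x 1 = 0" "simplical_face 1 x 2 = x 1"
  "simplical_face 2 x 0 = x 0" "simplical_face 2 x 1 = x 1" "simplical_face 2 x 2 = 0"
  by (auto simp: simplical_face_def)

lemma singular_face_2_eqI:
  assumes "k \<le> 2" "\<And>x. x \<in> standard_simplex 1 \<Longrightarrow> f (simplical_face k x) = g (x 1)"
  shows "singular_face 2 k (restrict f (standard_simplex 2)) = path_simplex g"
proof
  fix x
  have "simplical_face k x \<in> standard_simplex 2" if "x \<in> standard_simplex 1"
    using simplical_face_in_standard_simplex [of 2 k x] assms(1) that by simp
  then show "singular_face 2 k (restrict f (standard_simplex 2)) x = path_simplex g x"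
    using assms(2) by (auto simp: singular_face_def path_simplex_def restrict_def)
qed

lemma simplex_edge_restrict:
  assumes "t \<in> {0..1}" "i \<le> p" "j \<le> p"
  shows "simplex_edge (restrict f (standard_simplex p)) i j t =
    f (\<lambda>k. (if k = i then 1 - t else 0) + (if k = j then t else 0))"
  using edge_point_in_simplex [OF assms] by (simp add: simplex_edge_def)

lemma concatenation_simplex:
  fixes Y :: "'a::real_normed_vector set"
  assumes u: "path u" "path_image u \<subseteq> Y" and v: "path v" "path_image v \<subseteq> Y" and ends: "pathfinish u = pathstart v"
  obtains \<sigma> where "singular_simplex 2 (top_of_set Y) \<sigma>"
    "chain_boundary 2 (frag_of \<sigma>) = frag_of (path_simplex u) + frag_of (path_simplex v) - frag_of (path_simplex (u +++ v))"
    "\<And>t. t \<in> {0..1} \<Longrightarrow> simplex_edge \<sigma> 0 1 t = u t" "\<And>t. t \<in> {0..1} \<Longrightarrow> simplex_edge \<sigma> 1 2 t = v t"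
    "simplex_vertex \<sigma> 0 = pathstart u"
proof -
  \<comment> \<open>The vertices 0, 1, 2 go to the parameters 0, 1/2, 1 of \<open>u +++ v\<close>,
    so the first two edges run through \<open>u\<close> and \<open>v\<close> and the long edge
    through their concatenation.\<close>
  define f where "f = (\<lambda>x::nat\<Rightarrow>real. (u +++ v) (x 1 / 2 + x 2))"
  define \<sigma> where "\<sigma> = restrict f (standard_simplex 2)"
  have uv: "path (u +++ v)" "path_image (u +++ v) \<subseteq> Y"
    using u v ends by (auto simp: path_image_join)
  have im: "(\<lambda>x. x 1 / 2 + x 2) \<in> standard_simplex 2 \<rightarrow> {0..1::real}"
    using standard_simplex_2 by fastforce
  have sing: "singular_simplex 2 (top_of_set Y) \<sigma>"
    unfolding \<sigma>_def
  proof (rule singular_simplexI)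
    show "continuous_on (standard_simplex 2) f"
      unfolding f_def
      by (rule continuous_on_compose2 [of "{0..1}" "u +++ v"])
        (use uv im in \<open>auto simp: path_def intro!: continuous_intros continuous_on_proj_simplex\<close>)
    show "f ` standard_simplex 2 \<subseteq> Y"
      using uv im by (fastforce simp: f_def path_image_def)
  qed
  have e: "u 1 = v 0"
    using ends by (auto simp: pathstart_def pathfinish_def)
  have f0: "singular_face 2 0 \<sigma> = path_simplex v"
    unfolding \<sigma>_def
  proof (rule singular_face_2_eqI)
    fix x :: "nat \<Rightarrow> real" assume x: "x \<in> standard_simplex 1"
    show "f (simplical_face 0 x) = v (x 1)"
    proof -
      have "f (simplical_face 0 x) = (u +++ v) ((1 + x 1) / 2)"
      proof -
        have "x 0 / 2 + x 1 = (1 + x 1) / 2"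
          unfolding conjunct1 [OF standard_simplex_1 [OF x]] by (simp add: field_simps)
        then show ?thesis
          unfolding f_def simplical_face_2 by (rule arg_cong)
      qed
      also have "\<dots> = v (x 1)"
        using standard_simplex_1 [OF x] e by (cases "x 1 = 0") (auto simp: joinpaths_def add_divide_distrib)
      finally show ?thesis .
    qed
  qed simp
  have f1: "singular_face 2 1 \<sigma> = path_simplex (u +++ v)"
    unfolding \<sigma>_def
    by (rule singular_face_2_eqI) (auto simp: f_def simplical_face_2 simplical_face_2 [unfolded One_nat_def])
  have f2: "singular_face 2 2 \<sigma> = path_simplex u"
    unfolding \<sigma>_def
  proof (rule singular_face_2_eqI)
    fix x :: "nat \<Rightarrow> real" assume x: "x \<in> standard_simplex 1"
    show "f (simplical_face 2 x) = u (x 1)"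
      using standard_simplex_1 [OF x] by (auto simp: f_def simplical_face_2 simplical_face_2 [unfolded One_nat_def] joinpaths_def)
  qed simp
  show thesis
  proof (rule that [OF sing])
    show "chain_boundary 2 (frag_of \<sigma>) =
        frag_of (path_simplex u) + frag_of (path_simplex v) - frag_of (path_simplex (u +++ v))"
      unfolding chain_boundary_2 f0 f1 f2 by simp
    show "simplex_edge \<sigma> 0 1 t = u t" if "t \<in> {0..1}" for t
      using that by (auto simp: \<sigma>_def simplex_edge_restrict f_def joinpaths_def)
    show "simplex_edge \<sigma> 1 2 t = v t" if "t \<in> {0..1}" for t
      using that e by (cases "t = 0") (auto simp: \<sigma>_def simplex_edge_restrict f_def joinpaths_def field_simps)
    show "simplex_vertex \<sigma> 0 = pathstart u"
      by (simp add: \<sigma>_def simplex_edge_restrict f_def joinpaths_def pathstart_def)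
  qed
qed

lemma concatenation_chain:
  fixes Y :: "'a::real_normed_vector set"
  assumes u: "u \<in> loops Y a" and v: "v \<in> loops Y a" and \<phi>: "loop_cocycle Y a \<phi>"
  obtains D where "singular_chain 2 (top_of_set Y) D"
    "chain_boundary 2 D = frag_of (path_simplex u) + frag_of (path_simplex v) - frag_of (path_simplex (u +++ v))"
    "chain_eval (triangle_cochain Y a \<phi>) D = \<phi> u v"
proof -
  have uv: "path u" "path_image u \<subseteq> Y" "path v" "path_image v \<subseteq> Y" "pathfinish u = pathstart v" "pathstart u = a"
    using u v by (auto simp: loops_def)
  obtain \<sigma> where sing: "singular_simplex 2 (top_of_set Y) \<sigma>"
    and bd: "chain_boundary 2 (frag_of \<sigma>) = frag_of (path_simplex u) + frag_of (path_simplex v) - frag_of (path_simplex (u +++ v))"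
    and e: "\<And>t. t \<in> {0..1} \<Longrightarrow> simplex_edge \<sigma> 0 1 t = u t" "\<And>t. t \<in> {0..1} \<Longrightarrow> simplex_edge \<sigma> 1 2 t = v t"
    and v0: "simplex_vertex \<sigma> 0 = a"
    by (rule concatenation_simplex [OF uv(1-5)]) (use uv(6) in blast)
  have "triangle_cochain Y a \<phi> \<sigma> = \<phi> u v"
    using based_eq_loop [OF u e(1)] based_eq_loop [OF v e(2)] u v \<phi> v0 reachable_base [OF loops_base [OF u]]
    by (simp add: triangle_cochain_def loop_cocycle_def)
  then show thesis
    using that [of "frag_of \<sigma>"] sing bd by (simp add: singular_chain_of)
qed

text \<open>The square of the homotopy is cut along its diagonal. Each triangle has one edge that
  stays at the base point, so a normalised cocycle vanishes on it.\<close>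

lemma homotopy_chain:
  fixes Y :: "'a::real_normed_vector set"
  assumes u: "u \<in> loops Y a" and uw: "homotopic_paths Y u w" and \<phi>: "loop_cocycle Y a \<phi>"
  obtains D where "singular_chain 2 (top_of_set Y) D"
    "chain_boundary 2 D = frag_of (path_simplex u) - frag_of (path_simplex w)"
    "chain_eval (triangle_cochain Y a \<phi>) D = 0"
proof -
  have w: "w \<in> loops Y a"
    by (rule loops_homotopic [OF uw u])
  have a: "a \<in> Y" using u loops_base by blast
  obtain h where h: "continuous_on ({0..1} \<times> {0..1}) h" "h ` ({0..1} \<times> {0..1}) \<subseteq> Y"
    and h0: "\<And>t. t \<in> {0..1} \<Longrightarrow> h (0, t) = u t" and h1: "\<And>t. t \<in> {0..1} \<Longrightarrow> h (1, t) = w t"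
    and hs: "\<And>s. s \<in> {0..1::real} \<Longrightarrow> h (s, 0) = a" and hf: "\<And>s. s \<in> {0..1::real} \<Longrightarrow> h (s, 1) = a"
    using uw u unfolding homotopic_paths_def homotopic_with_def loops_def
    by (auto simp: pathstart_def pathfinish_def image_subset_iff_funcset)
  \<comment> \<open>The vertices 0, 1, 2 go to (0,0), (0,1), (1,1) under the argument of
    \<open>f\<close> and to (0,0), (1,0), (1,1) under that of \<open>g\<close>; the edge 02 is the
    diagonal in both.\<close>
  define f g where "f = (\<lambda>x::nat\<Rightarrow>real. h (x 2, x 1 + x 2))" and "g = (\<lambda>x::nat\<Rightarrow>real. h (x 1 + x 2, x 2))"
  define \<sigma> \<tau> where "\<sigma> = restrict f (standard_simplex 2)" and "\<tau> = restrict g (standard_simplex 2)"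
  have im: "(\<lambda>x. (x 2, x 1 + x 2)) \<in> standard_simplex 2 \<rightarrow> {0..1} \<times> {0..1::real}"
    "(\<lambda>x. (x 1 + x 2, x 2)) \<in> standard_simplex 2 \<rightarrow> {0..1} \<times> {0..1::real}"
    using standard_simplex_2 by fastforce+
  have sing: "singular_simplex 2 (top_of_set Y) \<sigma>" "singular_simplex 2 (top_of_set Y) \<tau>"
    unfolding \<sigma>_def \<tau>_def
  proof (safe intro!: singular_simplexI)
    show "continuous_on (standard_simplex 2) f" "continuous_on (standard_simplex 2) g"
      unfolding f_def g_def
      by (rule continuous_on_compose2 [OF h(1)];
        use im in \<open>auto intro!: continuous_intros continuous_on_proj_simplex\<close>)+
    show "f x \<in> Y" "g x \<in> Y" if "x \<in> standard_simplex 2" for x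
      using h(2) im that by (auto simp: f_def g_def)
  qed
  let ?d = "\<lambda>t. h (t, t)" and ?c = "linepath a a"
  have f0: "singular_face 2 0 \<sigma> = path_simplex ?c"
    unfolding \<sigma>_def
  proof (rule singular_face_2_eqI)
    fix x :: "nat \<Rightarrow> real" assume x: "x \<in> standard_simplex 1"
    have "x 0 + x 1 = 1" using standard_simplex_1 [OF x] by simp
    then show "f (simplical_face 0 x) = ?c (x 1)"
      using standard_simplex_1 [OF x] hf
      by (simp add: f_def simplical_face_2 simplical_face_2 [unfolded One_nat_def])
  qed simp
  have f1: "singular_face 2 1 \<sigma> = path_simplex ?d"
    unfolding \<sigma>_def
    by (rule singular_face_2_eqI) (auto simp: f_def simplical_face_2 simplical_face_2 [unfolded One_nat_def])
  have f2: "singular_face 2 2 \<sigma> = path_simplex u"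
    unfolding \<sigma>_def
    by (rule singular_face_2_eqI) (use standard_simplex_1 h0 in \<open>auto simp: f_def simplical_face_2 simplical_face_2 [unfolded One_nat_def]\<close>)
  have g0: "singular_face 2 0 \<tau> = path_simplex w"
    unfolding \<tau>_def
  proof (rule singular_face_2_eqI)
    fix x :: "nat \<Rightarrow> real" assume x: "x \<in> standard_simplex 1"
    have "x 0 + x 1 = 1" using standard_simplex_1 [OF x] by simp
    then show "g (simplical_face 0 x) = w (x 1)"
      using standard_simplex_1 [OF x] h1
      by (simp add: g_def simplical_face_2 simplical_face_2 [unfolded One_nat_def])
  qed simp
  have g1: "singular_face 2 1 \<tau> = path_simplex ?d"
    unfolding \<tau>_def
    by (rule singular_face_2_eqI) (auto simp: g_def simplical_face_2 simplical_face_2 [unfolded One_nat_def])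
  have g2: "singular_face 2 2 \<tau> = path_simplex ?c"
    unfolding \<tau>_def
    by (rule singular_face_2_eqI) (use standard_simplex_1 hs in \<open>auto simp: g_def simplical_face_2 simplical_face_2 [unfolded One_nat_def]\<close>)
  have c: "?c \<in> loops Y a" using a loops_const by blast
  have v\<sigma>: "reachable Y a (simplex_vertex \<sigma> 0)" "reachable Y a (simplex_vertex \<tau> 0)"
    using hs [of 0] reachable_base [OF a] by (simp_all add: \<sigma>_def \<tau>_def simplex_edge_restrict f_def g_def)
  have e12: "homotopic_paths Y ?c (based_edge Y a \<sigma> 1 2)"
  proof (rule based_eq_loop [OF c])
    fix t :: real assume "t \<in> {0..1}"
    then show "simplex_edge \<sigma> 1 2 t = ?c t"
      using hf by (auto simp: \<sigma>_def simplex_edge_restrict f_def)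
  qed
  have e01: "homotopic_paths Y ?c (based_edge Y a \<tau> 0 1)"
  proof (rule based_eq_loop [OF c])
    fix t :: real assume "t \<in> {0..1}"
    then show "simplex_edge \<tau> 0 1 t = ?c t"
      using hs by (auto simp: \<tau>_def simplex_edge_restrict g_def)
  qed
  have inv: "\<phi> u' v' = \<phi> u v" if "u \<in> loops Y a" "v \<in> loops Y a" "homotopic_paths Y u u'" "homotopic_paths Y v v'" for u v u' v'
    using \<phi> that unfolding loop_cocycle_def by blast
  have nrm: "\<phi> u ?c = 0" "\<phi> ?c u = 0" if "u \<in> loops Y a" for u
    using \<phi> that unfolding loop_cocycle_def normalised_def by auto
  have l: "based_edge Y a \<sigma> 0 1 \<in> loops Y a" "based_edge Y a \<tau> 1 2 \<in> loops Y a"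
    using v\<sigma> reachable_vertices [OF sing(2), of 0 1 a]
    by (auto intro!: based_edge_in_loops [OF sing(1)] based_edge_in_loops [OF sing(2)])
  have refl: "homotopic_paths Y u u" if "u \<in> loops Y a" for u
    using that by (auto simp: loops_def)
  have "\<phi> (based_edge Y a \<sigma> 0 1) (based_edge Y a \<sigma> 1 2) = \<phi> (based_edge Y a \<sigma> 0 1) ?c"
    "\<phi> (based_edge Y a \<tau> 0 1) (based_edge Y a \<tau> 1 2) = \<phi> ?c (based_edge Y a \<tau> 1 2)"
    by (intro inv l c refl e12 e01)+
  then have "triangle_cochain Y a \<phi> \<sigma> = 0" "triangle_cochain Y a \<phi> \<tau> = 0"
    using nrm l by (simp_all add: triangle_cochain_def)
  then have "chain_eval (triangle_cochain Y a \<phi>) (frag_of \<sigma> - frag_of \<tau>) = 0"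
    by (simp add: chain_eval_diff)
  moreover have "chain_boundary 2 (frag_of \<sigma> - frag_of \<tau>) = frag_of (path_simplex u) - frag_of (path_simplex w)"
    unfolding chain_boundary_diff chain_boundary_2 f0 f1 f2 g0 g1 g2 by simp
  moreover have "singular_chain 2 (top_of_set Y) (frag_of \<sigma> - frag_of \<tau>)"
    using sing by (intro singular_chain_diff) (auto simp: singular_chain_of)
  ultimately show thesis
    using that by blast
qed

lemma triangle_chain:
  fixes Y :: "'a::real_normed_vector set"
  assumes u: "u \<in> loops Y a" and v: "v \<in> loops Y a" and w: "homotopic_paths Y (u +++ v) w"
    and \<phi>: "loop_cocycle Y a \<phi>"
  obtains D where "singular_chain 2 (top_of_set Y) D"
    "chain_boundary 2 D = frag_of (path_simplex u) + frag_of (path_simplex v) - frag_of (path_simplex w)"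
    "chain_eval (triangle_cochain Y a \<phi>) D = \<phi> u v"
proof -
  obtain D1 where D1: "singular_chain 2 (top_of_set Y) D1"
    "chain_boundary 2 D1 = frag_of (path_simplex u) + frag_of (path_simplex v) - frag_of (path_simplex (u +++ v))"
    "chain_eval (triangle_cochain Y a \<phi>) D1 = \<phi> u v"
    by (rule concatenation_chain [OF u v \<phi>])
  obtain D2 where D2: "singular_chain 2 (top_of_set Y) D2"
    "chain_boundary 2 D2 = frag_of (path_simplex (u +++ v)) - frag_of (path_simplex w)"
    "chain_eval (triangle_cochain Y a \<phi>) D2 = 0"
    by (rule homotopy_chain [OF loops_join [OF u v] w \<phi>])
  show thesis
    by (rule that [of "D1 + D2"])
      (use D1 D2 in \<open>auto simp: singular_chain_add chain_boundary_add chain_eval_add\<close>)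
qed

lemma loop_cocycle_zero: "loop_cocycle Y a (\<lambda>_ _. 0)"
  by (simp add: loop_cocycle_def)

definition loop_class_combination :: "('j \<Rightarrow> real \<Rightarrow> 'a) \<Rightarrow> 'j set \<Rightarrow> ('j \<Rightarrow> int) \<Rightarrow> 'a chain" where
  "loop_class_combination y J k = (\<Sum>j\<in>J. frag_cmul (k j) (frag_of (path_simplex (y j))))"

subsection \<open>Loops that form a basis of the first homology\<close>

lemma combination_add:
  "loop_class_combination y J k + loop_class_combination y J l = loop_class_combination y J (\<lambda>j. k j + l j)"
  by (simp add: loop_class_combination_def sum.distrib frag_cmul_distrib)

lemma combination_diff:
  "loop_class_combination y J k - loop_class_combination y J l = loop_class_combination y J (\<lambda>j. k j - l j)"
  using combination_add [of y J "\<lambda>j. k j - l j" l] by (simp add: algebra_simps)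

text \<open>The basis property is stated with chains of based loops, to which cochains apply
  directly, and thus concerns the path component of \<open>a\<close>. \<open>H2\<close> is what lets
  2-cocycles have primitives.\<close>

locale loop_basis =
  fixes Y :: "'a::real_normed_vector set" and a :: 'a and J :: "'j set" and y :: "'j \<Rightarrow> real \<Rightarrow> 'a"
  assumes finite_J: "finite J" and base: "a \<in> Y"
    and basis_loops: "j \<in> J \<Longrightarrow> y j \<in> loops Y a"
    and generate: "u \<in> loops Y a \<Longrightarrow> \<exists>k. singular_relboundary 1 (top_of_set Y) {}
        (frag_of (path_simplex u) - loop_class_combination y J k)"
    and free: "singular_relboundary 1 (top_of_set Y) {} (loop_class_combination y J k) \<Longrightarrow> j \<in> J \<Longrightarrow> k j = 0"
    and H2: "vanishing_homology 2 Y"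
begin

lemma combination_delta: "i \<in> J \<Longrightarrow> loop_class_combination y J (\<lambda>j. if j = i then 1 else 0) = frag_of (path_simplex (y i))"
  using finite_J by (simp add: loop_class_combination_def if_distrib [of "\<lambda>k. frag_cmul k _"] cong: if_cong)

text \<open>\<open>F\<close> defines a singular 1-cocycle, so \<open>F u\<close> is the combination
  of the values \<open>F (y j)\<close> given by the coordinates of \<open>u\<close>.\<close>

lemma additive_zero:
  assumes F: "additive_on_loops Y a F" and "\<And>j. j \<in> J \<Longrightarrow> F (y j) = 0" and u: "u \<in> loops Y a"
  shows "F u = 0"
proof -
  have ev: "edge_cochain Y a F (path_simplex v) = F v" if v: "v \<in> loops Y a" for v
  proof -
    have "homotopic_paths Y v (based_edge Y a (path_simplex v) 0 1)"
      by (rule based_eq_loop [OF v]) (rule simplex_edge_path_simplex)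
    moreover have "simplex_vertex (path_simplex v) 0 = a"
      using v edge_point_in_simplex [of 0 0 1 0]
      by (simp add: simplex_edge_def path_simplex_def loops_def pathstart_def)
    ultimately show ?thesis
      using crossed_homotopic [OF F normalised_zero v] reachable_base [OF base]
      by (simp add: edge_cochain_def)
  qed
  obtain k where k: "singular_relboundary 1 (top_of_set Y) {} (frag_of (path_simplex u) - loop_class_combination y J k)"
    using generate [OF u] by blast
  then obtain d where d: "singular_chain 2 (top_of_set Y) d"
      "chain_boundary 2 d = frag_of (path_simplex u) - loop_class_combination y J k"
    by (auto simp: singular_boundary numeral_2_eq_2)
  have "chain_eval (edge_cochain Y a F) (chain_boundary 2 d) = 0"
    by (rule chain_eval_boundary_zero [OF d(1)]) (rule edge_cochain_boundary [OF _ F])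
  then have "F u = (\<Sum>j\<in>J. k j * F (y j))"
    using ev [OF u] ev [OF basis_loops]
    by (simp add: d(2) chain_eval_diff loop_class_combination_def chain_eval_sum chain_eval_cmul)
  then show ?thesis
    using assms(2) by simp
qed

lemma coordinates_unique:
  assumes "singular_relboundary 1 (top_of_set Y) {} (frag_of (path_simplex u) - loop_class_combination y J k)"
    "singular_relboundary 1 (top_of_set Y) {} (frag_of (path_simplex u) - loop_class_combination y J l)" "j \<in> J"
  shows "k j = l j"
proof -
  have "singular_relboundary 1 (top_of_set Y) {} (loop_class_combination y J (\<lambda>j. k j - l j))"
    using singular_relboundary_diff [OF assms(2,1)] by (simp add: combination_diff [symmetric])
  from free [OF this assms(3)] show ?thesis by simp
qed

lemma dual_basis:
  obtains lam where "\<And>i. i \<in> J \<Longrightarrow> additive_on_loops Y a (lam i)"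
    "\<And>i j. i \<in> J \<Longrightarrow> j \<in> J \<Longrightarrow> lam i (y j) = (if i = j then 1 else 0)"
proof -
  define K where "K = (\<lambda>u. SOME k. singular_relboundary 1 (top_of_set Y) {}
     (frag_of (path_simplex u) - loop_class_combination y J k))"
  have K: "singular_relboundary 1 (top_of_set Y) {} (frag_of (path_simplex u) - loop_class_combination y J (K u))"
    if "u \<in> loops Y a" for u
    unfolding K_def using generate [OF that] by (rule someI_ex)
  show thesis
  proof (rule that [of "\<lambda>i u. K u i"])
    fix i assume i: "i \<in> J"
    show "additive_on_loops Y a (\<lambda>u. K u i)"
      unfolding crossed_def
    proof (intro ballI allI impI)
      fix u v w assume uv: "u \<in> loops Y a" "v \<in> loops Y a" and w: "homotopic_paths Y (u +++ v) w"
      obtain D where D: "singular_chain 2 (top_of_set Y) D"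
        "chain_boundary 2 D = frag_of (path_simplex u) + frag_of (path_simplex v) - frag_of (path_simplex w)"
        by (rule triangle_chain [OF uv w loop_cocycle_zero])
      have "singular_relboundary 1 (top_of_set Y) {}
          (frag_of (path_simplex u) + frag_of (path_simplex v) - frag_of (path_simplex w))"
        using D by (auto simp: singular_boundary numeral_2_eq_2)
      from singular_relboundary_diff [OF singular_relboundary_add [OF K [OF uv(1)] K [OF uv(2)]] this]
      have "singular_relboundary 1 (top_of_set Y) {}
          (frag_of (path_simplex w) - loop_class_combination y J (\<lambda>j. K u j + K v j))"
        by (simp add: algebra_simps flip: combination_add)
      from coordinates_unique [OF K this i]
      show "K w i = K u i + K v i + 0"
        using loops_homotopic [OF w loops_join [OF uv]] by simp
    qed
  next
    fix i j assume ij: "i \<in> J" "j \<in> J"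
    have "singular_relboundary 1 (top_of_set Y) {}
      (frag_of (path_simplex (y j)) - loop_class_combination y J (\<lambda>i. if i = j then 1 else 0))"
      using combination_delta [OF ij(2)] by simp
    from coordinates_unique [OF K this ij(1)] basis_loops [OF ij(2)]
    show "K (y j) i = (if i = j then 1 else 0)" by simp
  qed
qed

text \<open>\<open>C u\<close> is a 2-chain from \<open>u\<close> to its combination of basis loops,
  and the primitive is minus the cocycle evaluated on it. Since the second homology vanishes, the
  cocycle is zero on 2-cycles; applied to \<open>C u + C v - C w - D\<close> this is the coboundary
  formula, applied to \<open>C (y j)\<close> the normalisation.\<close>

lemma crossed_exists:
  assumes \<phi>: "loop_cocycle Y a \<phi>"
  obtains F where "crossed Y a \<phi> F" "\<And>j. j \<in> J \<Longrightarrow> F (y j) = 0"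
proof -
  let ?\<Phi> = "chain_eval (triangle_cochain Y a \<phi>)"
  define P where "P = (\<lambda>u (k, c). singular_chain 2 (top_of_set Y) c \<and>
     chain_boundary 2 c = frag_of (path_simplex u) - loop_class_combination y J k)"
  have exP: "\<exists>kc. P u kc" if "u \<in> loops Y a" for u
    using generate [OF that] by (auto simp: P_def singular_boundary numeral_2_eq_2)
  have ex: "P u (SOME kc. P u kc)" if "u \<in> loops Y a" for u
    by (rule someI_ex [OF exP [OF that]])
  define K where "K = (\<lambda>u. fst (SOME kc. P u kc))"
  define C where "C = (\<lambda>u. snd (SOME kc. P u kc))"
  have KC: "singular_chain 2 (top_of_set Y) (C u)"
      "chain_boundary 2 (C u) = frag_of (path_simplex u) - loop_class_combination y J (K u)"
    if "u \<in> loops Y a" for u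
    using ex [OF that] by (auto simp: P_def K_def C_def split_def)
  have K: "singular_relboundary 1 (top_of_set Y) {} (frag_of (path_simplex u) - loop_class_combination y J (K u))"
    if "u \<in> loops Y a" for u
    using KC [OF that] by (auto simp: singular_boundary numeral_2_eq_2)
  have cyc: "?\<Phi> z = 0" if "singular_chain 2 (top_of_set Y) z" "chain_boundary 2 z = 0" for z
  proof -
    have "singular_relboundary 2 (top_of_set Y) {} z"
      using H2 that by (simp add: vanishing_homology_def singular_cycle)
    then obtain d where d: "singular_chain 3 (top_of_set Y) d" "chain_boundary 3 d = z"
      by (auto simp: singular_boundary numeral_3_eq_3 numeral_2_eq_2)
    show ?thesis
      using chain_eval_boundary_zero [OF d(1), of "triangle_cochain Y a \<phi>"] triangle_cochain_boundary [OF _ \<phi>] d(2)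
      by blast
  qed
  \<comment> \<open>Coordinates are determined on \<open>J\<close> only; elsewhere the chosen
    coefficient functions are arbitrary.\<close>
  have comb_cong: "loop_class_combination y J k = loop_class_combination y J l" if "\<And>j. j \<in> J \<Longrightarrow> k j = l j" for k l
    unfolding loop_class_combination_def by (rule sum.cong) (use that in auto)
  show thesis
  proof (rule that [of "\<lambda>u. - ?\<Phi> (C u)"])
    show "crossed Y a \<phi> (\<lambda>u. - ?\<Phi> (C u))"
      unfolding crossed_def
    proof (intro ballI allI impI)
      fix u v w assume uv: "u \<in> loops Y a" "v \<in> loops Y a" and h: "homotopic_paths Y (u +++ v) w"
      have w: "w \<in> loops Y a"
        using loops_homotopic [OF h loops_join [OF uv]] .
      obtain D where D: "singular_chain 2 (top_of_set Y) D"
        "chain_boundary 2 D = frag_of (path_simplex u) + frag_of (path_simplex v) - frag_of (path_simplex w)"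
        "?\<Phi> D = \<phi> u v"
        by (rule triangle_chain [OF uv h \<phi>])
      have bD: "singular_relboundary 1 (top_of_set Y) {}
          (frag_of (path_simplex u) + frag_of (path_simplex v) - frag_of (path_simplex w))"
        using D by (auto simp: singular_boundary numeral_2_eq_2)
      from singular_relboundary_diff [OF singular_relboundary_add [OF K [OF uv(1)] K [OF uv(2)]] bD]
      have "singular_relboundary 1 (top_of_set Y) {}
          (frag_of (path_simplex w) - loop_class_combination y J (\<lambda>j. K u j + K v j))"
        by (simp add: algebra_simps flip: combination_add)
      from coordinates_unique [OF K [OF w] this]
      have "loop_class_combination y J (K w) = loop_class_combination y J (\<lambda>j. K u j + K v j)"
        by (rule comb_cong)
      then have "chain_boundary 2 (C u + C v - C w - D) = 0"
        using KC uv w D(2) by (simp add: chain_boundary_diff chain_boundary_add flip: combination_add)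
      moreover have "singular_chain 2 (top_of_set Y) (C u + C v - C w - D)"
        by (intro singular_chain_diff singular_chain_add KC uv w D)
      ultimately have "?\<Phi> (C u + C v - C w - D) = 0"
        by (rule cyc [rotated])
      then show "- ?\<Phi> (C w) = - ?\<Phi> (C u) + - ?\<Phi> (C v) + \<phi> u v"
        by (simp add: chain_eval_diff chain_eval_add D(3))
    qed
  next
    fix j assume j: "j \<in> J"
    have "singular_relboundary 1 (top_of_set Y) {}
      (frag_of (path_simplex (y j)) - loop_class_combination y J (\<lambda>i. if i = j then 1 else 0))"
      using combination_delta [OF j] by simp
    from coordinates_unique [OF K [OF basis_loops [OF j]] this]
    have "loop_class_combination y J (K (y j)) = loop_class_combination y J (\<lambda>i. if i = j then 1 else 0)"
      by (rule comb_cong)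
    then have "chain_boundary 2 (C (y j)) = 0"
      using KC(2) [OF basis_loops [OF j]] combination_delta [OF j] by simp
    then show "- ?\<Phi> (C (y j)) = 0"
      using cyc KC(1) [OF basis_loops [OF j]] by simp
  qed
qed

end

section \<open>Homology relations between loops\<close>

abbreviation null_homologous :: "'a::real_normed_vector set \<Rightarrow> 'a chain \<Rightarrow> bool" where
  "null_homologous Y \<equiv> singular_relboundary 1 (top_of_set Y) {}"

lemma null_homologous_boundary: "singular_chain 2 (top_of_set Y) d \<Longrightarrow> null_homologous Y (chain_boundary 2 d)"
  by (auto simp: singular_boundary numeral_2_eq_2)

lemma null_homologous_mono: "null_homologous Y c \<Longrightarrow> Y \<subseteq> Z \<Longrightarrow> null_homologous Z c"
  using singular_boundary_mono by blast

lemma null_homologous_join: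
  fixes Y :: "'a::real_normed_vector set"
  assumes "path u" "path_image u \<subseteq> Y" "path v" "path_image v \<subseteq> Y" "pathfinish u = pathstart v"
  shows "null_homologous Y (frag_of (path_simplex u) + frag_of (path_simplex v) - frag_of (path_simplex (u +++ v)))"
proof -
  obtain \<sigma> where "singular_simplex 2 (top_of_set Y) \<sigma>"
    "chain_boundary 2 (frag_of \<sigma>) = frag_of (path_simplex u) + frag_of (path_simplex v) - frag_of (path_simplex (u +++ v))"
    by (rule concatenation_simplex [OF assms]) 
  then show ?thesis
    using null_homologous_boundary [of Y "frag_of \<sigma>"] by (simp add: singular_chain_of)
qed

lemma null_homologous_homotopic_loops:
  assumes "u \<in> loops Y a" "homotopic_paths Y u w"
  shows "null_homologous Y (frag_of (path_simplex u) - frag_of (path_simplex w))"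
proof -
  obtain D where "singular_chain 2 (top_of_set Y) D"
    "chain_boundary 2 D = frag_of (path_simplex u) - frag_of (path_simplex w)"
    by (rule homotopy_chain [OF assms loop_cocycle_zero])
  then show ?thesis using null_homologous_boundary [of Y D] by simp
qed

lemma null_homologous_const:
  assumes "a \<in> Y"
  shows "null_homologous Y (frag_of (path_simplex (linepath a a)))"
proof -
  have l: "linepath a a \<in> loops Y a" using assms loops_const by blast
  have "homotopic_paths Y (linepath a a +++ linepath a a) (linepath a a)"
    using l homotopic_paths_lid [of "linepath a a" Y] by (auto simp: loops_def)
  then have 1: "null_homologous Y (frag_of (path_simplex (linepath a a +++ linepath a a)) - frag_of (path_simplex (linepath a a)))"
    using null_homologous_homotopic_loops [OF loops_join [OF l l]] by blast
  have 2: "null_homologous Y (frag_of (path_simplex (linepath a a)) + frag_of (path_simplex (linepath a a))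
      - frag_of (path_simplex (linepath a a +++ linepath a a)))"
    using assms by (intro null_homologous_join) auto
  show ?thesis using singular_relboundary_add [OF 1 2] by simp
qed

lemma null_homologous_contractible_loop:
  assumes "u \<in> loops Y a" "homotopic_paths Y u (linepath a a)"
  shows "null_homologous Y (frag_of (path_simplex u))"
  using singular_relboundary_add [OF null_homologous_homotopic_loops [OF assms]
      null_homologous_const [OF loops_base [OF assms(1)]]] by simp

lemma null_homologous_reverse:
  fixes Y :: "'a::real_normed_vector set"
  assumes "path u" "path_image u \<subseteq> Y"
  shows "null_homologous Y (frag_of (path_simplex u) + frag_of (path_simplex (reversepath u)))"
proof -
  have 1: "null_homologous Y (frag_of (path_simplex u) + frag_of (path_simplex (reversepath u))
      - frag_of (path_simplex (u +++ reversepath u)))"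
    using assms by (intro null_homologous_join) auto
  have "u +++ reversepath u \<in> loops Y (pathstart u)"
    using assms by (auto simp: loops_def path_image_join)
  then have 2: "null_homologous Y (frag_of (path_simplex (u +++ reversepath u)))"
    by (rule null_homologous_contractible_loop) (rule homotopic_paths_rinv [OF assms])
  show ?thesis using singular_relboundary_add [OF 1 2] by simp
qed

lemma null_homologous_triangle:
  fixes a b c :: "'a::real_normed_vector"
  assumes "convex hull {a, b, c} \<subseteq> Y"
  shows "null_homologous Y (frag_of (path_simplex (linepath a b)) + frag_of (path_simplex (linepath b c))
     - frag_of (path_simplex (linepath a c)))"
proof -
  define f where "f = (\<lambda>x::nat \<Rightarrow> real. x 0 *\<^sub>R a + x 1 *\<^sub>R b + x 2 *\<^sub>R c)"
  define \<sigma> where "\<sigma> = restrict f (standard_simplex 2)"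
  have sing: "singular_simplex 2 (top_of_set Y) \<sigma>"
    unfolding \<sigma>_def
  proof (rule singular_simplexI)
    show "continuous_on (standard_simplex 2) f"
      unfolding f_def by (intro continuous_intros continuous_on_proj_simplex)
    have "f x \<in> convex hull {a, b, c}" if "x \<in> standard_simplex 2" for x
      using standard_simplex_2 [OF that] by (auto simp: convex_hull_3 f_def)
    then show "f ` standard_simplex 2 \<subseteq> Y" using assms by blast
  qed
  note sf = simplical_face_2 simplical_face_2 [unfolded One_nat_def]
  have "singular_face 2 0 \<sigma> = path_simplex (linepath b c)" "singular_face 2 1 \<sigma> = path_simplex (linepath a c)"
    "singular_face 2 2 \<sigma> = path_simplex (linepath a b)"
    unfolding \<sigma>_def
    by (rule singular_face_2_eqI; use standard_simplex_1 in \<open>simp add: f_def sf linepath_def\<close>)+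
  then show ?thesis
    using null_homologous_boundary [of Y "frag_of \<sigma>"] sing chain_boundary_2 [of \<sigma>]
    by (simp add: singular_chain_of algebra_simps)
qed

lemma path_simplex_simplex_edge:
  assumes "singular_simplex 1 X e"
  shows "path_simplex (simplex_edge e 0 1) = e"
proof
  fix x :: "nat \<Rightarrow> real"
  show "path_simplex (simplex_edge e 0 1) x = e x"
  proof (cases "x \<in> standard_simplex 1")
    case True
    then have "(\<lambda>k. (if k = 0 then 1 - x 1 else 0) + (if k = 1 then x 1 else 0)) = x"
      using standard_simplex_1 [OF True] by (auto simp: fun_eq_iff standard_simplex_def not_le)
    then show ?thesis using True by (simp add: path_simplex_def simplex_edge_def)
  next
    case False
    then show ?thesis
      using assms by (auto simp: path_simplex_def singular_simplex_def extensional_def)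
  qed
qed

lemma combination_zero: "loop_class_combination y J (\<lambda>_. 0) = 0"
  by (simp add: loop_class_combination_def)

text \<open>Every edge of a chain is closed up by connectors. The correction \<open>G\<close>
  depends on the boundary only, so it disappears for cycles, while the induction can run over
  arbitrary chains.\<close>

lemma cycle_from_loops:
  fixes Y :: "'a::real_normed_vector set"
  assumes reach: "\<And>x. x \<in> Y \<Longrightarrow> reachable Y a x"
    and gen: "\<And>u. u \<in> loops Y a \<Longrightarrow> \<exists>k. null_homologous Y (frag_of (path_simplex u) - loop_class_combination y J k)"
    and c: "singular_relcycle 1 (top_of_set Y) {} c"
  shows "\<exists>k. null_homologous Y (c - loop_class_combination y J k)"
proof -
  define G where "G = frag_extend (\<lambda>s. frag_of (path_simplex (connector Y a (simplex_vertex s 0))))"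
  have G_diff: "G (p - q) = G p - G q" for p q
    by (simp add: G_def frag_extend_diff)
  have G_of: "G (frag_of s) = frag_of (path_simplex (connector Y a (simplex_vertex s 0)))" for s
    by (simp add: G_def)
  have "singular_chain 1 (top_of_set Y) c" and bc: "chain_boundary 1 c = 0"
    using c by (auto simp: singular_cycle)
  from this(1) have "\<exists>k. null_homologous Y (c - G (chain_boundary 1 c) - loop_class_combination y J k)"
    unfolding singular_chain_def
  proof (induction rule: frag_induction)
    case zero
    then show ?case
      by (intro exI [of _ "\<lambda>_. 0"]) (simp add: combination_zero G_def)
  next
    case (one e)
    then have e: "singular_simplex 1 (top_of_set Y) e" by simp
    let ?e = "simplex_edge e 0 1"
    note pe = simplex_edge_path [OF e, of 0 1, simplified]
    have r0: "reachable Y a (pathstart ?e)" and r1: "reachable Y a (pathfinish ?e)"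
      using reach pe(1,2) pathstart_in_path_image [of ?e] pathfinish_in_path_image [of ?e] by auto
    note c0 = connector [OF r0] and c1 = connector [OF r1]
    let ?g0 = "connector Y a (pathstart ?e)" and ?g1 = "connector Y a (pathfinish ?e)"
    have "based Y a ?e \<in> loops Y a"
      using pe r0 by (intro based_in_loops) auto
    then obtain k where k: "null_homologous Y (frag_of (path_simplex (based Y a ?e)) - loop_class_combination y J k)"
      using gen by blast
    have 1: "null_homologous Y (frag_of (path_simplex ?g0) + frag_of (path_simplex (?e +++ reversepath ?g1))
        - frag_of (path_simplex (based Y a ?e)))"
      unfolding based_def using pe c0 c1 by (intro null_homologous_join) (auto simp: path_image_join)
    have 2: "null_homologous Y (frag_of (path_simplex ?e) + frag_of (path_simplex (reversepath ?g1))
        - frag_of (path_simplex (?e +++ reversepath ?g1)))"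
      using pe c0 c1 by (intro null_homologous_join) auto
    have 3: "null_homologous Y (frag_of (path_simplex ?g1) + frag_of (path_simplex (reversepath ?g1)))"
      using c1 by (intro null_homologous_reverse) auto
    from singular_relboundary_add [OF singular_relboundary_diff [OF singular_relboundary_add [OF 1 2] 3] k]
    have 4: "null_homologous Y (frag_of (path_simplex ?e) - (frag_of (path_simplex ?g1) - frag_of (path_simplex ?g0))
        - loop_class_combination y J k)"
      by (simp add: algebra_simps)
    have bd: "chain_boundary 1 (frag_of e) = frag_of (singular_face 1 0 e) - frag_of (singular_face 1 1 e)"
      by (simp add: chain_boundary_of)
    have v: "simplex_vertex (singular_face 1 0 e) 0 = pathfinish ?e" "simplex_vertex (singular_face 1 1 e) 0 = pathstart ?e"
      using edge_singular_face [of 0 0 1 0 0 e] edge_singular_face [of 0 0 1 0 1 e] pe by simp_all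
    have "path_simplex ?e = e"
      by (rule path_simplex_simplex_edge [OF e])
    then show ?case
      using 4 unfolding bd G_diff G_of v by auto
  next
    case (diff p q)
    then obtain k l where k: "null_homologous Y (p - G (chain_boundary 1 p) - loop_class_combination y J k)"
      and l: "null_homologous Y (q - G (chain_boundary 1 q) - loop_class_combination y J l)"
      by blast
    have eq: "(p - G (chain_boundary 1 p) - loop_class_combination y J k) - (q - G (chain_boundary 1 q) - loop_class_combination y J l)
       = (p - q) - G (chain_boundary 1 (p - q)) - loop_class_combination y J (\<lambda>j. k j - l j)"
      by (simp add: chain_boundary_diff G_diff algebra_simps flip: combination_diff)
    show ?case
      by (rule exI [of _ "\<lambda>j. k j - l j"], subst eq [symmetric], rule singular_relboundary_diff [OF k l])
  qed
  then show ?thesis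
    unfolding bc by (simp add: G_def)
qed

lemma loop_cycle:
  fixes Y :: "'a::real_normed_vector set"
  assumes that: "u \<in> loops Y a"
  shows "singular_relcycle 1 (top_of_set Y) {} (frag_of (path_simplex u))"
proof -
  have s: "singular_simplex 1 (top_of_set Y) (path_simplex u)"
    using that by (intro singular_simplex_path_simplex) (auto simp: loops_def)
  have c: "u 0 = u 1" using that by (auto simp: loops_def pathstart_def pathfinish_def)
  have p: "(\<lambda>j. if j = 0 then 1 else 0) \<in> standard_simplex 0" by (simp add: standard_simplex_0)
  have "singular_face 1 0 (path_simplex u) = singular_face 1 1 (path_simplex u)"
  proof
    fix x
    show "singular_face 1 0 (path_simplex u) x = singular_face 1 1 (path_simplex u) x"
    proof (cases "x \<in> standard_simplex 0")
      case True
      then have x: "x = (\<lambda>j. if j = 0 then 1 else 0)" by (simp add: standard_simplex_0)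
      have "simplical_face 0 x \<in> standard_simplex 1" "simplical_face 1 x \<in> standard_simplex 1"
        using simplical_face_in_standard_simplex [of 1 _ x] True by auto
      moreover have "simplical_face 0 x 1 = 1" "simplical_face 1 x 1 = 0"
        by (auto simp: simplical_face_def x)
      ultimately show ?thesis using True c by (simp add: singular_face_def path_simplex_def)
    qed (simp add: singular_face_def)
  qed
  then have "chain_boundary 1 (frag_of (path_simplex u)) = 0"
    by (simp add: chain_boundary_of)
  then show ?thesis using s by (simp add: singular_cycle singular_chain_of)
qed

text \<open>As the union has no homology in degrees 2 and 3, cycles of the intersection in degrees 1
  and 2 bound if they bound in both sets. Each family of loops is invisible in the other set, so the
  two systems of coordinates do not interfere.\<close>

lemma loop_basis_Int:
  fixes Y1 :: "'a::real_normed_vector set"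
  assumes op: "open Y1" "open Y2" and b1: "loop_basis Y1 a J1 y" and b2: "loop_basis Y2 a J2 y" and "J1 \<inter> J2 = {}"
    and van: "vanishing_homology 2 (Y1 \<union> Y2)" "vanishing_homology 3 (Y1 \<union> Y2)"
    and l2: "\<And>j. j \<in> J2 \<Longrightarrow> y j \<in> loops Y1 a" and l1: "\<And>j. j \<in> J1 \<Longrightarrow> y j \<in> loops Y2 a"
    and n2: "\<And>j. j \<in> J2 \<Longrightarrow> null_homologous Y1 (frag_of (path_simplex (y j)))"
    and n1: "\<And>j. j \<in> J1 \<Longrightarrow> null_homologous Y2 (frag_of (path_simplex (y j)))"
  shows "loop_basis (Y1 \<inter> Y2) a (J1 \<union> J2) y"
proof -
  interpret b1: loop_basis Y1 a J1 y by (rule b1)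
  interpret b2: loop_basis Y2 a J2 y by (rule b2)
  have split: "loop_class_combination y (J1 \<union> J2) k = loop_class_combination y J1 k + loop_class_combination y J2 k" for k
    unfolding loop_class_combination_def
    by (rule sum.union_disjoint) (use assms b1.finite_J b2.finite_J in auto)
  have null_sum: "null_homologous Y (loop_class_combination y J k)"
    if "\<And>j. j \<in> J \<Longrightarrow> null_homologous Y (frag_of (path_simplex (y j)))" "finite J" for Y J k
    using that(2,1) unfolding loop_class_combination_def
    by (induction J rule: finite_induct) (auto intro!: singular_relboundary_add singular_relboundary_cmul)
  have N1: "null_homologous Y1 (loop_class_combination y J2 k)" for k
    by (rule null_sum) (use n2 b2.finite_J in auto)
  have N2: "null_homologous Y2 (loop_class_combination y J1 k)" for k
    by (rule null_sum) (use n1 b1.finite_J in auto)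
  have lp: "y j \<in> loops (Y1 \<inter> Y2) a" if "j \<in> J1 \<union> J2" for j
    using that b1.basis_loops [of j] b2.basis_loops [of j] l1 [of j] l2 [of j] by (auto simp: loops_def)
  show ?thesis
  proof
    show "finite (J1 \<union> J2)" using b1.finite_J b2.finite_J by simp
    show "a \<in> Y1 \<inter> Y2" using b1.base b2.base by simp
    show "\<And>j. j \<in> J1 \<union> J2 \<Longrightarrow> y j \<in> loops (Y1 \<inter> Y2) a" by (rule lp)
    show "\<exists>k. null_homologous (Y1 \<inter> Y2) (frag_of (path_simplex u) - loop_class_combination y (J1 \<union> J2) k)"
      if u: "u \<in> loops (Y1 \<inter> Y2) a" for u
    proof -
      have u12: "u \<in> loops Y1 a" "u \<in> loops Y2 a" using u by (auto simp: loops_def)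
      obtain k1 where k1: "null_homologous Y1 (frag_of (path_simplex u) - loop_class_combination y J1 k1)"
        using b1.generate u12 by blast
      obtain k2 where k2: "null_homologous Y2 (frag_of (path_simplex u) - loop_class_combination y J2 k2)"
        using b2.generate u12 by blast
      define k where "k = (\<lambda>j. if j \<in> J1 then k1 j else k2 j)"
      have e1: "loop_class_combination y J1 k = loop_class_combination y J1 k1"
        unfolding loop_class_combination_def by (rule sum.cong) (auto simp: k_def)
      have e2: "loop_class_combination y J2 k = loop_class_combination y J2 k2"
        unfolding loop_class_combination_def by (rule sum.cong) (use assms(5) in \<open>auto simp: k_def\<close>)
      let ?c = "frag_of (path_simplex u) - loop_class_combination y (J1 \<union> J2) k"
      have cyc: "singular_relcycle 1 (top_of_set (Y1 \<inter> Y2)) {} ?c"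
        unfolding loop_class_combination_def
        by (intro singular_relcycle_diff singular_relcycle_sum singular_relcycle_cmul loop_cycle [OF u] loop_cycle [OF lp])
      have B1: "null_homologous Y1 ?c"
        using singular_relboundary_diff [OF k1 N1 [of k]] by (simp add: split e1 algebra_simps)
      have B2: "null_homologous Y2 ?c"
        using singular_relboundary_diff [OF k2 N2 [of k]] by (simp add: split e2 algebra_simps)
      have "null_homologous (Y1 \<inter> Y2) ?c"
        by (rule Mayer_Vietoris_injective [OF op _ cyc B1 B2]) (use van in \<open>simp add: numeral_2_eq_2\<close>)
      then show ?thesis by blast
    qed
    show "k j = 0" if nh: "null_homologous (Y1 \<inter> Y2) (loop_class_combination y (J1 \<union> J2) k)" and j: "j \<in> J1 \<union> J2" for k j
    proof -
      have "null_homologous Y1 (loop_class_combination y (J1 \<union> J2) k)"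
        "null_homologous Y2 (loop_class_combination y (J1 \<union> J2) k)"
        by (rule null_homologous_mono [OF nh]; simp)+
      from singular_relboundary_diff [OF this(1) N1 [of k]] singular_relboundary_diff [OF this(2) N2 [of k]]
      have "null_homologous Y1 (loop_class_combination y J1 k)" "null_homologous Y2 (loop_class_combination y J2 k)"
        by (simp_all add: split)
      then show ?thesis using b1.free b2.free j by blast
    qed
    show "vanishing_homology 2 (Y1 \<inter> Y2)"
      unfolding vanishing_homology_def
    proof (intro allI impI)
      fix c assume c: "singular_relcycle 2 (top_of_set (Y1 \<inter> Y2)) {} c"
      have "singular_relcycle 2 (top_of_set Y1) {} c" "singular_relcycle 2 (top_of_set Y2) {} c"
        by (rule singular_cycle_mono [OF c]; simp)+
      then have "singular_relboundary 2 (top_of_set Y1) {} c" "singular_relboundary 2 (top_of_set Y2) {} c"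
        using b1.H2 b2.H2 by (auto simp: vanishing_homology_def)
      then show "singular_relboundary 2 (top_of_set (Y1 \<inter> Y2)) {} c"
        by (intro Mayer_Vietoris_injective [OF op _ c]) (use van in \<open>simp_all add: numeral_2_eq_2 numeral_3_eq_3\<close>)
    qed
  qed
qed

subsection \<open>The complement of a properly embedded plane\<close>

type_synonym space4 = "complex \<times> real \<times> real"

text \<open>For a unit complex number \<open>v\<close>, the coordinates of \<open>\<complex> \<times> \<real> \<times> \<real>\<close> along the ray of \<open>v\<close> and
  transverse to it.\<close>

definition along :: "complex \<Rightarrow> space4 \<Rightarrow> real" where
  "along v p = Re (fst p * cnj v)"

definition across :: "complex \<Rightarrow> space4 \<Rightarrow> complex" where
  "across v p = Complex (Im (fst p * cnj v)) (fst (snd p))"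

definition from_coords :: "complex \<Rightarrow> real \<Rightarrow> complex \<Rightarrow> real \<Rightarrow> space4" where
  "from_coords v A c t = (Complex A (Re c) * v, Im c, t)"

definition outer :: "complex \<Rightarrow> space4 set" where
  "outer v = {p. along v p > 1}"

text \<open>What is left of the half space \<open>outer v\<close> outside a standard plane through
  the ray of \<open>v\<close>; for unit \<open>v\<close> it has the homotopy type of a
  circle.\<close>

definition punctured :: "complex \<Rightarrow> space4 set" where
  "punctured v = {p. along v p > 1 \<and> across v p \<noteq> 0}"

lemma along_linear:
  "along v (x + y) = along v x + along v y" "along v (r *\<^sub>R x) = r * along v x"
  by (auto simp: along_def algebra_simps)

lemma across_linear:
  "across v (x + y) = across v x + across v y" "across v (r *\<^sub>R x) = r *\<^sub>R across v x"
  by (auto simp: across_def algebra_simps complex_eq_iff)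

lemma continuous_on_along [continuous_intros]: "continuous_on S (along v)"
  unfolding along_def by (intro continuous_intros)

lemma continuous_on_across [continuous_intros]: "continuous_on S (across v)"
  unfolding across_def Complex_eq by (intro continuous_intros)

lemma continuous_on_from_coords [continuous_intros]:
  assumes "continuous_on S f" "continuous_on S g" "continuous_on S h"
  shows "continuous_on S (\<lambda>x. from_coords v (f x) (g x) (h x))"
  unfolding from_coords_def Complex_eq by (intro continuous_intros assms)

lemma from_coords_inverse:
  assumes "cmod v = 1"
  shows "along v (from_coords v A c t) = A" "across v (from_coords v A c t) = c" "snd (snd (from_coords v A c t)) = t"
    "from_coords v (along v p) (across v p) (snd (snd p)) = p"
proof -
  have v: "v * cnj v = 1" using assms by (simp add: complex_norm_square [symmetric])
  have "Complex A (Re c) * v * cnj v = Complex A (Re c)"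
    by (simp add: mult.assoc v)
  then show "along v (from_coords v A c t) = A" "across v (from_coords v A c t) = c" "snd (snd (from_coords v A c t)) = t"
    by (auto simp: along_def across_def from_coords_def complex_eq_iff)
  have "fst p * cnj v * v = fst p"
    using v by (simp add: mult.assoc mult.commute [of "cnj v"])
  then have "Complex (Re (fst p * cnj v)) (Im (fst p * cnj v)) * v = fst p"
    by (simp only: complex_surj)
  then show "from_coords v (along v p) (across v p) (snd (snd p)) = p"
    by (simp only: from_coords_def along_def across_def complex.sel prod.collapse)
qed

lemma convex_bound_gt:
  fixes a x y :: real
  shows "a < x \<Longrightarrow> a < y \<Longrightarrow> 0 \<le> u \<Longrightarrow> 0 \<le> w \<Longrightarrow> u + w = 1 \<Longrightarrow> a < u * x + w * y"
  using convex_bound_lt [of "-x" "-a" "-y" u w] by simp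

lemma open_outer: "open (outer v)" and open_punctured: "open (punctured v)"
proof -
  show 1: "open (outer v)"
    unfolding outer_def by (intro open_Collect_less continuous_intros)
  have "open {p. across v p \<noteq> 0}"
    by (intro open_Collect_neq continuous_intros)
  then show "open (punctured v)"
    using open_Int [OF 1] by (auto simp: outer_def punctured_def Collect_conj_eq)
qed

lemma convex_outer: "convex (outer v)"
  by (rule convexI) (simp add: outer_def along_linear convex_bound_gt)

lemma vanishing_homology_convex: "convex U \<Longrightarrow> p > 0 \<Longrightarrow> vanishing_homology p (U :: 'a::real_normed_vector set)"
  by (intro vanishing_homology_contractible) (simp_all add: convex_imp_contractible)

lemma vanishing_homology_starlike: "starlike U \<Longrightarrow> p > 0 \<Longrightarrow> vanishing_homology p (U :: 'a::real_normed_vector set)"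
  by (intro vanishing_homology_contractible) (simp_all add: starlike_imp_contractible)

lemma vanishing_homology_disjoint_Un:
  assumes "open A" "open B" "A \<inter> B = {}" "vanishing_homology 1 A" "vanishing_homology 1 B"
  shows "vanishing_homology 1 (A \<union> B)"
  using vanishing_homology_Un [of A B 0] assms
  by (simp add: vanishing_homology_def singular_cycle singular_chain_empty)

text \<open>Slitting along one of two opposite half-lines of the \<open>across\<close> plane gives
  the star-shaped sets \<open>S 1\<close> and \<open>S (-1)\<close>. They cover the space and meet
  in two convex pieces, which have no first homology.\<close>

lemma vanishing_homology_punctured:
  assumes v: "cmod v = 1"
  shows "vanishing_homology 2 (punctured v)"
proof -
  define S where "S = (\<lambda>\<epsilon>. {p. along v p > 1 \<and> (Im (across v p) = 0 \<longrightarrow> \<epsilon> * Re (across v p) > 0)})"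
  have starS: "starlike (S \<epsilon>)" if "\<bar>\<epsilon>\<bar> = 1" for \<epsilon>
    unfolding starlike_def
  proof (intro bexI ballI subsetI)
    let ?a = "from_coords v 2 (of_real \<epsilon>) 0"
    have \<epsilon>: "\<epsilon> * \<epsilon> = 1" using that by (metis abs_mult_self_eq mult_1)
    show "?a \<in> S \<epsilon>"
      using \<epsilon> by (simp add: S_def from_coords_inverse [OF v])
    fix x z assume x: "x \<in> S \<epsilon>" and "z \<in> closed_segment ?a x"
    then obtain u where u: "0 \<le> u" "u \<le> 1" and z: "z = (1 - u) *\<^sub>R ?a + u *\<^sub>R x"
      by (auto simp: closed_segment_def)
    have al: "along v z = (1 - u) * 2 + u * along v x"
      by (simp add: z along_linear from_coords_inverse [OF v])
    have ac: "across v z = (1 - u) *\<^sub>R of_real \<epsilon> + u *\<^sub>R across v x"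
      by (simp only: z across_linear from_coords_inverse [OF v])
    have "along v z > 1"
    proof (cases "u = 0")
      case False
      then have "u * along v x > u * 1" using x u by (intro mult_strict_left_mono) (auto simp: S_def)
      then show ?thesis using u al by simp
    qed (simp add: al)
    moreover have "\<epsilon> * Re (across v z) > 0" if "Im (across v z) = 0"
    proof -
      have re: "\<epsilon> * Re (across v z) = (1 - u) + u * (\<epsilon> * Re (across v x))"
        using \<epsilon> by (simp add: ac algebra_simps)
      have "u = 0 \<or> Im (across v x) = 0" using that by (simp add: ac)
      then show ?thesis
      proof
        assume "u = 0" then show ?thesis using re by simp
      next
        assume "Im (across v x) = 0"
        then have "\<epsilon> * Re (across v x) > 0" using x by (simp add: S_def)
        then show ?thesis using re u by (cases "u = 0") (auto intro: add_nonneg_pos)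
      qed
    qed
    ultimately show "z \<in> S \<epsilon>" by (simp add: S_def)
  qed
  have openS: "open (S \<epsilon>)" for \<epsilon>
  proof -
    have "open ({p. along v p > 1} \<inter> ({p. Im (across v p) \<noteq> 0} \<union> {p. \<epsilon> * Re (across v p) > 0}))"
      by (intro open_Int open_Un open_Collect_less open_Collect_neq continuous_intros)
    moreover have "S \<epsilon> = {p. along v p > 1} \<inter> ({p. Im (across v p) \<noteq> 0} \<union> {p. \<epsilon> * Re (across v p) > 0})"
      by (auto simp: S_def)
    ultimately show ?thesis by simp
  qed
  define V where "V = (\<lambda>\<epsilon>. {p. along v p > 1 \<and> \<epsilon> * Im (across v p) > 0})"
  have openV: "open (V \<epsilon>)" for \<epsilon>
    unfolding V_def Collect_conj_eq by (intro open_Int open_Collect_less continuous_intros)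
  have convV: "convex (V \<epsilon>)" for \<epsilon>
  proof (rule convexI)
    fix x y :: space4 and u w :: real
    assume xy: "x \<in> V \<epsilon>" "y \<in> V \<epsilon>" and uw: "0 \<le> u" "0 \<le> w" "u + w = 1"
    have "1 < u * along v x + w * along v y"
      using convex_bound_gt [of 1 "along v x" "along v y" u w] xy uw by (simp add: V_def)
    moreover have "0 < u * (\<epsilon> * Im (across v x)) + w * (\<epsilon> * Im (across v y))"
      using convex_bound_gt [of 0 "\<epsilon> * Im (across v x)" "\<epsilon> * Im (across v y)" u w] xy uw by (simp add: V_def)
    ultimately show "u *\<^sub>R x + w *\<^sub>R y \<in> V \<epsilon>"
      by (simp add: V_def along_linear across_linear algebra_simps)
  qed
  have "vanishing_homology 1 (V 1 \<union> V (-1))"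
    by (intro vanishing_homology_disjoint_Un openV vanishing_homology_convex convV) (auto simp: V_def)
  moreover have "S 1 \<inter> S (-1) = V 1 \<union> V (-1)"
    by (auto simp: S_def V_def)
  ultimately have "vanishing_homology (Suc 1) (S 1 \<union> S (-1))"
    by (intro vanishing_homology_Un [OF openS openS] vanishing_homology_starlike [OF starS]) auto
  moreover have "S 1 \<union> S (-1) = punctured v"
    by (auto simp: S_def punctured_def complex_eq_iff)
  ultimately show ?thesis by (simp add: numeral_2_eq_2)
qed

lemma path_across: "u \<in> loops (punctured v) a \<Longrightarrow> path (across v \<circ> u) \<and> 0 \<notin> path_image (across v \<circ> u)
   \<and> pathstart (across v \<circ> u) = across v a \<and> pathfinish (across v \<circ> u) = across v a"
  by (auto simp: loops_def punctured_def path_image_compose pathstart_compose pathfinish_compose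
      intro!: path_continuous_image continuous_intros)

text \<open>A straight-line homotopy that keeps \<open>across\<close> fixed pushes the loop into the
  slice of \<open>a\<close>; in this punctured plane the winding number decides.\<close>

lemma loop_winding_zero:
  assumes v: "cmod v = 1" and u: "u \<in> loops (punctured v) a" and w: "winding_number (across v \<circ> u) 0 = 0"
  shows "homotopic_paths (punctured v) u (linepath a a)"
proof -
  define f where "f = (\<lambda>c. from_coords v (along v a) c (snd (snd a)))"
  have a: "a \<in> punctured v" using u loops_base by blast
  note pa = path_across [OF u]
  have fP: "f \<in> - {0} \<rightarrow> punctured v"
    using a by (auto simp: f_def punctured_def from_coords_inverse [OF v])
  have contf: "continuous_on S f" for S
    unfolding f_def by (intro continuous_intros)
  let ?u1 = "f \<circ> (across v \<circ> u)"
  have 1: "homotopic_paths (punctured v) u ?u1"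
  proof (rule homotopic_paths_linear)
    show "path u" using u by (simp add: loops_def)
    show "path ?u1" by (rule path_continuous_image [OF _ contf]) (use pa in simp)
    show "pathstart ?u1 = pathstart u" "pathfinish ?u1 = pathfinish u"
      using u pa by (auto simp: pathstart_compose pathfinish_compose loops_def f_def from_coords_inverse [OF v])
    fix t :: real assume t: "t \<in> {0..1}"
    have ut: "u t \<in> punctured v" using u t by (auto simp: loops_def path_image_def)
    show "closed_segment (u t) (?u1 t) \<subseteq> punctured v"
    proof
      fix z assume "z \<in> closed_segment (u t) (?u1 t)"
      then obtain r where r: "0 \<le> r" "r \<le> 1" and z: "z = (1 - r) *\<^sub>R u t + r *\<^sub>R ?u1 t"
        by (auto simp: closed_segment_def)
      have "across v z = (1 - r) *\<^sub>R across v (u t) + r *\<^sub>R across v (u t)"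
        unfolding z across_linear by (simp add: f_def from_coords_inverse [OF v])
      then have "across v z = across v (u t)" by (simp add: scaleR_left_diff_distrib)
      moreover have "1 < (1 - r) * along v (u t) + r * along v a"
        using convex_bound_gt [of 1 "along v (u t)" "along v a" "1 - r" r] ut a r by (simp add: punctured_def)
      then have "1 < along v z"
        unfolding z along_linear by (simp add: f_def from_coords_inverse [OF v])
      ultimately show "z \<in> punctured v" using ut by (simp add: punctured_def)
    qed
  qed
  have "homotopic_paths (- {0}) (across v \<circ> u) (linepath (across v a) (across v a))"
    using winding_number_homotopic_paths_null_explicit_eq [of "across v \<circ> u" 0] pa w by auto
  then have "homotopic_paths (punctured v) ?u1 (f \<circ> linepath (across v a) (across v a))"
    by (rule homotopic_paths_continuous_image [OF _ contf fP])
  moreover have "f \<circ> linepath (across v a) (across v a) = linepath a a"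
    by (auto simp: f_def linepath_refl from_coords_inverse [OF v])
  ultimately show ?thesis using 1 homotopic_paths_trans by metis
qed

lemma winding_across_join:
  assumes "u \<in> loops (punctured v) a" "w \<in> loops (punctured v) a"
  shows "winding_number (across v \<circ> (u +++ w)) 0 = winding_number (across v \<circ> u) 0 + winding_number (across v \<circ> w) 0"
  using path_across [OF assms(1)] path_across [OF assms(2)]
  unfolding path_compose_join by (intro winding_number_join) auto

lemma winding_across_reverse:
  assumes "u \<in> loops (punctured v) a"
  shows "winding_number (across v \<circ> reversepath u) 0 = - winding_number (across v \<circ> u) 0"
  using path_across [OF assms] winding_number_reversepath [of "across v \<circ> u" 0]
  by (simp add: path_compose_reversepath)

text \<open>Appending \<open>om\<close> or its reverse changes the winding number by one, which
  reduces the claim to winding number zero.\<close>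

lemma punctured_loop_multiple:
  assumes v: "cmod v = 1" and om: "om \<in> loops (punctured v) a" and w1: "winding_number (across v \<circ> om) 0 = 1"
    and u: "u \<in> loops (punctured v) a"
  shows "\<exists>k. null_homologous (punctured v) (frag_of (path_simplex u) - frag_cmul k (frag_of (path_simplex om)))"
proof -
  have "winding_number (across v \<circ> u) 0 \<in> \<int>"
    using path_across [OF u] by (intro integer_winding_number) auto
  then obtain k where k: "winding_number (across v \<circ> u) 0 = of_int k" by (auto elim: Ints_cases)
  have sum: "null_homologous (punctured v) (frag_of (path_simplex p) + frag_of (path_simplex q) - frag_of (path_simplex (p +++ q)))"
    if "p \<in> loops (punctured v) a" "q \<in> loops (punctured v) a" for p q
    using that by (intro null_homologous_join) (auto simp: loops_def)
  have rev: "null_homologous (punctured v) (frag_of (path_simplex om) + frag_of (path_simplex (reversepath om)))"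
    using om by (intro null_homologous_reverse) (auto simp: loops_def)
  have "\<forall>u\<in>loops (punctured v) a. winding_number (across v \<circ> u) 0 = of_int k \<longrightarrow>
     null_homologous (punctured v) (frag_of (path_simplex u) - frag_cmul k (frag_of (path_simplex om)))"
  proof (induction k rule: int_induct [where k = 0])
    case base
    show ?case
    proof (intro ballI impI)
      fix u assume u: "u \<in> loops (punctured v) a" and "winding_number (across v \<circ> u) 0 = of_int 0"
      then have "homotopic_paths (punctured v) u (linepath a a)"
        by (intro loop_winding_zero [OF v]) auto
      then show "null_homologous (punctured v) (frag_of (path_simplex u) - frag_cmul 0 (frag_of (path_simplex om)))"
        using null_homologous_contractible_loop [OF u] by simp
    qed
  next
    case (step1 i)
    show ?case
    proof (intro ballI impI)
      fix u assume u: "u \<in> loops (punctured v) a" and k: "winding_number (across v \<circ> u) 0 = of_int (i + 1)"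
      have l: "u +++ reversepath om \<in> loops (punctured v) a"
        using u om by (intro loops_join loops_reverse)
      have "winding_number (across v \<circ> (u +++ reversepath om)) 0 = of_int i"
        using k w1 winding_across_join [OF u loops_reverse [OF om]] winding_across_reverse [OF om] by simp
      then have 1: "null_homologous (punctured v) (frag_of (path_simplex (u +++ reversepath om)) - frag_cmul i (frag_of (path_simplex om)))"
        using step1.IH l by blast
      show "null_homologous (punctured v) (frag_of (path_simplex u) - frag_cmul (i + 1) (frag_of (path_simplex om)))"
        using singular_relboundary_diff [OF singular_relboundary_add [OF 1 sum [OF u loops_reverse [OF om]]] rev]
        by (simp add: algebra_simps frag_cmul_distrib)
    qed
  next
    case (step2 i)
    show ?case
    proof (intro ballI impI)
      fix u assume u: "u \<in> loops (punctured v) a" and k: "winding_number (across v \<circ> u) 0 = of_int (i - 1)"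
      have l: "u +++ om \<in> loops (punctured v) a"
        using u om by (intro loops_join)
      have "winding_number (across v \<circ> (u +++ om)) 0 = of_int i"
        using k w1 winding_across_join [OF u om] by simp
      then have 1: "null_homologous (punctured v) (frag_of (path_simplex (u +++ om)) - frag_cmul i (frag_of (path_simplex om)))"
        using step2.IH l by blast
      have eq: "frag_cmul (i - 1) x = frag_cmul i x - x" for x :: "space4 chain"
        using frag_cmul_distrib [of "i - 1" 1 x] by (simp add: algebra_simps)
      show "null_homologous (punctured v) (frag_of (path_simplex u) - frag_cmul (i - 1) (frag_of (path_simplex om)))"
        using singular_relboundary_add [OF 1 sum [OF u om]]
        by (simp add: eq algebra_simps)
    qed
  qed
  then show ?thesis using u k by blast
qed

text \<open>The winding number is additive on loops, hence a 1-cocycle, and so it vanishes on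
  boundaries.\<close>

lemma punctured_loop_infinite_order:
  assumes om: "om \<in> loops (punctured v) a" and w1: "winding_number (across v \<circ> om) 0 = 1"
    and "null_homologous (punctured v) (frag_cmul k (frag_of (path_simplex om)))"
  shows "k = 0"
proof -
  let ?Y = "punctured v"
  define F where "F = (\<lambda>u. \<lfloor>Re (winding_number (across v \<circ> u) 0)\<rfloor>)"
  have F: "additive_on_loops ?Y a F"
    unfolding crossed_def
  proof (intro ballI allI impI)
    fix u w z assume u: "u \<in> loops ?Y a" and w: "w \<in> loops ?Y a" and h: "homotopic_paths ?Y (u +++ w) z"
    have "homotopic_paths (- {0}) (across v \<circ> (u +++ w)) (across v \<circ> z)"
      by (rule homotopic_paths_continuous_image [OF h]) (auto intro!: continuous_intros simp: punctured_def)
    then have "winding_number (across v \<circ> z) 0 = winding_number (across v \<circ> (u +++ w)) 0"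
      by (rule winding_number_homotopic_paths [symmetric])
    moreover have "winding_number (across v \<circ> u) 0 \<in> \<int>" "winding_number (across v \<circ> w) 0 \<in> \<int>"
      using path_across [OF u] path_across [OF w] by (auto intro!: integer_winding_number)
    then obtain i j where "winding_number (across v \<circ> u) 0 = of_int i" "winding_number (across v \<circ> w) 0 = of_int j"
      by (elim Ints_cases)
    ultimately show "F z = F u + F w + 0"
      using winding_across_join [OF u w] by (simp add: F_def)
  qed
  have "homotopic_paths ?Y om (based_edge ?Y a (path_simplex om) 0 1)"
    by (rule based_eq_loop [OF om]) (rule simplex_edge_path_simplex)
  moreover have "simplex_vertex (path_simplex om) 0 = a"
    using om edge_point_in_simplex [of 0 0 1 0]
    by (simp add: simplex_edge_def path_simplex_def loops_def pathstart_def)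
  ultimately have ev: "edge_cochain ?Y a F (path_simplex om) = F om"
    using crossed_homotopic [OF F normalised_zero om] reachable_base [OF loops_base [OF om]]
    by (simp add: edge_cochain_def)
  obtain d where d: "singular_chain 2 (top_of_set ?Y) d"
      "chain_boundary 2 d = frag_cmul k (frag_of (path_simplex om))"
    using assms(3) by (auto simp: singular_boundary numeral_2_eq_2)
  have "chain_eval (edge_cochain ?Y a F) (chain_boundary 2 d) = 0"
    by (rule chain_eval_boundary_zero [OF d(1)]) (rule edge_cochain_boundary [OF _ F])
  then have "k * F om = 0"
    by (simp add: d(2) chain_eval_cmul ev)
  moreover have "F om = 1"
    using w1 by (simp add: F_def)
  ultimately show ?thesis by simp
qed

lemma reachable_punctured:
  assumes v: "cmod v = 1" and "a \<in> punctured v" "x \<in> punctured v"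
  shows "reachable (punctured v) a x"
proof -
  have "punctured v = (\<lambda>(A, c, t). from_coords v A c t) ` ({1<..} \<times> (- {0}) \<times> UNIV)"
  proof (intro equalityI subsetI)
    fix p assume "p \<in> punctured v"
    then have "(along v p, across v p, snd (snd p)) \<in> {1<..} \<times> (- {0}) \<times> UNIV"
      by (simp add: punctured_def)
    then show "p \<in> (\<lambda>(A, c, t). from_coords v A c t) ` ({1<..} \<times> (- {0}) \<times> UNIV)"
      by (rule image_eqI [rotated]) (simp add: from_coords_inverse [OF v])
  qed (auto simp: punctured_def from_coords_inverse [OF v])
  moreover have "path_connected ({1::real<..} \<times> (- {0::complex}) \<times> (UNIV :: real set))"
    using path_connected_punctured_universe [where 'a = complex]
    by (intro path_connected_Times) (auto simp: Compl_eq_Diff_UNIV convex_imp_path_connected convex_real_interval)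
  ultimately have "path_connected (punctured v)"
    by (auto simp: case_prod_unfold intro!: path_connected_continuous_image continuous_intros)
  then show ?thesis
    using assms by (auto simp: path_connected_def reachable_def)
qed

text \<open>Homeomorphic closed subsets of Euclidean space have complements with isomorphic
  homology. So \<open>S\<close> may be replaced by the flat half plane \<open>H\<close>, whose
  complement is star-shaped about (-1, 0, 0).\<close>

lemma vanishing_homology_half_plane_complement:
  fixes S :: "space4 set"
  assumes "closed S" and hom: "S homeomorphic ({0..} \<times> UNIV :: (real \<times> real) set)" and "p > 0"
  shows "vanishing_homology p (- S)"
proof -
  define H where "H = {q::space4. 0 \<le> Re (fst q) \<and> Im (fst q) = 0 \<and> fst (snd q) = 0}"
  have closedH: "closed H"
    unfolding H_def Collect_conj_eq
    by (intro closed_Int closed_Collect_le closed_Collect_eq continuous_intros)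
  have "H homeomorphic ({0..} \<times> UNIV :: (real \<times> real) set)"
    unfolding homeomorphic_def homeomorphism_def
    by (rule exI [of _ "\<lambda>q. (Re (fst q), snd (snd q))"], rule exI [of _ "\<lambda>z. (of_real (fst z), 0, snd z)"])
      (auto simp: H_def image_iff complex_eq_iff intro!: continuous_intros, metis Im_complex_of_real Re_complex_of_real)
  then have SH: "S homeomorphic H"
    using hom homeomorphic_trans homeomorphic_sym by metis
  have "starlike (- H)"
    unfolding starlike_def
  proof (intro bexI ballI subsetI)
    show "(-1, 0, 0) \<in> - H" by (simp add: H_def)
    fix x z assume x: "x \<in> - H" and "z \<in> closed_segment (-1, 0, 0) x"
    then obtain u where u: "0 \<le> u" "u \<le> 1" and z: "z = (1 - u) *\<^sub>R (-1, 0, 0) + u *\<^sub>R x"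
      by (auto simp: closed_segment_def)
    show "z \<in> - H"
    proof
      assume "z \<in> H"
      then have h: "0 \<le> u * Re (fst x) - (1 - u)" "u * Im (fst x) = 0" "u * fst (snd x) = 0"
        by (auto simp: H_def z)
      then have "u \<noteq> 0" by auto
      then have "Im (fst x) = 0" "fst (snd x) = 0" using h by auto
      moreover have "0 \<le> u * Re (fst x)" using h(1) u by linarith
      then have "0 \<le> Re (fst x)" using u \<open>u \<noteq> 0\<close> by (simp add: zero_le_mult_iff)
      ultimately show False using x by (simp add: H_def)
    qed
  qed
  then have vH: "vanishing_homology p (- H)"
    using assms(3) by (rule vanishing_homology_starlike)
  \<comment> \<open>The duality theorem is stated for \<open>Euclidean_space\<close>, a space of
    functions on the naturals; \<open>g\<close> carries \<open>space4\<close> there.\<close>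
  obtain f :: "(nat \<Rightarrow> real) \<Rightarrow> space4" and g where fg: "homeomorphic_maps (Euclidean_space (DIM(space4))) euclidean f g"
    by (rule homeomorphic_maps_Euclidean_space_euclidean)
  let ?E = "Euclidean_space (DIM(space4))"
  have g: "homeomorphic_map euclidean ?E g"
    using fg homeomorphic_maps_sym homeomorphic_maps_map by metis
  have surj: "g ` UNIV = topspace ?E" and inj: "inj g"
    using g by (auto simp: homeomorphic_eq_everything_map)
  have sub: "top_of_set T homeomorphic_space subtopology ?E (g ` T)" for T
  proof -
    have "homeomorphic_map (top_of_set T) (subtopology ?E (g ` T)) g"
      by (rule homeomorphic_map_subtopologies [OF g]) (use surj in auto)
    then show ?thesis by (rule homeomorphic_map_imp_homeomorphic_space)
  qed
  have cl: "closedin ?E (g ` T)" if "closed T" for T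
    using that g homeomorphic_map_closedness_eq [of euclidean ?E g] by (metis UNIV_I closed_closedin homeomorphic_map_closedness subset_UNIV topspace_euclidean)
  have compl: "topspace ?E - g ` T = g ` (- T)" for T
    using image_set_diff [OF inj, of UNIV T] surj by (simp add: Compl_eq_Diff_UNIV)
  have grp: "group (homology_group p X)" for X :: "'z topology" and p :: int by simp
  have "top_of_set S homeomorphic_space top_of_set H"
    using SH by simp
  then have "subtopology ?E (g ` S) homeomorphic_space subtopology ?E (g ` H)"
    by (intro homeomorphic_space_trans [OF iffD1 [OF homeomorphic_space_sym sub]] homeomorphic_space_trans [OF _ sub])
  from isomorphic_homology_groups_Euclidean_complements [OF cl [OF assms(1)] cl [OF closedH] this]
  have 1: "homology_group p (subtopology ?E (g ` (- S))) \<cong> homology_group p (subtopology ?E (g ` (- H)))"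
    unfolding compl .
  have 2: "homology_group p (top_of_set (- T)) \<cong> homology_group p (subtopology ?E (g ` (- T)))" for T
    by (rule homeomorphic_space_imp_isomorphic_homology_groups [OF sub])
  have "homology_group p (top_of_set (- S)) \<cong> homology_group p (top_of_set (- H))"
    by (rule iso_trans [OF iso_trans [OF 2 1] group.iso_sym [OF grp 2]])
  from isomorphic_group_triviality [OF this grp grp] show ?thesis
    using vH unfolding vanishing_homology_iff_trivial by simp
qed

text \<open>Adding the half space \<open>outer v\<close> to the complement of \<open>P\<close> gives
  the complement of the half plane \<open>P'\<close>, which has no homology in positive degrees. As
  \<open>outer v\<close> is convex, Mayer--Vietoris identifies the homology of \<open>- P\<close>
  with that of the punctured half space, where \<open>om\<close> is a generator. \<open>om\<close>
  and \<open>y j\<close> have different base points, so they are compared in homology only.\<close>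

lemma loop_basis_plane_complement:
  fixes P P' :: "space4 set"
  assumes v: "cmod v = 1" and P: "closed P" and P': "closed P'" "P' homeomorphic ({0..} \<times> UNIV :: (real \<times> real) set)"
    and N: "- P' = - P \<union> outer v" "- P \<inter> outer v = punctured v"
    and b: "y j \<in> loops (- P) b"
    and om: "om \<in> loops (punctured v) a" and w: "winding_number (across v \<circ> om) 0 = 1"
    and y: "null_homologous (- P) (frag_of (path_simplex (y j)) + frag_of (path_simplex om))"
  shows "loop_basis (- P) b {j} y"
proof -
  have op: "open (- P)" "open (outer v)"
    using P open_outer by auto
  have van: "vanishing_homology p (- P \<union> outer v)" if "p > 0" for p
    using vanishing_homology_half_plane_complement [OF P' that] N by simp
  have sub: "punctured v \<subseteq> - P" using N by blast
  have gen1: "\<exists>k. null_homologous (punctured v) (frag_of (path_simplex u) - loop_class_combination (\<lambda>_. om) {()} k)"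
    if u: "u \<in> loops (punctured v) a" for u
  proof -
    obtain k where "null_homologous (punctured v) (frag_of (path_simplex u) - frag_cmul k (frag_of (path_simplex om)))"
      using punctured_loop_multiple [OF v om w u] by blast
    then show ?thesis
      by (intro exI [of _ "\<lambda>_. k"]) (simp add: loop_class_combination_def)
  qed
  have reach: "reachable (punctured v) a x" if "x \<in> punctured v" for x
    by (rule reachable_punctured [OF v loops_base [OF om] that])
  have comb: "loop_class_combination y {j} k = frag_cmul (k j) (frag_of (path_simplex (y j)))" for k
    by (simp add: loop_class_combination_def)
  show ?thesis
  proof
    show "finite {j}" "b \<in> - P" "\<And>i. i \<in> {j} \<Longrightarrow> y i \<in> loops (- P) b"
      using b loops_base [OF b] by auto
    show "\<exists>k. null_homologous (- P) (frag_of (path_simplex u) - loop_class_combination y {j} k)"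
      if u: "u \<in> loops (- P) b" for u
    proof -
      have "singular_relcycle 1 (top_of_set (- P)) {} (frag_of (path_simplex u))"
        by (rule loop_cycle [OF u])
      then obtain c where c: "singular_relcycle 1 (top_of_set (- P \<inter> outer v)) {} c"
        and uc: "null_homologous (- P) (frag_of (path_simplex u) - c)"
        by (rule Mayer_Vietoris_surjective [OF op van, rotated]) auto
      obtain k where "null_homologous (punctured v) (c - loop_class_combination (\<lambda>_. om) {()} k)"
        using cycle_from_loops [OF reach gen1] c N(2) by metis
      then have k: "null_homologous (- P) (c - frag_cmul (k ()) (frag_of (path_simplex om)))"
        using null_homologous_mono [OF _ sub] by (simp add: loop_class_combination_def)
      have "null_homologous (- P) (frag_cmul (k ()) (frag_of (path_simplex (y j)) + frag_of (path_simplex om)))"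
        by (rule singular_relboundary_cmul [OF y])
      from singular_relboundary_add [OF singular_relboundary_add [OF uc k] this]
      have "null_homologous (- P) (frag_of (path_simplex u) - frag_cmul (- k ()) (frag_of (path_simplex (y j))))"
        by (simp add: frag_cmul_distrib2 algebra_simps minus_frag_cmul [symmetric] del: minus_frag_cmul)
      then show ?thesis
        unfolding comb by (intro exI [of _ "\<lambda>_. - k ()"])
    qed
    show "k i = 0" if nh: "null_homologous (- P) (loop_class_combination y {j} k)" and i: "i \<in> {j}" for k i
    proof -
      have "null_homologous (- P) (frag_cmul (k j) (frag_of (path_simplex (y j)) + frag_of (path_simplex om)))"
        by (rule singular_relboundary_cmul [OF y])
      from singular_relboundary_diff [OF this nh]
      have 1: "null_homologous (- P) (frag_cmul (k j) (frag_of (path_simplex om)))"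
        by (simp add: comb frag_cmul_distrib2)
      have cyc: "singular_relcycle 1 (top_of_set X) {} (frag_cmul (k j) (frag_of (path_simplex om)))"
        if "punctured v \<subseteq> X" for X
        using om that by (intro singular_relcycle_cmul loop_cycle [of _ _ a]) (auto simp: loops_def)
      have "vanishing_homology 1 (outer v)"
        by (rule vanishing_homology_convex [OF convex_outer]) simp
      then have 2: "null_homologous (outer v) (frag_cmul (k j) (frag_of (path_simplex om)))"
        using cyc [of "outer v"] N by (auto simp: vanishing_homology_def)
      have "null_homologous (- P \<inter> outer v) (frag_cmul (k j) (frag_of (path_simplex om)))"
        by (rule Mayer_Vietoris_injective [OF op van _ 1 2]) (use cyc N in auto)
      then have "k j = 0"
        unfolding N(2) by (rule punctured_loop_infinite_order [OF om w])
      then show ?thesis using i by simp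
    qed
    show "vanishing_homology 2 (- P)"
      unfolding vanishing_homology_def
    proof (intro allI impI)
      fix z assume "singular_relcycle 2 (top_of_set (- P)) {} z"
      then obtain c where c: "singular_relcycle 2 (top_of_set (- P \<inter> outer v)) {} c"
        and zc: "singular_relboundary 2 (top_of_set (- P)) {} (z - c)"
        by (rule Mayer_Vietoris_surjective [OF op van, rotated]) auto
      have "singular_relboundary 2 (top_of_set (punctured v)) {} c"
        using vanishing_homology_punctured [OF v] c N(2) by (simp add: vanishing_homology_def)
      then have "singular_relboundary 2 (top_of_set (- P)) {} c"
        using singular_boundary_mono [OF sub] by blast
      from singular_relboundary_add [OF zc this]
      show "singular_relboundary 2 (top_of_set (- P)) {} z" by simp
    qed
  qed
qed

subsection \<open>Systems of planes with a screw symmetry\<close>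

text \<open>The \<open>2 n\<close>-th roots of unity in clockwise order. Untwisting turns height t
  by - pi t / n, so a translation by \<open>m\<close> becomes the rotation by
  \<open>dirn n m\<close>; this explains the sign.\<close>

definition dirn :: "nat \<Rightarrow> int \<Rightarrow> complex" where
  "dirn n k = cis (- pi * of_int k / of_nat n)"

definition ray :: "complex \<Rightarrow> space4 set" where
  "ray v = {p. along v p > 1 \<and> across v p = 0}"

definition screw :: "nat \<Rightarrow> int \<Rightarrow> space4 \<Rightarrow> space4" where
  "screw n m p = (dirn n m * fst p, fst (snd p), snd (snd p) + of_int m)"

lemma cmod_dirn [simp]: "cmod (dirn n k) = 1"
  by (simp add: dirn_def)

lemma dirn_cnj [simp]: "dirn n k * cnj (dirn n k) = 1"
  by (simp add: complex_norm_square [symmetric])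

lemma screw_screw: "screw n i (screw n j p) = screw n (i + j) p"
proof -
  have "- pi * of_int i / n + - pi * of_int j / n = - pi * of_int (i + j) / n"
    by (simp add: distrib_left add_divide_distrib diff_divide_distrib)
  then have "dirn n i * dirn n j = dirn n (i + j)"
    by (simp only: dirn_def cis_mult)
  then show ?thesis by (simp add: screw_def mult.assoc [symmetric])
qed

lemma screw_0: "screw n 0 p = p"
  by (simp add: screw_def dirn_def)

lemma continuous_on_screw: "continuous_on S (screw n m)"
  unfolding screw_def by (intro continuous_intros)

text \<open>\<open>P k\<close> is the \<open>k\<close>-th lift of the band, continued outside the unit ball along the rays through its edges. The
  half plane condition stands in for the parametrisation of \<open>P k\<close>: only the complement of the half plane is
  needed for the homology of the complement of \<open>P k\<close>, since \<open>P k\<close> is a standard piece of a plane near the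
  removed ray.\<close>

locale plane_system =
  fixes n :: nat and P :: "int \<Rightarrow> space4 set"
  assumes n: "n \<ge> 2"
    and closed_P: "closed (P k)"
    and periodic: "P (k + int n) = P k"
    and disjoint: "\<not> int n dvd k - l \<Longrightarrow> P k \<inter> P l = {}"
    and outside: "(cmod z)\<^sup>2 + h\<^sup>2 \<ge> 1 \<Longrightarrow> (z, h, t) \<in> P k \<longleftrightarrow> h = 0 \<and> Im (z * cnj (dirn n k)) = 0"
    and shift: "screw n 1 p \<in> P (k + 1) \<longleftrightarrow> p \<in> P k"
    and half_plane: "(P k - ray (dirn n k)) homeomorphic ({0..} \<times> UNIV :: (real \<times> real) set)"
begin

section \<open>Meridians and lunes around the rays\<close>

definition Y :: "int set \<Rightarrow> space4 set" where
  "Y J = - (\<Union>k\<in>J. P k)"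

definition top_pt :: space4 where "top_pt = (0, 3, 0)"
definition bot_pt :: space4 where "bot_pt = (0, -3, 0)"
definition side_pt :: "real \<Rightarrow> space4" where "side_pt \<phi> = (5 * cis \<phi>, 0, 0)"

text \<open>A closed formula for the two segments from \<open>top_pt\<close> over
  \<open>side_pt \<phi>\<close> to \<open>bot_pt\<close>. The lengths 3 and 5 keep the path outside
  the unit ball, where the planes are explicit: its squared distance from the axis point at height 0
  is at least 225/34.\<close>

definition meridian :: "real \<Rightarrow> real \<Rightarrow> space4" where
  "meridian \<phi> t = (of_real (5 * (1 - \<bar>1 - 2 * t\<bar>)) * cis \<phi>, 3 * (1 - 2 * t), 0)"

text \<open>The direction midway between the rays \<open>p - 1\<close> and \<open>p\<close>, so that
  the lune between \<open>ang p\<close> and \<open>ang (p + 1)\<close> encloses the ray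
  \<open>p\<close> alone. Plane \<open>k\<close> has its edges on the rays \<open>k\<close> and
  \<open>k + n\<close>.\<close>

definition ang :: "int \<Rightarrow> real" where
  "ang p = - pi * (of_int p - 1 / 2) / n"

definition lune :: "int \<Rightarrow> int \<Rightarrow> real \<Rightarrow> space4" where
  "lune p q = meridian (ang p) +++ reversepath (meridian (ang q))"

definition y :: "int \<Rightarrow> real \<Rightarrow> space4" where
  "y p = lune p (p + 1)"

lemma n_pos: "0 < n" "(0::real) < n"
  using n by auto

lemma meridian_eq: "meridian \<phi> = linepath top_pt (side_pt \<phi>) +++ linepath (side_pt \<phi>) bot_pt"
proof
  fix t :: real
  show "meridian \<phi> t = (linepath top_pt (side_pt \<phi>) +++ linepath (side_pt \<phi>) bot_pt) t"
    by (auto simp: meridian_def joinpaths_def linepath_def top_pt_def bot_pt_def side_pt_def scaleR_conv_of_real algebra_simps)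
qed

lemma meridian_path [simp]: "path (meridian \<phi>)"
  unfolding meridian_eq by (intro path_join_imp) auto

lemma meridian_ends [simp]: "pathstart (meridian \<phi>) = top_pt" "pathfinish (meridian \<phi>) = bot_pt"
  unfolding meridian_eq by auto

lemma outside_avoid:
  assumes "(cmod z)\<^sup>2 + h\<^sup>2 \<ge> 1" "h \<noteq> 0 \<or> Im (z * cnj (dirn n k)) \<noteq> 0"
  shows "(z, h, t) \<notin> P k"
  using outside [OF assms(1)] assms(2) by blast

lemma cis_dirn: "cis \<phi> * cnj (dirn n k) = cis (\<phi> + pi * of_int k / n)"
  by (simp add: dirn_def cis_cnj cis_mult)

lemma meridian_norm: "(cmod (fst (meridian \<phi> t)))\<^sup>2 + (fst (snd (meridian \<phi> t)))\<^sup>2 \<ge> 1"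
proof -
  define w where "w = \<bar>1 - 2 * t\<bar>"
  have f: "fst (meridian \<phi> t) = of_real (5 * (1 - w)) * cis \<phi>" "\<bar>fst (snd (meridian \<phi> t))\<bar> = 3 * w"
    unfolding meridian_def w_def fst_conv snd_conv abs_mult by simp_all
  have "(cmod (fst (meridian \<phi> t)))\<^sup>2 = (5 * (1 - w))\<^sup>2"
    unfolding f(1) norm_mult norm_cis norm_of_real mult_1_right power2_abs ..
  moreover have "(fst (snd (meridian \<phi> t)))\<^sup>2 = (3 * w)\<^sup>2"
    using arg_cong [OF f(2), of "\<lambda>x. x\<^sup>2"] by simp
  moreover have "(5 * (1 - w))\<^sup>2 + (3 * w)\<^sup>2 = 34 * (w - 25 / 34)\<^sup>2 + 225 / 34"
    by (simp add: power2_eq_square algebra_simps)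
  moreover have "0 \<le> (w - 25 / 34)\<^sup>2" by simp
  ultimately show ?thesis by linarith
qed

lemma meridian_avoid:
  assumes "sin (\<phi> + pi * of_int k / n) \<noteq> 0"
  shows "meridian \<phi> t \<notin> P k"
proof -
  obtain z h where m: "meridian \<phi> t = (z, h, 0)" by (simp add: meridian_def)
  have "h \<noteq> 0 \<or> Im (z * cnj (dirn n k)) \<noteq> 0"
  proof (cases "h = 0")
    case True
    then have "1 - 2 * t = 0" using m by (simp add: meridian_def)
    then have "z = 5 * cis \<phi>" using m by (simp add: meridian_def)
    then show ?thesis using assms by (simp add: mult.assoc cis_dirn)
  qed simp
  then show ?thesis
    unfolding m by (rule outside_avoid [rotated]) (use meridian_norm [of \<phi> t] m in simp)
qed

text \<open>Turning a meridian from index \<open>p - 1/2\<close> to \<open>p + 1/2\<close> sweeps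
  over the ray \<open>p\<close> only, and that ray belongs to the planes congruent to
  \<open>p\<close> modulo \<open>n\<close>.\<close>

lemma sin_zero_strand:
  assumes "sin (- pi * x / n + pi * of_int k / n) = 0" "\<bar>x - of_int p\<bar> \<le> 1 / 2"
  shows "int n dvd p - k"
proof -
  obtain i where i: "- pi * x / n + pi * of_int k / n = of_int i * pi"
    using assms(1) by (auto simp: sin_zero_iff_int2)
  then have "pi * (of_int k - x) = pi * (of_int i * n)"
    using n_pos by (simp add: field_simps)
  then have "of_int k - x = of_int i * n" by simp
  then have e: "of_int (k - p - i * int n) = x - of_int p" by simp
  have "\<bar>of_int (k - p - i * int n)\<bar> \<le> (1/2 :: real)"
    using assms(2) by (simp only: e)
  then have "\<bar>k - p - i * int n\<bar> < 1" by linarith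
  then have "k - p = i * int n" by simp
  then have "p - k = (- i) * int n" by simp
  then show ?thesis by (metis dvd_triv_right)
qed

lemma meridian_in_Y: "meridian (ang p) t \<in> Y J"
proof -
  have "sin (ang p + pi * of_int k / n) \<noteq> 0" for k
  proof
    assume "sin (ang p + pi * of_int k / n) = 0"
    then obtain i where "ang p + pi * of_int k / n = of_int i * pi"
      by (auto simp: sin_zero_iff_int2)
    then have "pi * (of_int k - of_int p + 1 / 2) = pi * (of_int i * n)"
      using n_pos by (simp add: ang_def field_simps)
    then have "of_int (2 * (k - p) + 1) = (of_int (2 * i * int n) :: real)"
      by simp
    then have "2 * (k - p) + 1 = 2 * i * int n"
      by (simp only: of_int_eq_iff)
    moreover have "odd (2 * (k - p) + 1)" "even (2 * i * int n)" by simp_all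
    ultimately show False by metis
  qed
  then show ?thesis
    using meridian_avoid by (auto simp: Y_def)
qed

lemma meridian_image [simp]: "path_image (meridian (ang p)) \<subseteq> Y J"
  using meridian_in_Y by (auto simp: path_image_def)

text \<open>The meridian is rotated across the ray \<open>p\<close>, which is not part of any
  removed plane.\<close>

lemma meridian_homotopic_step:
  assumes "\<And>k. k \<in> J \<Longrightarrow> \<not> int n dvd p - k"
  shows "homotopic_paths (Y J) (meridian (ang p)) (meridian (ang (p + 1)))"
  unfolding homotopic_paths
proof (intro exI conjI ballI)
  let ?a = "\<lambda>s. - pi * (of_int p - 1 / 2 + s) / n"
  let ?h = "\<lambda>z. meridian (?a (fst z)) (snd z)"
  show "continuous_on ({0..1} \<times> {0..1}) ?h"
    unfolding meridian_def using n_pos by (intro continuous_intros) auto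
  show "?h \<in> {0..1} \<times> {0..1} \<rightarrow> Y J"
  proof
    fix z :: "real \<times> real" assume z: "z \<in> {0..1} \<times> {0..1}"
    have "meridian (?a (fst z)) (snd z) \<notin> P k" if k: "k \<in> J" for k
    proof (rule meridian_avoid)
      have "0 \<le> fst z" "fst z \<le> 1" using z by auto
      then have "\<bar>of_int p - 1 / 2 + fst z - of_int p\<bar> \<le> 1 / 2" by linarith
      then show "sin (?a (fst z) + pi * of_int k / n) \<noteq> 0"
        using sin_zero_strand [of "of_int p - 1 / 2 + fst z" k p] assms [OF k] by blast
    qed
    then show "?h z \<in> Y J" by (auto simp: Y_def)
  qed
  show "?h (0, t) = meridian (ang p) t" for t by (simp add: ang_def)
  show "?h (1, t) = meridian (ang (p + 1)) t" for t by (simp add: ang_def add_diff_eq diff_add_eq)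
  show "pathstart (?h \<circ> Pair s) = pathstart (meridian (ang p))" "pathfinish (?h \<circ> Pair s) = pathfinish (meridian (ang p))" for s
    by (simp_all add: pathstart_def pathfinish_def meridian_def)
qed

lemma meridian_homotopic:
  assumes "p \<le> q" "\<And>r k. p \<le> r \<Longrightarrow> r < q \<Longrightarrow> k \<in> J \<Longrightarrow> \<not> int n dvd r - k"
  shows "homotopic_paths (Y J) (meridian (ang p)) (meridian (ang q))"
  using assms
proof (induction q rule: int_ge_induct)
  case base
  then show ?case by simp
next
  case (step q)
  then have "homotopic_paths (Y J) (meridian (ang p)) (meridian (ang q))" by simp
  moreover have "homotopic_paths (Y J) (meridian (ang q)) (meridian (ang (q + 1)))"
    by (rule meridian_homotopic_step) (use step in auto)
  ultimately show ?case using homotopic_paths_trans by blast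
qed

lemma lune_loop [simp]: "lune p q \<in> loops (Y J) top_pt"
  by (simp add: lune_def loops_def path_image_join)

lemma y_loop [simp]: "y p \<in> loops (Y J) top_pt"
  by (simp add: y_def)

lemma lune_join: "homotopic_paths (Y J) (lune p q +++ lune q r) (lune p r)"
  unfolding lune_def by (rule homotopic_paths_cancel_middle) auto

lemma lune_null:
  assumes "p \<le> q" "\<And>r k. p \<le> r \<Longrightarrow> r < q \<Longrightarrow> k \<in> J \<Longrightarrow> \<not> int n dvd r - k"
  shows "homotopic_paths (Y J) (lune p q) (linepath top_pt top_pt)"
proof -
  have "homotopic_paths (Y J) (lune p q) (meridian (ang p) +++ reversepath (meridian (ang p)))"
    unfolding lune_def using meridian_homotopic [OF assms] homotopic_paths_sym
    by (intro homotopic_paths_join homotopic_paths_reversepath_D) auto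
  also have "homotopic_paths (Y J) \<dots> (linepath top_pt top_pt)"
    using homotopic_paths_rinv [of "meridian (ang p)" "Y J"] by simp
  finally show ?thesis .
qed

lemma lune_drop:
  assumes "p \<le> q" "\<And>r k. p \<le> r \<Longrightarrow> r < q \<Longrightarrow> k \<in> J \<Longrightarrow> \<not> int n dvd r - k"
  shows "homotopic_paths (Y J) (lune q r) (lune p r)"
proof -
  have "homotopic_paths (Y J) (meridian (ang q)) (meridian (ang p))"
    using meridian_homotopic [OF assms] homotopic_paths_sym by blast
  then show ?thesis
    unfolding lune_def by (rule homotopic_paths_join) auto
qed

lemma ang_period: "meridian (ang (p + 2 * int n)) = meridian (ang p)"
proof -
  have "ang (p + 2 * int n) = ang p - 2 * pi"
    using n_pos by (simp add: ang_def field_simps)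
  then have "cis (ang (p + 2 * int n)) = cis (ang p)"
    by (simp add: cis_divide [symmetric])
  then show ?thesis by (simp add: meridian_def fun_eq_iff)
qed

lemma lune_period: "lune (p + 2 * int n) (q + 2 * int n) = lune p q"
  by (simp add: lune_def ang_period)

lemma y_period: "y (p + 2 * int n) = y p"
  using lune_period [of p "p + 1"] by (simp add: y_def algebra_simps)

text \<open>The lune over a full turn is homotopic to the product of all \<open>2 n\<close> loops
  \<open>y p\<close> in cyclic order, so this is the relation among the meridians.\<close>

lemma lune_full: "homotopic_paths (Y J) (lune p (p + 2 * int n)) (linepath top_pt top_pt)"
  using homotopic_paths_rinv [of "meridian (ang p)" "Y J"] by (simp add: lune_def ang_period)

lemma y_null:
  assumes "\<And>k. k \<in> J \<Longrightarrow> \<not> int n dvd p - k"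
  shows "homotopic_paths (Y J) (y p) (linepath top_pt top_pt)"
  unfolding y_def by (rule lune_null) (use assms in \<open>auto dest: antisym simp: not_less\<close>)


section \<open>Homology bases for the complements of the planes\<close>

lemma open_Y: "finite J \<Longrightarrow> open (Y J)"
  unfolding Y_def by (intro open_Compl closed_UN) (auto simp: closed_P)

lemma Y_Un: "Y (J \<union> K) = Y J \<inter> Y K"
  by (auto simp: Y_def)

lemma Y_mono: "K \<subseteq> J \<Longrightarrow> Y J \<subseteq> Y K"
  by (auto simp: Y_def)

text \<open>Where \<open>along\<close> exceeds 1 the point is outside the unit ball, so
  \<open>outside\<close> describes the plane there as the locus \<open>across = 0\<close>.\<close>

lemma half_plane_complement:
  defines "P' \<equiv> \<lambda>k. P k - ray (dirn n k)"
  shows "- P' k = - P k \<union> outer (dirn n k)" "- P k \<inter> outer (dirn n k) = punctured (dirn n k)" "closed (P' k)"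
proof -
  have iff: "p \<in> P k \<longleftrightarrow> across (dirn n k) p = 0" if "along (dirn n k) p > 1" for p
  proof -
    obtain z h t where p: "p = (z, h, t)" by (metis surj_pair)
    have "\<bar>along (dirn n k) p\<bar> \<le> cmod (fst p * cnj (dirn n k))"
      unfolding along_def by (rule abs_Re_le_cmod)
    then have "1 \<le> cmod z" using that by (simp add: p norm_mult)
    then have "(cmod z)\<^sup>2 + h\<^sup>2 \<ge> 1"
      using power_mono [of 1 "cmod z" 2] by (simp add: add_increasing2)
    from outside [OF this] show ?thesis
      by (auto simp: p across_def complex_eq_iff)
  qed
  show 1: "- P k \<inter> outer (dirn n k) = punctured (dirn n k)"
    using iff by (auto simp: outer_def punctured_def)
  show 2: "- P' k = - P k \<union> outer (dirn n k)"
    using iff by (auto simp: P'_def ray_def outer_def)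
  show "closed (P' k)"
    unfolding closed_def 2 by (intro open_Un open_outer) (simp add: closed_P open_Compl)
qed

text \<open>By \<open>n \<ge> 2\<close> the angle is at most pi / 4. The bound 3/5 places the side
  points, at distance 5, more than 3 units along the ray.\<close>

lemma sin_cos_lune:
  "sin (pi / (2 * n)) > 0" "cos (pi / (2 * n)) > 3 / 5"
proof -
  have "pi / (2 * n) \<le> pi / (2 * 2)"
    using n n_pos by (intro divide_left_mono) auto
  then have le: "0 < pi / (2 * n)" "pi / (2 * n) \<le> pi / 4"
    using n_pos by auto
  then show "sin (pi / (2 * n)) > 0"
    by (intro sin_gt_zero) (use pi_gt_zero in linarith)+
  have "cos (pi / 4) \<le> cos (pi / (2 * n))"
    using le pi_gt_zero by (intro cos_monotone_0_pi_le) linarith+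
  moreover have "sqrt 2 > 6 / 5"
    by (rule real_less_rsqrt) (simp add: power2_eq_square)
  ultimately show "cos (pi / (2 * n)) > 3 / 5"
    by (simp add: cos_45)
qed

lemma side_coords:
  "along (dirn n k) (side_pt (ang k)) = 5 * cos (pi / (2 * n))" "across (dirn n k) (side_pt (ang k)) = of_real (5 * sin (pi / (2 * n)))"
  "along (dirn n k) (side_pt (ang (k + 1))) = 5 * cos (pi / (2 * n))" "across (dirn n k) (side_pt (ang (k + 1))) = - of_real (5 * sin (pi / (2 * n)))"
proof -
  have a: "ang k + pi * of_int k / n = pi / (2 * n)" "ang (k + 1) + pi * of_int k / n = - (pi / (2 * n))"
    using n_pos by (simp_all add: ang_def field_simps)
  have b: "cis (ang k) * cnj (dirn n k) = cis (pi / (2 * n))" "cis (ang (k + 1)) * cnj (dirn n k) = cis (- (pi / (2 * n)))"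
    unfolding cis_dirn a by simp_all
  have c: "fst (side_pt (ang k)) * cnj (dirn n k) = 5 * cis (pi / (2 * n))"
    "fst (side_pt (ang (k + 1))) * cnj (dirn n k) = 5 * cis (- (pi / (2 * n)))"
    by (simp_all add: side_pt_def mult.assoc b)
  show "along (dirn n k) (side_pt (ang k)) = 5 * cos (pi / (2 * n))" "across (dirn n k) (side_pt (ang k)) = of_real (5 * sin (pi / (2 * n)))"
    "along (dirn n k) (side_pt (ang (k + 1))) = 5 * cos (pi / (2 * n))" "across (dirn n k) (side_pt (ang (k + 1))) = - of_real (5 * sin (pi / (2 * n)))"
    unfolding along_def across_def c by (simp_all add: side_pt_def complex_eq_iff)
qed

text \<open>These triangles compare meridians with a loop around the ray. A point with weight
  \<open>c\<close> at \<open>q\<close> has first coordinate of modulus at least \<open>3 c\<close>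
  and second coordinate \<open>3 * \<sigma> * (1 - c)\<close>, so it is outside the ball; it is off
  the plane because the second coordinate is nonzero, or because it equals \<open>q\<close>.\<close>

lemma hull_avoid:
  fixes \<sigma> :: real
  assumes \<sigma>: "\<bar>\<sigma>\<bar> = 1" and q: "q = side_pt (ang k) \<or> q = side_pt (ang (k + 1))"
  shows "convex hull {(0, 3 * \<sigma>, 0), (3 * dirn n k, 3 * \<sigma>, 0), q} \<subseteq> - P k"
proof
  fix x assume "x \<in> convex hull {(0, 3 * \<sigma>, 0), (3 * dirn n k, 3 * \<sigma>, 0), q}"
  then obtain a b c where abc: "0 \<le> a" "0 \<le> b" "0 \<le> c" "a + b + c = 1"
    and x: "x = a *\<^sub>R (0, 3 * \<sigma>, 0) + b *\<^sub>R (3 * dirn n k, 3 * \<sigma>, 0) + c *\<^sub>R q"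
    by (auto simp: convex_hull_3)
  have qc: "along (dirn n k) q = 5 * cos (pi / (2 * n))" "across (dirn n k) q \<noteq> 0" "snd q = (0, 0)"
    using q side_coords [of k] sin_cos_lune by (auto simp: side_pt_def)
  have al: "along (dirn n k) (3 * dirn n k, 3 * \<sigma>, 0) = 3" "along (dirn n k) (0, 3 * \<sigma>, 0) = 0"
    by (simp_all add: along_def mult.assoc)
  have "along (dirn n k) x = 3 * b + c * (5 * cos (pi / (2 * n)))"
    unfolding x along_linear al qc by simp
  moreover have "c * (5 * cos (pi / (2 * n))) \<ge> c * 3"
    using abc sin_cos_lune by (intro mult_left_mono) auto
  ultimately have "along (dirn n k) x \<ge> 3 * c" using abc by linarith
  moreover have "\<bar>along (dirn n k) x\<bar> \<le> cmod (fst x * cnj (dirn n k))"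
    unfolding along_def by (rule abs_Re_le_cmod)
  ultimately have cm: "3 * c \<le> cmod (fst x)" by (simp add: norm_mult)
  have h: "fst (snd x) = 3 * \<sigma> * (1 - c)" and t: "snd (snd x) = 0"
  proof -
    have ab: "a + b = 1 - c" using abc by simp
    have "fst (snd x) = 3 * \<sigma> * (a + b)" using qc(3) by (simp add: x algebra_simps)
    then show "fst (snd x) = 3 * \<sigma> * (1 - c)" unfolding ab .
    show "snd (snd x) = 0" using qc(3) by (simp add: x)
  qed
  have "(3 * c)\<^sup>2 \<le> (cmod (fst x))\<^sup>2" using cm abc by (intro power_mono) auto
  moreover have "\<sigma>\<^sup>2 = 1" using \<sigma> by (metis one_power2 power2_abs)
  then have "(fst (snd x))\<^sup>2 = 9 * (1 - c)\<^sup>2" by (simp add: h power_mult_distrib)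
  moreover have "(3 * c)\<^sup>2 + 9 * (1 - c)\<^sup>2 \<ge> 1"
    using zero_le_power2 [of "2 * c - 1"] by (simp add: power2_eq_square algebra_simps)
  ultimately have ge: "(cmod (fst x))\<^sup>2 + (fst (snd x))\<^sup>2 \<ge> 1" by linarith
  have "fst (snd x) \<noteq> 0 \<or> Im (fst x * cnj (dirn n k)) \<noteq> 0"
  proof (cases "c = 1")
    case True
    then have "x = q" using abc x by (auto simp: add_nonneg_eq_0_iff zero_prod_def [symmetric])
    then show ?thesis using qc by (auto simp: across_def complex_eq_iff)
  next
    case False then show ?thesis using \<sigma> by (auto simp: h)
  qed
  from outside_avoid [OF ge this, of "snd (snd x)"] show "x \<in> - P k" by simp
qed

lemma linepath_across: "across v \<circ> linepath x z = linepath (across v x) (across v z)"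
  by (auto simp: linepath_def across_linear fun_eq_iff)

text \<open>The quadrilateral \<open>om\<close> in the outer half space winds once around the ray
  \<open>k\<close>, and \<open>y k\<close> is homologous to its reverse.\<close>

lemma loop_basis_single: "loop_basis (Y {k}) top_pt {k} y"
proof -
  let ?v = "dirn n k"
  define s where "s = 5 * sin (pi / (2 * n))"
  have s: "s > 0" using sin_cos_lune by (simp add: s_def)
  let ?q = "side_pt (ang k)" and ?q' = "side_pt (ang (k + 1))"
  \<comment> \<open>Corners on either side of the ray, with the second coordinates of
    \<open>top_pt\<close> and \<open>bot_pt\<close>, so that they span the triangles of
    \<open>hull_avoid\<close> with these points.\<close>
  define b1 b2 where "b1 = (3 * ?v, 3 :: real, 0 :: real)" and "b2 = (3 * ?v, -3 :: real, 0 :: real)"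
  define om where "om = linepath b1 ?q' +++ linepath ?q' b2 +++ linepath b2 ?q +++ linepath ?q b1"
  have co: "along ?v b1 = 3" "along ?v b2 = 3" "across ?v b1 = Complex 0 3" "across ?v b2 = Complex 0 (-3)"
    by (simp_all add: b1_def b2_def along_def across_def mult.assoc)
  have cq: "across ?v ?q = of_real s" "across ?v ?q' = - of_real s"
    using side_coords [of k] by (simp_all add: s_def)
  have "along ?v ?q > 1" "along ?v ?q' > 1"
    using side_coords [of k] sin_cos_lune by simp_all
  then have inO: "b1 \<in> outer ?v" "b2 \<in> outer ?v" "?q \<in> outer ?v" "?q' \<in> outer ?v"
    using co by (auto simp: outer_def)
  define L1 L2 L3 L4 where "L1 = linepath (Complex 0 3) (- of_real s)" and "L2 = linepath (- of_real s) (Complex 0 (-3))"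
    and "L3 = linepath (Complex 0 (-3)) (of_real s)" and "L4 = linepath (of_real s) (Complex 0 3)"
  have pos: "0 < Re (winding_number L1 0)" "0 < Re (winding_number L2 0)" "0 < Re (winding_number L3 0)" "0 < Re (winding_number L4 0)"
    unfolding L1_def L2_def L3_def L4_def by (rule winding_number_linepath_pos_lt; use s in \<open>simp add: algebra_simps\<close>)+
  have avoid0: "0 \<notin> closed_segment (Complex a b) (Complex c d)" if "a * d \<noteq> b * c" for a b c d
  proof
    assume "0 \<in> closed_segment (Complex a b) (Complex c d)"
    then obtain u where "(1 - u) * a + u * c = 0" "(1 - u) * b + u * d = 0"
      by (auto simp: closed_segment_def complex_eq_iff)
    then have e: "(1 - u) * a = - (u * c)" "(1 - u) * b = - (u * d)" by linarith+
    have "(1 - u) * (a * d - b * c) = ((1 - u) * a) * d - ((1 - u) * b) * c" by (simp add: algebra_simps)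
    also have "\<dots> = 0" unfolding e by simp
    finally have "u = 1" using that by simp
    then show False using e that by simp
  qed
  have av: "0 \<notin> closed_segment (Complex 0 3) (- of_real s)" "0 \<notin> closed_segment (- of_real s) (Complex 0 (-3))"
    "0 \<notin> closed_segment (Complex 0 (-3)) (of_real s)" "0 \<notin> closed_segment (of_real s) (Complex 0 3)"
    using avoid0 [of 0 0 3 "-s"] avoid0 [of "-s" "-3" 0 0] avoid0 [of 0 0 "-3" s] avoid0 [of s 3 0 0] s
    by (auto simp: complex_of_real_def complex_minus)
  have half: "\<bar>Re (winding_number L1 0)\<bar> < 1/2" "\<bar>Re (winding_number L2 0)\<bar> < 1/2"
    "\<bar>Re (winding_number L3 0)\<bar> < 1/2" "\<bar>Re (winding_number L4 0)\<bar> < 1/2"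
    unfolding L1_def L2_def L3_def L4_def by (rule winding_number_lt_half_linepath av)+
  have om_across: "across ?v \<circ> om = L1 +++ L2 +++ L3 +++ L4"
    unfolding om_def path_compose_join linepath_across co cq L1_def L2_def L3_def L4_def ..
  have LL: "path L1" "path L2" "path L3" "path L4" "0 \<notin> path_image L1" "0 \<notin> path_image L2" "0 \<notin> path_image L3" "0 \<notin> path_image L4"
    "pathfinish L1 = pathstart L2" "pathfinish L2 = pathstart L3" "pathfinish L3 = pathstart L4" "pathfinish L4 = pathstart L1"
    using av by (simp_all add: L1_def L2_def L3_def L4_def)
  have w_sum: "winding_number (across ?v \<circ> om) 0 = winding_number L1 0 + winding_number L2 0 + winding_number L3 0 + winding_number L4 0"
    unfolding om_across using LL by (simp add: winding_number_join not_in_path_image_join)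
  have "path_image om \<subseteq> outer ?v"
    unfolding om_def using inO convex_outer
    by (auto simp: path_image_join path_image_linepath dest: closed_segment_subset)
  moreover have "0 \<notin> path_image (across ?v \<circ> om)"
    unfolding om_across using LL by (simp add: not_in_path_image_join)
  ultimately have om: "om \<in> loops (punctured ?v) b1"
    by (auto simp: loops_def om_def punctured_def outer_def path_image_compose image_iff)
  have "winding_number (across ?v \<circ> om) 0 \<in> \<int>"
    using path_across [OF om] by (intro integer_winding_number) auto
  then obtain i where i: "winding_number (across ?v \<circ> om) 0 = of_int i" by (elim Ints_cases)
  \<comment> \<open>Every side contributes less than half a turn, and all in the same sense, so the
    integer lies strictly between 0 and 2.\<close>
  then have "real_of_int i = Re (winding_number L1 0) + Re (winding_number L2 0) + Re (winding_number L3 0) + Re (winding_number L4 0)"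
    using arg_cong [OF w_sum, of Re] by simp
  then have "0 < real_of_int i" "real_of_int i < 2" using pos half by linarith+
  then have "i = 1" by linarith
  then have w1: "winding_number (across ?v \<circ> om) 0 = 1" using i by simp
  have Yk: "Y {k} = - P k" by (simp add: Y_def)
  let ?s = "\<lambda>x z. frag_of (path_simplex (linepath x z)) :: space4 chain"
  have pc: "punctured ?v \<subseteq> - P k" using half_plane_complement(2) [of k] by blast
  have segP: "closed_segment x z \<subseteq> - P k" if "x \<in> {b1, b2}" "z \<in> {?q, ?q'}" for x z
    using om pc that by (auto simp: loops_def om_def path_image_join path_image_linepath closed_segment_commute)
  have rev: "null_homologous (- P k) (?s x z + ?s z x)" if "x \<in> {b1, b2}" "z \<in> {?q, ?q'}" for x z
    using null_homologous_reverse [of "linepath x z" "- P k"] segP [OF that] by (simp add: path_image_linepath)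
  have tri: "null_homologous (- P k) (?s top_pt b1 + ?s b1 z - ?s top_pt z)"
    "null_homologous (- P k) (?s z b2 + ?s b2 bot_pt - ?s z bot_pt)" if "z \<in> {?q, ?q'}" for z
  proof -
    show "null_homologous (- P k) (?s top_pt b1 + ?s b1 z - ?s top_pt z)"
      using null_homologous_triangle [of top_pt b1 z "- P k"] hull_avoid [of 1 z k] that
      by (auto simp: top_pt_def b1_def)
    have "{z, b2, bot_pt} = {bot_pt, b2, z}" by auto
    then show "null_homologous (- P k) (?s z b2 + ?s b2 bot_pt - ?s z bot_pt)"
      using null_homologous_triangle [of z b2 bot_pt "- P k"] hull_avoid [of "-1" z k] that
      by (auto simp: bot_pt_def b2_def)
  qed
  have mer: "null_homologous (- P k) (?s top_pt (side_pt (ang p)) + ?s (side_pt (ang p)) bot_pt - frag_of (path_simplex (meridian (ang p))))" for p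
    using null_homologous_join [of "linepath top_pt (side_pt (ang p))" "- P k" "linepath (side_pt (ang p)) bot_pt"]
      meridian_image [of p "{k}"] unfolding Yk meridian_eq by (simp add: path_image_join)
  have revm: "null_homologous (- P k) (frag_of (path_simplex (meridian (ang p))) + frag_of (path_simplex (reversepath (meridian (ang p)))))" for p
    using meridian_image [of p "{k}"] unfolding Yk by (intro null_homologous_reverse) auto
  have yj: "null_homologous (- P k) (frag_of (path_simplex (meridian (ang k))) + frag_of (path_simplex (reversepath (meridian (ang (k + 1)))))
      - frag_of (path_simplex (y k)))"
    unfolding y_def lune_def
    by (rule null_homologous_join) (use meridian_image [of _ "{k}"] in \<open>simp_all add: Yk\<close>)
  have omj: "null_homologous (- P k) (?s b1 ?q' + (?s ?q' b2 + (?s b2 ?q + ?s ?q b1)) - frag_of (path_simplex om))"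
  proof -
    have sg: "closed_segment b1 ?q' \<subseteq> - P k" "closed_segment ?q' b2 \<subseteq> - P k" "closed_segment b2 ?q \<subseteq> - P k" "closed_segment ?q b1 \<subseteq> - P k"
      using segP by (auto simp: closed_segment_commute)
    have "null_homologous (- P k) (?s b2 ?q + ?s ?q b1 - frag_of (path_simplex (linepath b2 ?q +++ linepath ?q b1)))"
      "null_homologous (- P k) (?s ?q' b2 + frag_of (path_simplex (linepath b2 ?q +++ linepath ?q b1))
        - frag_of (path_simplex (linepath ?q' b2 +++ linepath b2 ?q +++ linepath ?q b1)))"
      "null_homologous (- P k) (?s b1 ?q' + frag_of (path_simplex (linepath ?q' b2 +++ linepath b2 ?q +++ linepath ?q b1))
        - frag_of (path_simplex om))"
      unfolding om_def by (rule null_homologous_join; use sg in \<open>simp add: path_image_join path_image_linepath\<close>)+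
    from singular_relboundary_add [OF singular_relboundary_add [OF this(1,2)] this(3)]
    show ?thesis by (simp add: algebra_simps)
  qed
  note add = singular_relboundary_add and diff = singular_relboundary_diff
  \<comment> \<open>Modulo boundaries \<open>y k\<close> is the path from \<open>b1\<close> over
    \<open>?q\<close> to \<open>b2\<close> minus the path over \<open>?q'\<close>; \<open>om\<close>
    follows the second path and returns along the first.\<close>
  have b: "null_homologous (- P k) (frag_of (path_simplex (y k)) + frag_of (path_simplex om))"
  proof -
    have m1: "null_homologous (- P k) (?s b1 ?q + ?s ?q b2 + ?s top_pt b1 + ?s b2 bot_pt - frag_of (path_simplex (meridian (ang k))))"
      using add [OF add [OF tri(1) [of ?q] tri(2) [of ?q]] mer [of k]] by (simp add: algebra_simps)
    have m2: "null_homologous (- P k) (?s b1 ?q' + ?s ?q' b2 + ?s top_pt b1 + ?s b2 bot_pt - frag_of (path_simplex (meridian (ang (k + 1)))))"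
      using add [OF add [OF tri(1) [of ?q'] tri(2) [of ?q']] mer [of "k + 1"]] by (simp add: algebra_simps)
    have r: "null_homologous (- P k) (?s b1 ?q + ?s ?q b1)" "null_homologous (- P k) (?s b2 ?q + ?s ?q b2)"
      using rev by auto
    from diff [OF add [OF add [OF diff [OF diff [OF revm [of "k + 1"] yj] m1] m2] add [OF r]] omj]
    show ?thesis by (simp add: algebra_simps)
  qed
  show ?thesis
    unfolding Yk
  proof (rule loop_basis_plane_complement [where v = ?v and P' = "P k - ray ?v" and om = om and a = b1])
    show "y k \<in> loops (- P k) top_pt" using y_loop [of k "{k}"] by (simp add: Yk)
  qed (use closed_P half_plane_complement [of k] half_plane om w1 b in auto)
qed

lemma Y_period: "Y {i + int n, j} = Y {j, i}" "Y {i + int n} = Y {i}"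
  by (auto simp: Y_def periodic)

lemma Y_union_UNIV:
  assumes "\<And>i j. i \<in> J \<Longrightarrow> j \<in> K \<Longrightarrow> \<not> int n dvd i - j"
  shows "Y J \<union> Y K = UNIV"
  using disjoint assms by (fastforce simp: Y_def)

text \<open>Disjoint planes have complements that cover the whole space, which has no homology in
  positive degrees; meridians of one plane are contractible in the complement of the others.\<close>

lemma loop_basis_insert:
  assumes "finite J" "loop_basis (Y J) top_pt J y" and j: "\<And>i. i \<in> J \<Longrightarrow> \<not> int n dvd j - i"
  shows "loop_basis (Y (insert j J)) top_pt (insert j J) y"
proof -
  have ji: "\<not> int n dvd i - j" if "i \<in> J" for i
    using j [OF that] by (metis dvd_minus_iff minus_diff_eq)
  have U: "Y {j} \<union> Y J = UNIV"
    by (rule Y_union_UNIV) (use j in auto)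
  have "loop_basis (Y {j} \<inter> Y J) top_pt ({j} \<union> J) y"
  proof (rule loop_basis_Int [OF open_Y open_Y loop_basis_single assms(2)])
    show "{j} \<inter> J = {}" using j by fastforce
    show "vanishing_homology 2 (Y {j} \<union> Y J)" "vanishing_homology 3 (Y {j} \<union> Y J)"
      unfolding U by (auto intro: vanishing_homology_convex)
    show "null_homologous (Y {j}) (frag_of (path_simplex (y i)))" if "i \<in> J" for i
      by (rule null_homologous_contractible_loop [OF y_loop y_null]) (use ji [OF that] in auto)
    show "null_homologous (Y J) (frag_of (path_simplex (y i)))" if "i \<in> {j}" for i
      by (rule null_homologous_contractible_loop [OF y_loop y_null]) (use j that in auto)
  qed (use assms(1) in auto)
  then show ?thesis by (simp add: Y_Un [symmetric])
qed

lemma loop_basis_pair: "\<not> int n dvd i - j \<Longrightarrow> loop_basis (Y {i, j}) top_pt {i, j} y"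
  using loop_basis_insert [OF _ loop_basis_single, of j i] by auto

lemma loop_basis_triple:
  "\<not> int n dvd i - j \<Longrightarrow> \<not> int n dvd i - k \<Longrightarrow> \<not> int n dvd j - k \<Longrightarrow> loop_basis (Y {i, j, k}) top_pt {i, j, k} y"
  using loop_basis_insert [OF _ loop_basis_pair, of j k i] by auto

section \<open>Transport of based loops by the screw motion\<close>

lemma screw_P: "screw n m p \<in> P (k + m) \<longleftrightarrow> p \<in> P k"
proof -
  have pos: "screw n (int i) p \<in> P (k + int i) \<longleftrightarrow> p \<in> P k" for i p k
  proof (induction i)
    case 0 then show ?case by (simp add: screw_def dirn_def)
  next
    case (Suc i)
    have "screw n (int (Suc i)) p = screw n 1 (screw n (int i) p)" "k + int (Suc i) = k + int i + 1"
      by (simp_all add: screw_screw)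
    then show ?case using Suc shift by metis
  qed
  show ?thesis
  proof (cases "m \<ge> 0")
    case True
    then obtain i where "m = int i" by (metis nonneg_int_cases)
    then show ?thesis using pos by simp
  next
    case False
    then obtain i where i: "m = - int i" by (metis nle_le nonpos_int_cases)
    have "screw n (int i) (screw n m p) = p"
      by (simp add: screw_screw i screw_0)
    then show ?thesis using pos [of i "screw n m p" "k + m"] by (simp add: i)
  qed
qed

lemma screw_Y: "p \<in> Y J \<longleftrightarrow> screw n m p \<in> Y ((\<lambda>k. k + m) ` J)"
  by (simp add: Y_def screw_P)

text \<open>The screw motion lifts the base point. The vertical segments that lead there and back
  stay off all planes, since these have second coordinate 0 outside the ball.\<close>

definition transport :: "int \<Rightarrow> (real \<Rightarrow> space4) \<Rightarrow> real \<Rightarrow> space4" where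
  "transport m u = linepath top_pt (screw n m top_pt) +++ ((screw n m \<circ> u) +++ linepath (screw n m top_pt) top_pt)"

lemma screw_top: "screw n m top_pt = (0, 3, of_int m)"
  by (simp add: screw_def top_pt_def)

lemma vertical_Y: "closed_segment (0 :: complex, 3 :: real, s :: real) (0, 3, t) \<subseteq> Y J"
proof
  fix x :: space4 assume "x \<in> closed_segment (0, 3, s) (0, 3, t)"
  then obtain u where u: "x = (1 - u) *\<^sub>R (0, 3, s) + u *\<^sub>R (0, 3, t)"
    by (auto simp: closed_segment_def)
  have "x = (0, 3, (1 - u) * s + u * t)"
    unfolding u by (simp add: algebra_simps)
  then show "x \<in> Y J"
    using outside_avoid [of 0 3] by (simp add: Y_def)
qed

lemma vertical_paths [simp]:
  "closed_segment top_pt (screw n m top_pt) \<subseteq> Y J" "closed_segment (screw n m top_pt) top_pt \<subseteq> Y J"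
  unfolding screw_top unfolding top_pt_def by (rule vertical_Y)+

lemma screw_path:
  assumes "u \<in> loops (Y J) top_pt"
  shows "path (screw n m \<circ> u)" "path_image (screw n m \<circ> u) \<subseteq> Y ((\<lambda>k. k + m) ` J)"
    "pathstart (screw n m \<circ> u) = screw n m top_pt" "pathfinish (screw n m \<circ> u) = screw n m top_pt"
  using assms screw_Y [of _ J m]
  by (auto simp: loops_def pathstart_compose pathfinish_compose path_image_compose
      intro!: path_continuous_image continuous_on_screw)

lemma transport_loop:
  assumes "u \<in> loops (Y J) top_pt"
  shows "transport m u \<in> loops (Y ((\<lambda>k. k + m) ` J)) top_pt"
  using screw_path [OF assms, of m] by (simp add: transport_def loops_def path_image_join)

lemma transport_homotopic:
  assumes "u \<in> loops (Y J) top_pt" "homotopic_paths (Y J) u w"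
  shows "homotopic_paths (Y ((\<lambda>k. k + m) ` J)) (transport m u) (transport m w)"
proof -
  have "homotopic_paths (Y ((\<lambda>k. k + m) ` J)) (screw n m \<circ> u) (screw n m \<circ> w)"
    by (rule homotopic_paths_continuous_image [OF assms(2) continuous_on_screw]) (use screw_Y in auto)
  then show ?thesis
    unfolding transport_def using screw_path [OF assms(1), of m]
    by (intro homotopic_paths_join) (auto simp: vertical_paths [THEN subsetD])
qed

lemma transport_join:
  assumes u: "u \<in> loops (Y J) top_pt" and w: "w \<in> loops (Y J) top_pt"
  shows "homotopic_paths (Y ((\<lambda>k. k + m) ` J)) (transport m u +++ transport m w) (transport m (u +++ w))"
proof -
  let ?Y = "Y ((\<lambda>k. k + m) ` J)"
  let ?a = "linepath top_pt (screw n m top_pt)" and ?b = "linepath (screw n m top_pt) top_pt"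
  let ?u = "screw n m \<circ> u" and ?w = "screw n m \<circ> w"
  note pu = screw_path [OF u, of m] and pw = screw_path [OF w, of m]
  note facts = pu pw vertical_paths [of m "(\<lambda>k. k + m) ` J"]
  have b: "?b = reversepath ?a" by simp
  have "homotopic_paths ?Y (?a +++ (?u +++ ?b)) ((?a +++ ?u) +++ ?b)"
    using facts by (intro homotopic_paths_assoc) auto
  then have "homotopic_paths ?Y (transport m u +++ transport m w) (((?a +++ ?u) +++ reversepath ?a) +++ (?a +++ (?w +++ ?b)))"
    unfolding transport_def b by (rule homotopic_paths_join) (use facts in \<open>auto simp: path_image_join\<close>)
  also have "homotopic_paths ?Y \<dots> ((?a +++ ?u) +++ (?w +++ ?b))"
    using facts by (intro homotopic_paths_cancel_middle) (auto simp: path_image_join)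
  also have "homotopic_paths ?Y \<dots> (?a +++ (?u +++ (?w +++ ?b)))"
    using facts by (subst homotopic_paths_sym_eq, intro homotopic_paths_assoc) (auto simp: path_image_join)
  also have "homotopic_paths ?Y \<dots> (?a +++ ((?u +++ ?w) +++ ?b))"
    using facts by (intro homotopic_paths_join homotopic_paths_assoc) (auto simp: path_image_join)
  finally show ?thesis by (simp add: transport_def path_compose_join)
qed

lemma screw_meridian: "screw n m (meridian (ang p) t) = meridian (ang (p + m)) t + (0, 0, of_int m)"
proof -
  have "- pi * of_int m / n + ang p = ang (p + m)"
    using n_pos by (simp add: ang_def field_simps)
  then have "dirn n m * cis (ang p) = cis (ang (p + m))"
    by (simp add: dirn_def cis_mult)
  then show ?thesis by (simp add: screw_def meridian_def mult.left_commute)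
qed

lemma vertical_avoid:
  assumes "p \<in> path_image (lune i j)"
  shows "p + (0, 0, t) \<in> Y J"
proof -
  have "meridian (ang i) s + (0, 0, t) \<notin> P k" for i s k
  proof -
    have "meridian (ang i) s \<notin> P k" using meridian_in_Y [of i s "{k}"] by (simp add: Y_def)
    moreover define z h where "z = fst (meridian (ang i) s)" and "h = fst (snd (meridian (ang i) s))"
    ultimately have a: "(z, h, 0) \<notin> P k" by (simp add: meridian_def)
    have "(cmod z)\<^sup>2 + h\<^sup>2 \<ge> 1"
      unfolding z_def h_def by (rule meridian_norm)
    from outside [OF this, of 0] outside [OF this, of t] a have "(z, h, t) \<notin> P k" by blast
    then show ?thesis by (simp add: z_def h_def meridian_def)
  qed
  moreover have "p \<in> path_image (meridian (ang i)) \<union> path_image (meridian (ang j))"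
    using assms by (simp add: lune_def path_image_join)
  then obtain i' s where "p = meridian (ang i') s"
    by (auto simp: path_image_def)
  ultimately show ?thesis by (auto simp: Y_def)
qed

text \<open>Outside the ball the planes are vertical, so the raised lune can slide down. In the
  square of height and loop parameter, three sides are homotopic to the fourth.\<close>

lemma transport_lune: "homotopic_paths (Y J) (transport m (lune i j)) (lune (i + m) (j + m))"
proof -
  let ?g = "lune (i + m) (j + m)"
  define h where "h = (\<lambda>z::real \<times> real. ?g (snd z) + (0, 0, fst z * of_int m))"
  define A B C D where "A = linepath (0::real, 0::real) (1, 0)" and "B = linepath (1::real, 0::real) (1, 1)"
    and "C = linepath (1::real, 1::real) (0, 1)" and "D = linepath (0::real, 0::real) (0, 1)"
  have gl: "?g \<in> loops (Y J) top_pt" by simp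
  have "continuous_on {0..1} ?g" using gl by (auto simp: loops_def path_def)
  then have cont: "continuous_on ({0..1} \<times> {0..1}) h"
    unfolding h_def by (intro continuous_intros continuous_on_compose2 [of "{0..1}" ?g _ snd]) auto
  have im: "h \<in> {0..1} \<times> {0..1} \<rightarrow> Y J"
  proof
    fix z :: "real \<times> real" assume "z \<in> {0..1} \<times> {0..1}"
    then have "?g (snd z) \<in> path_image ?g" by (auto simp: path_image_def)
    then show "h z \<in> Y J" unfolding h_def by (rule vertical_avoid)
  qed
  have box: "convex ({0..1} \<times> {0..1} :: (real \<times> real) set)" by (intro convex_Times) auto
  have seg: "closed_segment p q \<subseteq> {0..1} \<times> {0..1}" if "p \<in> {0..1} \<times> {0..1}" "q \<in> {0..1} \<times> {0..1}" for p q :: "real \<times> real"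
    using that box by (simp add: closed_segment_subset)
  have pim: "path_image (A +++ (B +++ C)) \<subseteq> {0..1} \<times> {0..1}" "path_image D \<subseteq> {0..1} \<times> {0..1}"
    unfolding A_def B_def C_def D_def by (auto simp: path_image_join path_image_linepath dest: subsetD [OF seg, rotated 2])
  have "homotopic_paths ({0..1} \<times> {0..1}) (A +++ (B +++ C)) D"
    using pim by (intro homotopic_paths_linear seg) (auto simp: A_def B_def C_def D_def path_image_def)
  then have "homotopic_paths (Y J) (h \<circ> (A +++ (B +++ C))) (h \<circ> D)"
    by (rule homotopic_paths_continuous_image [OF _ cont im])
  moreover have "h \<circ> D = ?g"
    by (rule ext) (simp add: h_def D_def linepath_def zero_prod_def [symmetric])
  moreover have "h \<circ> (A +++ (B +++ C)) = transport m (lune i j)"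
  proof -
    have e: "?g 0 = top_pt" "?g 1 = top_pt" using gl by (auto simp: loops_def pathstart_def pathfinish_def)
    have "h \<circ> A = linepath top_pt (screw n m top_pt)" "h \<circ> C = linepath (screw n m top_pt) top_pt"
      unfolding screw_top by (rule ext, simp add: h_def A_def C_def linepath_def e top_pt_def algebra_simps)+
    moreover have "h \<circ> B = screw n m \<circ> lune i j"
      by (auto simp: h_def B_def linepath_def lune_def joinpaths_def reversepath_def screw_meridian)
    ultimately show ?thesis by (simp add: transport_def path_compose_join)
  qed
  ultimately show ?thesis by simp
qed

lemma transport_y: "homotopic_paths (Y J) (transport m (y p)) (y (p + m))"
  using transport_lune [of J m p "p + 1"] by (simp add: y_def algebra_simps)

end

subsection \<open>Triple products of the planes\<close>

lemma crossed_cong: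
  assumes "crossed Z a \<phi> F" "\<And>u v. u \<in> loops Z a \<Longrightarrow> v \<in> loops Z a \<Longrightarrow> \<phi> u v = \<psi> u v"
  shows "crossed Z a \<psi> F"
  using assms unfolding crossed_def by simp

lemma (in loop_basis) crossed_unique:
  assumes "crossed Y a \<phi> F" "crossed Y a \<phi> G" "\<And>j. j \<in> J \<Longrightarrow> F (y j) = G (y j)" "u \<in> loops Y a"
  shows "F u = G u"
proof -
  have "additive_on_loops Y a (\<lambda>u. F u - G u)"
    using assms(1,2) unfolding crossed_def by fastforce
  then show ?thesis
    using additive_zero [of "\<lambda>u. F u - G u" u] assms(3,4) by simp
qed

lemma crossed_subset:
  assumes "crossed Z a \<phi> F" "Z' \<subseteq> Z"
  shows "crossed Z' a \<phi> F"
proof -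
  have "loops Z' a \<subseteq> loops Z a" using assms(2) by (auto simp: loops_def)
  then show ?thesis
    using assms(1) homotopic_paths_subset [OF _ assms(2)] unfolding crossed_def by blast
qed

context plane_system
begin

abbreviation "\<Omega> J \<equiv> loops (Y J) top_pt"

lemma top_in_Y: "top_pt \<in> Y J"
  using loops_base [OF y_loop] .

lemma \<Omega>_mono: "u \<in> \<Omega> J \<Longrightarrow> K \<subseteq> J \<Longrightarrow> u \<in> \<Omega> K"
  using Y_mono [of K J] unfolding loops_def by blast

lemma crossed_mono: "crossed (Y K) top_pt \<phi> F \<Longrightarrow> K \<subseteq> J \<Longrightarrow> crossed (Y J) top_pt \<phi> F"
  using crossed_subset Y_mono by blast

lemma crossed_null:
  assumes "crossed (Y J) top_pt \<phi> F" "normalised (Y J) top_pt \<phi>" "u \<in> \<Omega> J" "homotopic_paths (Y J) u (linepath top_pt top_pt)"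
  shows "F u = 0"
  using crossed_homotopic [OF assms] crossed_const [OF assms(1,2) top_in_Y] by simp

text \<open>Evaluates a function along the cyclic product of meridians one factor at a time;
  \<open>crossed_skip\<close> passes over the contractible factors.\<close>

lemma crossed_step:
  assumes "crossed (Y J) top_pt \<phi> F"
  shows "F (lune p e) = F (y p) + F (lune (p + 1) e) + \<phi> (y p) (lune (p + 1) e)"
  using assms lune_join [of J p "p + 1" e] unfolding crossed_def y_def by simp

lemma crossed_skip:
  assumes "crossed (Y J) top_pt \<phi> F" "normalised (Y J) top_pt \<phi>" "p \<le> q"
    "\<And>r k. p \<le> r \<Longrightarrow> r < q \<Longrightarrow> k \<in> J \<Longrightarrow> \<not> int n dvd r - k"
  shows "F (lune p e) = F (lune q e)"
  using crossed_homotopic [OF assms(1,2) lune_loop lune_drop [OF assms(3,4)]] by blast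

lemma not_dvd: "int n * m < d \<Longrightarrow> d < int n * (m + 1) \<Longrightarrow> \<not> int n dvd d"
  using n by (auto simp: dvd_def)

section \<open>Linking numbers and primitives of cup products\<close>

definition linking :: "int \<Rightarrow> (real \<Rightarrow> space4) \<Rightarrow> int" where
  "linking k = (SOME F. additive_on_loops (Y {k}) top_pt F \<and> F (y k) = 1)"

lemma linking_single: "additive_on_loops (Y {k}) top_pt (linking k)" and linking_y [simp]: "linking k (y k) = 1"
proof -
  interpret b: loop_basis "Y {k}" top_pt "{k}" y by (rule loop_basis_single)
  have "\<exists>F. additive_on_loops (Y {k}) top_pt F \<and> F (y k) = 1"
  proof (rule b.dual_basis)
    fix l assume "\<And>i. i \<in> {k} \<Longrightarrow> additive_on_loops (Y {k}) top_pt (l i)"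
      "\<And>i j. i \<in> {k} \<Longrightarrow> j \<in> {k} \<Longrightarrow> l i (y j) = (if i = j then 1 else 0)"
    then show ?thesis by (intro exI [of _ "l k"]) simp
  qed
  from someI_ex [OF this] show "additive_on_loops (Y {k}) top_pt (linking k)" "linking k (y k) = 1"
    by (auto simp: linking_def)
qed

lemma linking_additive: "k \<in> J \<Longrightarrow> additive_on_loops (Y J) top_pt (linking k)"
  by (rule crossed_mono [OF linking_single]) simp

lemma linking_other: "\<not> int n dvd p - k \<Longrightarrow> linking k (y p) = 0"
  by (rule crossed_null [OF linking_single normalised_zero y_loop y_null]) auto

text \<open>In the complement of one plane the cyclic relation reduces to a product of
  \<open>y k\<close> and \<open>y (k + int n)\<close>.\<close>

lemma linking_opposite [simp]: "linking k (y (k + int n)) = - 1"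
proof -
  let ?e = "k + 2 * int n"
  note step = crossed_step [OF linking_single [of k], where e = ?e] and skip = crossed_skip [OF linking_single [of k] normalised_zero, where e = ?e]
  have "linking k (lune k ?e) = 0"
    by (rule crossed_null [OF linking_single normalised_zero lune_loop lune_full])
  moreover have "linking k (lune (k + 1) ?e) = linking k (lune (k + int n) ?e)"
    by (rule skip) (use n not_dvd [of 0] in auto)
  moreover have "linking k (lune (k + int n + 1) ?e) = 0"
    by (rule crossed_null [OF linking_single normalised_zero lune_loop lune_null])
      (use n not_dvd [of 1] in \<open>auto simp: algebra_simps\<close>)
  ultimately show ?thesis
    using step [of k] step [of "k + int n"] by simp
qed

lemma transport_crossed:
  assumes "crossed (Y ((\<lambda>k. k + m) ` J)) top_pt \<phi> F"
  shows "crossed (Y J) top_pt (\<lambda>u v. \<phi> (transport m u) (transport m v)) (\<lambda>u. F (transport m u))"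
  unfolding crossed_def
proof (intro ballI allI impI)
  fix u v w assume u: "u \<in> \<Omega> J" and v: "v \<in> \<Omega> J" and w: "homotopic_paths (Y J) (u +++ v) w"
  have "homotopic_paths (Y ((\<lambda>k. k + m) ` J)) (transport m u +++ transport m v) (transport m w)"
    using transport_join [OF u v] transport_homotopic [OF loops_join [OF u v] w] homotopic_paths_trans by blast
  then show "F (transport m w) = F (transport m u) + F (transport m v) + \<phi> (transport m u) (transport m v)"
    using assms transport_loop [OF u] transport_loop [OF v] unfolding crossed_def by blast
qed

lemma crossed_transport_y:
  assumes "crossed (Y J) top_pt \<phi> F" "normalised (Y J) top_pt \<phi>"
  shows "F (transport m (y p)) = F (y (p + m))"
  using crossed_homotopic [OF assms y_loop homotopic_paths_sym [OF transport_y]] .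

lemma linking_transport:
  assumes "u \<in> \<Omega> {k}"
  shows "linking (k + m) (transport m u) = linking k u"
proof -
  interpret b: loop_basis "Y {k}" top_pt "{k}" y by (rule loop_basis_single)
  show ?thesis
    by (rule b.crossed_unique [OF transport_crossed [of m "{k}" "\<lambda>_ _. 0"] linking_single _ assms])
      (use linking_single [of "k + m"] crossed_transport_y [OF linking_single [of "k + m"] normalised_zero, of m k] in auto)
qed

text \<open>The plane is the same, but the normalisation uses the opposite edge, which reverses the
  orientation.\<close>

lemma linking_period:
  assumes "u \<in> \<Omega> {k}"
  shows "linking (k + int n) u = - linking k u"
proof -
  interpret b: loop_basis "Y {k}" top_pt "{k}" y by (rule loop_basis_single)
  have 1: "additive_on_loops (Y {k}) top_pt (linking (k + int n))"
    using linking_single [of "k + int n"] Y_period(2) by simp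
  have 2: "additive_on_loops (Y {k}) top_pt (\<lambda>u. - linking k u)"
    using linking_single [of k] unfolding crossed_def by fastforce
  have 3: "linking (k + int n) (y k) = - 1"
    using linking_opposite [of "k + int n"] y_period [of k] by (simp add: algebra_simps)
  show ?thesis
    by (rule b.crossed_unique [OF 1 2 _ assms]) (use 3 in simp)
qed

lemma linking_join: "k \<in> J \<Longrightarrow> u \<in> \<Omega> J \<Longrightarrow> v \<in> \<Omega> J \<Longrightarrow> linking k (u +++ v) = linking k u + linking k v"
  using crossed_join [OF linking_additive] by fastforce

lemma linking_hom: "k \<in> J \<Longrightarrow> u \<in> \<Omega> J \<Longrightarrow> homotopic_paths (Y J) u v \<Longrightarrow> linking k v = linking k u"
  using crossed_homotopic [OF linking_additive normalised_zero] by blast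

lemma linking_const: "linking k (linepath top_pt top_pt) = 0"
  by (rule crossed_const [OF linking_single normalised_zero top_in_Y])

lemma loop_cocycle_cup:
  assumes ij: "i \<in> J" "j \<in> J"
  shows "loop_cocycle (Y J) top_pt (\<lambda>u v. linking i u * linking j v)"
  unfolding loop_cocycle_def normalised_def
  by (simp add: linking_const linking_join [OF ij(1)] linking_join [OF ij(2)] linking_hom [OF ij(1)] linking_hom [OF ij(2)] algebra_simps)

lemma normalised_cup: "i \<in> J \<Longrightarrow> j \<in> J \<Longrightarrow> normalised (Y J) top_pt (\<lambda>u v. linking i u * linking j v)"
  using loop_cocycle_cup unfolding loop_cocycle_def by blast

text \<open>Unique because \<open>y i\<close> and \<open>y j\<close> form a basis, and thus compatible with the screw motion.\<close>

definition cup_primitive :: "int \<Rightarrow> int \<Rightarrow> (real \<Rightarrow> space4) \<Rightarrow> int" where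
  "cup_primitive i j = (SOME F. crossed (Y {i, j}) top_pt (\<lambda>u v. linking i u * linking j v) F \<and> F (y i) = 0 \<and> F (y j) = 0)"

lemma cup_primitive:
  assumes "\<not> int n dvd i - j"
  shows "crossed (Y {i, j}) top_pt (\<lambda>u v. linking i u * linking j v) (cup_primitive i j)" "cup_primitive i j (y i) = 0" "cup_primitive i j (y j) = 0"
proof -
  interpret b: loop_basis "Y {i, j}" top_pt "{i, j}" y by (rule loop_basis_pair [OF assms])
  obtain F where "crossed (Y {i, j}) top_pt (\<lambda>u v. linking i u * linking j v) F" "\<And>k. k \<in> {i, j} \<Longrightarrow> F (y k) = 0"
    by (rule b.crossed_exists [OF loop_cocycle_cup [of i "{i, j}" j]]) auto
  then have "\<exists>F. crossed (Y {i, j}) top_pt (\<lambda>u v. linking i u * linking j v) F \<and> F (y i) = 0 \<and> F (y j) = 0"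
    by blast
  from someI_ex [OF this]
  show "crossed (Y {i, j}) top_pt (\<lambda>u v. linking i u * linking j v) (cup_primitive i j)" "cup_primitive i j (y i) = 0" "cup_primitive i j (y j) = 0"
    by (auto simp: cup_primitive_def)
qed

lemma cup_primitive_other:
  assumes "\<not> int n dvd i - j" "\<not> int n dvd p - i" "\<not> int n dvd p - j"
  shows "cup_primitive i j (y p) = 0"
  by (rule crossed_null [OF cup_primitive(1) [OF assms(1)] normalised_cup y_loop y_null]) (use assms in auto)

text \<open>With only the planes \<open>i\<close> and \<open>j\<close> removed, the cyclic relation
  reads \<open>y_i y_j y_{i+n} y_{j+n} = 1\<close>. Expanding the primitive over it, the products of
  linking numbers are 1 for the pair (i, j), -1 for (i, j+n) and 1 for (i+n, j+n), in total
  1.\<close>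

lemma cup_primitive_relation:
  assumes "i < j" "j < i + int n"
  shows "cup_primitive i j (y (i + int n)) + cup_primitive i j (y (j + int n)) = - 1"
proof -
  let ?e = "i + 2 * int n" and ?J = "{i, j}"
  have ndij: "\<not> int n dvd i - j" using assms not_dvd [of "-1" "i - j"] by simp
  have ndij': "\<not> int n dvd j - i" "\<not> int n dvd i + int n - j" "\<not> int n dvd j + int n - i"
    using assms not_dvd [of 0 "j - i"] not_dvd [of 0 "i + int n - j"] not_dvd [of 1 "j + int n - i"] by (auto simp: algebra_simps)
  have gaps: "\<And>r k. i + 1 \<le> r \<Longrightarrow> r < j \<Longrightarrow> k \<in> ?J \<Longrightarrow> \<not> int n dvd r - k"
     "\<And>r k. j + 1 \<le> r \<Longrightarrow> r < i + int n \<Longrightarrow> k \<in> ?J \<Longrightarrow> \<not> int n dvd r - k"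
     "\<And>r k. i + int n + 1 \<le> r \<Longrightarrow> r < j + int n \<Longrightarrow> k \<in> ?J \<Longrightarrow> \<not> int n dvd r - k"
     "\<And>r k. j + int n + 1 \<le> r \<Longrightarrow> r < ?e \<Longrightarrow> k \<in> ?J \<Longrightarrow> \<not> int n dvd r - k"
    using assms not_dvd [of 0] not_dvd [of 1] not_dvd [of "-1"] by (auto simp: algebra_simps)
  have calc: "F (lune i ?e) = 0 \<and> F (lune (i + 1) ?e) = F (lune j ?e) \<and> F (lune (j + 1) ?e) = F (lune (i + int n) ?e) \<and>
      F (lune (i + int n + 1) ?e) = F (lune (j + int n) ?e) \<and> F (lune (j + int n + 1) ?e) = 0"
    if F: "crossed (Y ?J) top_pt \<phi> F" and \<phi>: "normalised (Y ?J) top_pt \<phi>" for F \<phi>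
  proof (intro conjI)
    show "F (lune i ?e) = 0" by (rule crossed_null [OF F \<phi> lune_loop lune_full])
    show "F (lune (i + 1) ?e) = F (lune j ?e)"
      by (rule crossed_skip [OF F \<phi> _ gaps(1)]) (use assms in auto)
    show "F (lune (j + 1) ?e) = F (lune (i + int n) ?e)"
      by (rule crossed_skip [OF F \<phi> _ gaps(2)]) (use assms in auto)
    show "F (lune (i + int n + 1) ?e) = F (lune (j + int n) ?e)"
      by (rule crossed_skip [OF F \<phi> _ gaps(3)]) (use assms in auto)
    show "F (lune (j + int n + 1) ?e) = 0"
      by (rule crossed_null [OF F \<phi> lune_loop lune_null [OF _ gaps(4)]]) (use assms in auto)
  qed
  note l = linking_additive [of j ?J, simplified]
  note cl = calc [OF l normalised_zero] and sl = crossed_step [OF l, where e = ?e]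
  \<comment> \<open>The linking numbers of the remaining tails, which are the second factors of the
    product terms in \<open>sb\<close>.\<close>
  have lj: "linking j (lune (j + int n) ?e) = - 1" "linking j (lune (i + int n) ?e) = - 1" "linking j (lune j ?e) = 0"
    using cl sl [of "j + int n"] sl [of "i + int n"] sl [of j] linking_other [of "i + int n" j] ndij' by auto
  note b = cup_primitive [OF ndij]
  have nb: "normalised (Y ?J) top_pt (\<lambda>u v. linking i u * linking j v)" by (rule normalised_cup) auto
  note cb = calc [OF b(1) nb] and sb = crossed_step [OF b(1), where e = ?e]
  show ?thesis
    using cb cl sb [of i] sb [of j] sb [of "i + int n"] sb [of "j + int n"] lj b(2,3)
      linking_other [of j i] linking_other [of "j + int n" i] ndij' by simp
qed

lemma cup_primitive_transport:
  assumes nd: "\<not> int n dvd i - j" and u: "u \<in> \<Omega> {i, j}"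
  shows "cup_primitive (i + m) (j + m) (transport m u) = cup_primitive i j u"
proof -
  interpret b: loop_basis "Y {i, j}" top_pt "{i, j}" y by (rule loop_basis_pair [OF nd])
  have nd': "\<not> int n dvd (i + m) - (j + m)" using nd by simp
  have nb: "normalised (Y {i + m, j + m}) top_pt (\<lambda>u v. linking (i + m) u * linking (j + m) v)" by (rule normalised_cup) auto
  have im: "(\<lambda>k. k + m) ` {i, j} = {i + m, j + m}" by auto
  have "crossed (Y {i, j}) top_pt (\<lambda>u v. linking i u * linking j v) (\<lambda>u. cup_primitive (i + m) (j + m) (transport m u))"
    by (rule crossed_cong [OF transport_crossed])
      (use cup_primitive(1) [OF nd'] linking_transport [OF \<Omega>_mono, of _ "{i, j}"] in \<open>auto simp: im\<close>)
  then show ?thesis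
    by (rule b.crossed_unique [OF _ cup_primitive(1) [OF nd] _ u])
      (use crossed_transport_y [OF cup_primitive(1) [OF nd'] nb, of m] cup_primitive(2,3) [OF nd] cup_primitive(2,3) [OF nd'] in auto)
qed

text \<open>The number p_ij. On a conjugate of the inverse of \<open>y i\<close> by a loop g,
  \<open>cup_primitive i j\<close> takes the value \<open>linking j g\<close>; so
  \<open>cross i j\<close> may be read as the winding around plane \<open>j\<close> of a passage
  along plane \<open>i\<close> from one edge to the other.\<close>

definition cross :: "int \<Rightarrow> int \<Rightarrow> int" where
  "cross i j = cup_primitive i j (y (i + int n))"

lemma cross_shift:
  assumes "\<not> int n dvd i - j"
  shows "cross (i + m) (j + m) = cross i j"
proof -
  have nd': "\<not> int n dvd (i + m) - (j + m)" using assms by simp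
  have nb: "normalised (Y {i + m, j + m}) top_pt (\<lambda>u v. linking (i + m) u * linking (j + m) v)" by (rule normalised_cup) auto
  show ?thesis
    using cup_primitive_transport [OF assms y_loop, of m "i + int n"] crossed_transport_y [OF cup_primitive(1) [OF nd'] nb, of m "i + int n"]
    by (simp add: cross_def algebra_simps)
qed

text \<open>Cup products anticommute up to the coboundary of the pointwise product. As
  \<open>linking (i + int n)\<close> is minus \<open>linking i\<close>, the primitives for (j, i+n)
  and (i, j) differ by that product and a homomorphism, which is a multiple of
  \<open>linking i\<close>; its values at \<open>y i\<close> and \<open>y (i + int n)\<close> are
  opposite.\<close>

lemma cross_wrap:
  assumes "i < j" "j < i + int n"
  shows "cross i j + cross j (i + int n) = - 1"
proof -
  have nd: "\<not> int n dvd i - j" "\<not> int n dvd j - i" "\<not> int n dvd j - (i + int n)" "\<not> int n dvd i + int n - j"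
    using assms not_dvd [of "-1" "i - j"] not_dvd [of 0 "j - i"] not_dvd [of "-1" "j - (i + int n)"] not_dvd [of 0 "i + int n - j"]
    by auto
  interpret b: loop_basis "Y {i, j}" top_pt "{i, j}" y by (rule loop_basis_pair [OF nd(1)])
  let ?C = "cup_primitive j (i + int n)" and ?B = "cup_primitive i j"
  \<comment> \<open>The product \<open>linking i u * linking j u\<close> has both mixed terms in its
    coboundary; they cancel those of \<open>?C\<close> and \<open>- ?B\<close>.\<close>
  define D where "D = (\<lambda>u. ?C u - ?B u + linking i u * linking j u)"
  have YY: "Y {j, i + int n} = Y {i, j}"
    using Y_period(1) [of i j] by (simp add: insert_commute)
  have C: "crossed (Y {i, j}) top_pt (\<lambda>u v. - (linking j u * linking i v)) ?C"
    using crossed_cong [OF cup_primitive(1) [OF nd(3), unfolded YY], of "\<lambda>u v. - (linking j u * linking i v)"]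
      linking_period [OF \<Omega>_mono, of _ "{i, j}" i] by auto
  have li: "linking i w = linking i u + linking i v" "linking j w = linking j u + linking j v"
    if "u \<in> \<Omega> {i, j}" "v \<in> \<Omega> {i, j}" "homotopic_paths (Y {i, j}) (u +++ v) w" for u v w
    using linking_additive [of i "{i, j}"] linking_additive [of j "{i, j}"] that unfolding crossed_def by auto
  have D: "additive_on_loops (Y {i, j}) top_pt D"
    using C cup_primitive(1) [OF nd(1)] li unfolding crossed_def D_def by (simp add: algebra_simps)
  have yi: "y i = y (i + int n + int n)" using y_period [of i] by (simp add: algebra_simps)
  \<comment> \<open>Seen from index \<open>i + int n\<close>, the loop \<open>y i\<close> is the
    meridian at the opposite edge, so the relation for the pair (j, i+n) applies.\<close>
  have Dyi: "D (y i) = ?C (y (i + int n + int n))"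
    using cup_primitive(2) [OF nd(1)] linking_other [of i j] nd by (simp add: D_def yi)
  also have "\<dots> = - 1 - cross j (i + int n)"
    using cup_primitive_relation [of j "i + int n"] assms by (simp add: cross_def)
  finally have Dyi: "D (y i) = - 1 - cross j (i + int n)" .
  have Dyj: "D (y j) = 0"
    using cup_primitive(3) [OF nd(1)] cup_primitive(2) [OF nd(3)] linking_other [of j i] nd by (simp add: D_def)
  have E: "additive_on_loops (Y {i, j}) top_pt (\<lambda>u. D (y i) * linking i u)"
    using li unfolding crossed_def by (simp add: algebra_simps)
  have "D (y (i + int n)) = D (y i) * linking i (y (i + int n))"
    by (rule b.crossed_unique [OF D E _ y_loop]) (use Dyj linking_other [of j i] nd in auto)
  moreover have "D (y (i + int n)) = - cross i j"
    using cup_primitive(3) [OF nd(3)] linking_other [of "i + int n" j] nd by (simp add: D_def cross_def)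
  ultimately show ?thesis using Dyi by simp
qed

lemma Y_shift_period: "Y ((\<lambda>k. k + int n) ` J) = Y J"
  by (simp add: Y_def periodic)

text \<open>The \<open>n\<close>-th power of the screw motion maps a plane to itself and exchanges
  its two edges, whose meridians have opposite linking numbers.\<close>

lemma linking_half_turn:
  assumes "u \<in> \<Omega> {k}"
  shows "linking k (transport (int n) u) = - linking k u"
proof -
  have "transport (int n) u \<in> \<Omega> {k}"
    using transport_loop [OF assms, of "int n"] by (simp only: Y_shift_period)
  then show ?thesis
    using linking_period [of "transport (int n) u" k] linking_transport [OF assms, of "int n"] by simp
qed

text \<open>Two sign changes leave the cup product fixed, so the two primitives differ by a
  homomorphism. It is determined on \<open>y i\<close> and \<open>y j\<close>, which are carried to
  the meridians at the opposite edges.\<close>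

lemma cup_primitive_half_turn:
  assumes nd: "\<not> int n dvd i - j" and u: "u \<in> \<Omega> {i, j}"
  shows "cup_primitive i j (transport (int n) u) = cup_primitive i j u + cross i j * linking i u + cup_primitive i j (y (j + int n)) * linking j u"
proof -
  have nd': "\<not> int n dvd j - i" using nd by (metis dvd_minus_iff minus_diff_eq)
  interpret b: loop_basis "Y {i, j}" top_pt "{i, j}" y by (rule loop_basis_pair [OF nd])
  note c = cup_primitive [OF nd]
  have nb: "normalised (Y {i, j}) top_pt (\<lambda>u v. linking i u * linking j v)" by (rule normalised_cup) auto
  have "crossed (Y ((\<lambda>k. k + int n) ` {i, j})) top_pt (\<lambda>u v. linking i u * linking j v) (cup_primitive i j)"
    unfolding Y_shift_period by (rule c(1))
  from crossed_cong [OF transport_crossed [OF this]]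
  have 1: "crossed (Y {i, j}) top_pt (\<lambda>u v. linking i u * linking j v) (\<lambda>u. cup_primitive i j (transport (int n) u))"
    using linking_half_turn [OF \<Omega>_mono, of _ "{i, j}"] by auto
  have li: "linking i w = linking i u + linking i v" "linking j w = linking j u + linking j v"
    if "u \<in> \<Omega> {i, j}" "v \<in> \<Omega> {i, j}" "homotopic_paths (Y {i, j}) (u +++ v) w" for u v w
    using linking_additive [of i "{i, j}"] linking_additive [of j "{i, j}"] that unfolding crossed_def by auto
  have 2: "crossed (Y {i, j}) top_pt (\<lambda>u v. linking i u * linking j v)
      (\<lambda>u. cup_primitive i j u + cross i j * linking i u + cup_primitive i j (y (j + int n)) * linking j u)"
    using c(1) li unfolding crossed_def by (simp add: algebra_simps)
  show ?thesis
    by (rule b.crossed_unique [OF 1 2 _ u])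
      (use crossed_transport_y [OF c(1) nb, of "int n"] c(2,3) linking_other [of i j] linking_other [of j i] nd nd' in
        \<open>auto simp: cross_def\<close>)
qed

text \<open>A Massey product argument: a primitive \<open>M\<close> of the triple product and its
  half-turn image add up to known double primitives and a homomorphism, and evaluation at both
  meridians of plane \<open>i\<close> leaves \<open>2 * M (y (i + int n))\<close>.\<close>

lemma cross_triple:
  assumes "i < j" "j < k" "k < i + int n"
  shows "even (cross j k * cross i j + (cross i j - 1 - cross j k) * cross i k)"
proof -
  let ?J = "{i, j, k}"
  have nd: "\<not> int n dvd i - j" "\<not> int n dvd i - k" "\<not> int n dvd j - k" "\<not> int n dvd j - i" "\<not> int n dvd k - i" "\<not> int n dvd k - j"
    "\<not> int n dvd i + int n - j" "\<not> int n dvd i + int n - k"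
    using assms not_dvd [of "-1"] not_dvd [of 0] by auto
  interpret b: loop_basis "Y ?J" top_pt ?J y by (rule loop_basis_triple [OF nd(1-3)])
  have lm: "linking l w = linking l u + linking l v"
    if "l \<in> ?J" "u \<in> \<Omega> ?J" "v \<in> \<Omega> ?J" "homotopic_paths (Y ?J) (u +++ v) w" for l u v w
    using linking_additive [of l ?J] that unfolding crossed_def by auto
  have cij: "crossed (Y ?J) top_pt (\<lambda>u v. linking i u * linking j v) (cup_primitive i j)"
    and cjk: "crossed (Y ?J) top_pt (\<lambda>u v. linking j u * linking k v) (cup_primitive j k)"
    and cik: "crossed (Y ?J) top_pt (\<lambda>u v. linking i u * linking k v) (cup_primitive i k)"
    by (rule crossed_mono [OF cup_primitive(1)]; use nd in auto)+
  have nij: "normalised (Y ?J) top_pt (\<lambda>u v. linking i u * linking j v)" and njk: "normalised (Y ?J) top_pt (\<lambda>u v. linking j u * linking k v)"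
    by (rule normalised_cup; simp)+
  \<comment> \<open>The Massey triple product: the coboundaries of both summands are the threefold
    product of the linking numbers, with opposite signs.\<close>
  define \<phi> where "\<phi> = (\<lambda>u v. linking i u * cup_primitive j k v + cup_primitive i j u * linking k v)"
  have coc: "loop_cocycle (Y ?J) top_pt \<phi>"
    unfolding loop_cocycle_def normalised_def
  proof (intro conjI ballI allI impI)
    show "\<phi> u (linepath top_pt top_pt) = 0" "\<phi> (linepath top_pt top_pt) u = 0" for u
      by (simp_all add: \<phi>_def linking_const crossed_const [OF cij nij top_in_Y] crossed_const [OF cjk njk top_in_Y])
    fix u v assume u: "u \<in> \<Omega> ?J" and v: "v \<in> \<Omega> ?J"
    show "\<phi> u' v' = \<phi> u v" if "homotopic_paths (Y ?J) u u'" "homotopic_paths (Y ?J) v v'" for u' v'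
      using crossed_homotopic [OF cij nij u that(1)] crossed_homotopic [OF cjk njk v that(2)]
        linking_hom [OF _ u that(1), of i] linking_hom [OF _ v that(2), of k] by (simp add: \<phi>_def)
    fix w assume w: "w \<in> \<Omega> ?J"
    show "\<phi> v w - \<phi> (u +++ v) w + \<phi> u (v +++ w) - \<phi> u v = 0"
      using crossed_join [OF cij u v] crossed_join [OF cjk v w] linking_join [OF _ u v, of i] linking_join [OF _ v w, of k]
      by (simp add: \<phi>_def algebra_simps)
  qed
  obtain M where M: "crossed (Y ?J) top_pt \<phi> M" and M0': "\<forall>l\<in>?J. M (y l) = 0"
  proof (rule b.crossed_exists [OF coc])
    fix F assume "crossed (Y ?J) top_pt \<phi> F" "\<And>l. l \<in> ?J \<Longrightarrow> F (y l) = 0"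
    then show ?thesis by (intro that [of F] ballI)
  qed
  note M0 = M0' [rule_format]
  have n\<phi>: "normalised (Y ?J) top_pt \<phi>" using coc by (simp add: loop_cocycle_def)
  define p q r s where "p = cross i j" and "q = cup_primitive i j (y (j + int n))" and "r = cross j k" and "s = cup_primitive j k (y (k + int n))"
  have s: "s = - 1 - r"
    using cup_primitive_relation [of j k] assms by (simp add: r_def s_def cross_def)
  define S where "S = transport (int n)"
  have Sl: "linking l (S u) = - linking l u" if "l \<in> ?J" "u \<in> \<Omega> ?J" for l u
    unfolding S_def by (rule linking_half_turn [OF \<Omega>_mono [OF that(2)]]) (use that in auto)
  have Sij: "cup_primitive i j (S u) = cup_primitive i j u + p * linking i u + q * linking j u" if "u \<in> \<Omega> ?J" for u
    unfolding S_def p_def q_def by (rule cup_primitive_half_turn [OF nd(1) \<Omega>_mono [OF that]]) auto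
  have Sjk: "cup_primitive j k (S u) = cup_primitive j k u + r * linking j u + s * linking k u" if "u \<in> \<Omega> ?J" for u
    unfolding S_def r_def s_def by (rule cup_primitive_half_turn [OF nd(3) \<Omega>_mono [OF that]]) auto
  have MS: "crossed (Y ?J) top_pt (\<lambda>u v. \<phi> (S u) (S v)) (\<lambda>u. M (S u))"
    unfolding S_def by (rule transport_crossed) (simp only: Y_shift_period M)
  \<comment> \<open>The half turn changes \<open>\<phi>\<close> to its negative minus
    \<open>r\<close> times the (i,j) product, \<open>s + p\<close> times the (i,k) product and
    \<open>q\<close> times the (j,k) product; the double primitives absorb these terms.\<close>
  define E where "E = (\<lambda>u. M (S u) + M u + r * cup_primitive i j u + (s + p) * cup_primitive i k u + q * cup_primitive j k u)"
  have E: "additive_on_loops (Y ?J) top_pt E"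
    unfolding crossed_def
  proof (intro ballI allI impI)
    fix u v w assume u: "u \<in> \<Omega> ?J" and v: "v \<in> \<Omega> ?J" and w: "homotopic_paths (Y ?J) (u +++ v) w"
    have "M w = M u + M v + \<phi> u v" "M (S w) = M (S u) + M (S v) + \<phi> (S u) (S v)"
      "cup_primitive i j w = cup_primitive i j u + cup_primitive i j v + linking i u * linking j v"
      "cup_primitive j k w = cup_primitive j k u + cup_primitive j k v + linking j u * linking k v"
      "cup_primitive i k w = cup_primitive i k u + cup_primitive i k v + linking i u * linking k v"
      using M MS cij cjk cik u v w unfolding crossed_def by blast+
    then show "E w = E u + E v + 0"
      using Sl [OF _ u, of i] Sl [OF _ v, of k] Sij [OF u] Sjk [OF v]
      by (simp add: E_def \<phi>_def algebra_simps)
  qed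
  have F: "additive_on_loops (Y ?J) top_pt (\<lambda>u. E (y i) * linking i u + E (y j) * linking j u + E (y k) * linking k u)"
    using lm unfolding crossed_def by (simp add: algebra_simps)
  have "E (y (i + int n)) = E (y i) * linking i (y (i + int n)) + E (y j) * linking j (y (i + int n)) + E (y k) * linking k (y (i + int n))"
    by (rule b.crossed_unique [OF E F _ y_loop])
      (use linking_other [of i j] linking_other [of i k] linking_other [of j i] linking_other [of j k] linking_other [of k i] linking_other [of k j] nd in auto)
  then have 1: "E (y (i + int n)) = - E (y i)"
    using linking_other [of "i + int n" j] linking_other [of "i + int n" k] nd by simp
  have MSy: "M (S (y l)) = M (y (l + int n))" for l
    unfolding S_def by (rule crossed_transport_y [OF M n\<phi>])
  have yi: "y (i + int n + int n) = y i" using y_period [of i] by (simp add: algebra_simps)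
  have 2: "E (y i) = M (y (i + int n))"
    using MSy [of i] M0 [of i] cup_primitive(2) [OF nd(1)] cup_primitive(2) [OF nd(2)] cup_primitive_other [OF nd(3), of i] nd by (simp add: E_def)
  have 3: "E (y (i + int n)) = M (y (i + int n)) + r * p + (s + p) * cross i k"
    using MSy [of "i + int n", unfolded yi] M0 [of i] cup_primitive_other [OF nd(3), of "i + int n"] nd
    by (simp add: E_def p_def cross_def)
  \<comment> \<open>\<open>E\<close> is additive and \<open>y (i + int n)\<close> has coordinates
    (-1, 0, 0), so \<open>E (y (i + int n))\<close> is also
    \<open>- M (y (i + int n))\<close>.\<close>
  have "r * p + (p - 1 - r) * cross i k = 2 * (- M (y (i + int n)))"
    using 1 2 3 s by (simp add: algebra_simps)
  then show ?thesis
    unfolding p_def r_def by (metis dvd_triv_left)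
qed

theorem inconsistent: False
proof -
  define f where "f = cross 0"
  have sh: "cross i j = f (j - i)" if "i < j" "j < i + int n" for i j
    using cross_shift [of 0 "j - i" i] not_dvd [of "-1" "i - j"] that by (simp add: f_def)
  \<comment> \<open>In the triple relation for 0, 1, d+1, if \<open>f d\<close> and
    \<open>f 1\<close> have the same parity, then \<open>f 1 - 1 - f d\<close> is odd and
    \<open>f d * f 1\<close> has the parity of \<open>f 1\<close>; so \<open>f (d + 1)\<close> has
    it too.\<close>
  have par: "even (f d) \<longleftrightarrow> even (f 1)" if "1 \<le> d" "d < int n" for d
    using that
  proof (induction d rule: int_ge_induct)
    case (step d)
    have "even (cross 1 (d + 1) * cross 0 1 + (cross 0 1 - 1 - cross 1 (d + 1)) * cross 0 (d + 1))"
      by (rule cross_triple) (use step in auto)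
    then have "even (f d * f 1 + (f 1 - 1 - f d) * f (d + 1))"
      using sh [of 1 "d + 1"] step by (simp add: f_def)
    then show ?case using step by auto
  qed simp
  have "f 1 + f (int n - 1) = - 1"
    using cross_wrap [of 0 1] sh [of 1 "int n"] n by (simp add: f_def)
  moreover have "even (f (int n - 1)) \<longleftrightarrow> even (f 1)"
    using par [of "int n - 1"] n by simp
  ultimately show False by presburger
qed

end

subsection \<open>The universal cover of the band\<close>

abbreviation strip :: "(real \<times> real) set" where
  "strip \<equiv> UNIV \<times> {0..1}"

text \<open>Powers of the glide reflection that generates the deck group of the universal cover of
  the band.\<close>

definition deck :: "int \<Rightarrow> real \<times> real \<Rightarrow> real \<times> real" where
  "deck k a = (fst a + of_int k, if even k then snd a else 1 - snd a)"

lemma fst_deck [simp]: "fst (deck k a) = fst a + of_int k"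
  and snd_deck: "snd (deck k a) = (if even k then snd a else 1 - snd a)"
  by (simp_all add: deck_def)

lemma deck_0 [simp]: "deck 0 a = a"
  by (simp add: deck_def)

lemma deck_add: "deck k (deck l a) = deck (k + l) a"
  by (auto simp: deck_def)

lemma deck_strip [simp]: "deck k a \<in> strip \<longleftrightarrow> a \<in> strip"
  by (cases a) (auto simp: deck_def)

lemma deck_strip': "a \<in> strip \<Longrightarrow> snd (deck k a) \<in> {0..1}"
  by (cases a) (auto simp: deck_def)

lemma continuous_on_deck: "continuous_on S (deck k)"
  unfolding deck_def by (cases "even k") (auto intro!: continuous_intros)

locale moebius_strip =
  fixes M :: "'a::euclidean_space set" and G :: "real \<times> real \<Rightarrow> 'a"
  assumes continuous_G: "continuous_on strip G"
    and G_image: "G ` strip = M"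
    and G_eq: "a \<in> strip \<Longrightarrow> b \<in> strip \<Longrightarrow> G a = G b \<longleftrightarrow> (\<exists>k. b = deck k a)"

lemma moebius_band_square:
  fixes M :: "'a::euclidean_space set"
  assumes "moebius_band homeomorphic_space top_of_set M"
  obtains g where "continuous_on ({0..1} \<times> {0..1}) g" "g ` ({0..1} \<times> {0..1}) = M"
    "\<And>a b. a \<in> {0..1} \<times> {0..1} \<Longrightarrow> b \<in> {0..1} \<times> {0..1} \<Longrightarrow> g a = g b \<longleftrightarrow> (a, b) \<in> moebius_rel"
proof -
  obtain f where f: "homeomorphic_map moebius_band (top_of_set M) f"
    using assms homeomorphic_space by blast
  let ?Q = "{0..1} \<times> {0..1} :: (real \<times> real) set" and ?q = "\<lambda>x. moebius_rel `` {x}"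
  have q: "quotient_map (top_of_set ?Q) moebius_band ?q"
    unfolding moebius_band_def by (rule quotient_map_quotient_topology)
  have tq: "topspace moebius_band = ?Q // moebius_rel"
    by (simp add: moebius_band_def topspace_quotient_topology)
  have qm: "quotient_map (top_of_set ?Q) (top_of_set M) (f \<circ> ?q)"
    using quotient_map_compose [OF q] f unfolding homeomorphic_map_def by blast
  show thesis
  proof (rule that [of "f \<circ> ?q"])
    show "continuous_on ?Q (f \<circ> ?q)"
      using quotient_imp_continuous_map [OF qm] by simp
    show "(f \<circ> ?q) ` ?Q = M"
      using quotient_imp_surjective_map [OF qm] by simp
    fix a b assume ab: "a \<in> ?Q" "b \<in> ?Q"
    have "inj_on f (?Q // moebius_rel)"
      using f tq by (simp add: homeomorphic_eq_everything_map)
    then have "f (?q a) = f (?q b) \<longleftrightarrow> ?q a = ?q b"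
      by (rule inj_on_eq_iff) (use ab in \<open>blast intro: quotientI\<close>)+
    also have "\<dots> \<longleftrightarrow> (a, b) \<in> moebius_rel"
      using eq_equiv_class_iff [OF equiv_moebius_rel ab] .
    finally show "(f \<circ> ?q) a = (f \<circ> ?q) b \<longleftrightarrow> (a, b) \<in> moebius_rel" by simp
  qed
qed

text \<open>\<open>r\<close> moves a point by a deck transformation into the fundamental square. The
  pieces over unit intervals fit together because the gluing of the square is \<open>deck 1\<close>
  on its vertical sides.\<close>

lemma moebius_strip_exists:
  fixes M :: "'a::euclidean_space set"
  assumes "moebius_band homeomorphic_space top_of_set M"
  obtains G where "moebius_strip M G"
proof -
  let ?Q = "{0..1} \<times> {0..1} :: (real \<times> real) set"
  obtain g where cg: "continuous_on ?Q g" and gQ: "g ` ?Q = M"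
    and geq: "\<And>a b. a \<in> ?Q \<Longrightarrow> b \<in> ?Q \<Longrightarrow> g a = g b \<longleftrightarrow> (a, b) \<in> moebius_rel"
    using moebius_band_square [OF assms] by metis
  define r where "r a = deck (- \<lfloor>fst a\<rfloor>) a" for a
  define G where "G = g \<circ> r"
  have r_Q: "r a \<in> {0..<1} \<times> {0..1}" if "a \<in> strip" for a
    using that deck_strip' [OF that, of "- \<lfloor>fst a\<rfloor>"]
    by (auto simp: r_def mem_Times_iff) linarith+
  have r_Q': "r a \<in> ?Q" if "a \<in> strip" for a
    using r_Q [OF that] by (auto simp: mem_Times_iff)
  have r_deck: "r (deck k a) = r a" for k a
    by (simp add: r_def deck_add)
  have piece: "continuous_on ({of_int m..of_int m + 1} \<times> {0..1}) G" for m
  proof -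
    have "G a = g (deck (- m) a)" if a: "a \<in> {of_int m..of_int m + 1} \<times> {0..1}" for a
    proof (cases "fst a = of_int m + 1")
      case True
      then have fl: "\<lfloor>fst a\<rfloor> = m + 1" by simp
      have "(r a, deck (- m) a) \<in> moebius_rel"
        using a unfolding r_def fl by (auto simp: moebius_rel_def deck_def True)
      then show ?thesis
        using geq by (auto simp: G_def moebius_rel_def)
    next
      case False
      then have "\<lfloor>fst a\<rfloor> = m" using a by (auto simp: floor_eq_iff mem_Times_iff)
      then show ?thesis by (simp add: G_def r_def)
    qed
    moreover have "continuous_on ({of_int m..of_int m + 1} \<times> {0..1}) (g \<circ> deck (- m))"
      by (intro continuous_on_compose continuous_on_deck continuous_on_subset [OF cg])
        (auto simp: deck_def)
    ultimately show ?thesis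
      by (simp cong: continuous_on_cong)
  qed
  have pair: "continuous_on ({of_int m - 1..of_int m + 1} \<times> {0..1}) G" for m
  proof -
    have "{of_int m - 1..of_int m + 1 :: real} \<times> {0..1} =
        {of_int (m - 1)..of_int (m - 1) + 1} \<times> {0..1} \<union> {of_int m..of_int m + 1} \<times> {0..1 :: real}"
      by (auto simp: mem_Times_iff)
    then show ?thesis
      using continuous_on_closed_Un [OF _ _ piece [of "m - 1"] piece [of m]] by (simp add: closed_Times)
  qed
  have "continuous (at a within strip) G" if a: "a \<in> strip" for a
  proof -
    \<comment> \<open>An integer nearest to the first coordinate, so that this coordinate is
      interior to the window of length 2 on which \<open>pair\<close> applies.\<close>
    define m where "m = \<lfloor>fst a + 1 / 2\<rfloor>"
    let ?U = "{of_int m - 1<..<of_int m + 1} \<times> UNIV :: (real \<times> real) set"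
    have "at a within strip = at a within {of_int m - 1..of_int m + 1} \<times> {0..1}"
    proof (rule at_within_nhd [of _ ?U])
      show "a \<in> ?U" unfolding m_def by (auto simp: mem_Times_iff) linarith+
      show "open ?U" by (simp add: open_Times)
    qed auto
    moreover have "a \<in> {of_int m - 1..of_int m + 1} \<times> {0..1}"
      using a unfolding m_def by (auto simp: mem_Times_iff) linarith+
    ultimately show ?thesis
      using pair [of m] unfolding continuous_on_eq_continuous_within by metis
  qed
  then have "continuous_on strip G"
    by (simp add: continuous_on_eq_continuous_within)
  moreover have "G ` strip = M"
  proof
    show "G ` strip \<subseteq> M" using r_Q' gQ by (auto simp: G_def)
    show "M \<subseteq> G ` strip"
    proof
      fix p assume "p \<in> M"
      then obtain a where a: "a \<in> ?Q" "p = g a" using gQ by auto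
      show "p \<in> G ` strip"
      proof (cases "fst a = 1")
        case True
        then have "(r a, a) \<in> moebius_rel" using a by (auto simp: r_def deck_def moebius_rel_def)
        then have "p = G a" using geq a by (auto simp: G_def moebius_rel_def)
        then show ?thesis using a by auto
      next
        case False
        then have "\<lfloor>fst a\<rfloor> = 0" using a by (auto simp: floor_eq_iff mem_Times_iff)
        then have "p = G a" using a by (simp add: G_def r_def)
        then show ?thesis using a by auto
      qed
    qed
  qed
  moreover have "G a = G b \<longleftrightarrow> (\<exists>k. b = deck k a)" if ab: "a \<in> strip" "b \<in> strip" for a b
  proof
    assume "\<exists>k. b = deck k a"
    then show "G a = G b" by (auto simp: G_def r_deck)
  next
    assume "G a = G b"
    then have "(r a, r b) \<in> moebius_rel"
      using geq [OF r_Q' [OF ab(1)] r_Q' [OF ab(2)]] by (simp add: G_def)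
    then have "r a = r b"
      using r_Q [OF ab(1)] r_Q [OF ab(2)] by (auto simp: moebius_rel_def doubleton_eq_iff mem_Times_iff)
    then have "b = deck (\<lfloor>fst b\<rfloor> - \<lfloor>fst a\<rfloor>) a"
      using arg_cong [of "r a" "r b" "deck \<lfloor>fst b\<rfloor>"] unfolding r_def deck_add by simp
    then show "\<exists>k. b = deck k a" ..
  qed
  ultimately show thesis
    by (intro that [of G]) (simp add: moebius_strip_def)
qed

context moebius_strip
begin

lemma G_deck: "a \<in> strip \<Longrightarrow> G (deck k a) = G a"
  using G_eq [of a "deck k a"] by auto

lemma G_inj_close:
  assumes "a \<in> strip" "b \<in> strip" "G a = G b" "\<bar>fst a - fst b\<bar> < 1"
  shows "a = b"
proof -
  obtain k where k: "b = deck k a" using G_eq assms by blast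
  have "\<bar>real_of_int k\<bar> < 1" using assms(4) k by simp
  then have "k = 0" by linarith
  then show ?thesis using k by simp
qed

lemma G_window: "G ` ({u - 1/2..u + 1/2} \<times> {0..1}) = M"
proof -
  have "G a \<in> G ` ({u - 1/2..u + 1/2} \<times> {0..1})" if a: "a \<in> strip" for a
  proof -
    define k where "k = \<lfloor>u + 1/2 - fst a\<rfloor>"
    have "fst (deck k a) \<in> {u - 1/2..u + 1/2}" by (simp add: k_def) linarith
    then have "deck k a \<in> {u - 1/2..u + 1/2} \<times> {0..1}"
      using deck_strip' [OF a, of k] by (simp add: mem_Times_iff)
    then show ?thesis by (metis G_deck [OF a] imageI)
  qed
  then show ?thesis unfolding G_image [symmetric] by fastforce
qed

text \<open>On a closed window of length one \<open>G\<close> identifies points of the two vertical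
  ends only. So images of relatively open subsets of \<open>?W\<close> have compact complements in
  \<open>M\<close>, and \<open>G\<close> followed by an exchange of coordinates yields a boundary
  chart.\<close>

lemma edge_in_boundary: "G (u, 0) \<in> surface_boundary M"
proof -
  let ?C = "{u - 1/2..u + 1/2} \<times> {0..1} :: (real \<times> real) set"
  let ?W = "{u - 1/2<..<u + 1/2} \<times> {0..<1} :: (real \<times> real) set"
  let ?V = "{x :: real^2. 0 \<le> x $ 1 \<and> x $ 1 < 1 \<and> u - 1/2 < x $ 2 \<and> x $ 2 < u + 1/2}"
  have cC: "continuous_on ?C G" by (rule continuous_on_subset [OF continuous_G]) auto
  have sat: "a = b" if "a \<in> ?W" "b \<in> ?C" "G a = G b" for a b
    by (rule G_inj_close) (use that in \<open>auto simp: mem_Times_iff abs_if\<close>)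
  have WC: "?W \<subseteq> ?C" by auto
  have oW: "openin (top_of_set ?C) ?W"
  proof -
    have "?W = ?C \<inter> ({u - 1/2<..<u + 1/2} \<times> {..<1})" by auto
    then show ?thesis by (metis open_Times open_greaterThanLessThan open_lessThan openin_open)
  qed
  have opn: "openin (top_of_set M) (G ` A)" if A: "openin (top_of_set ?C) A" "A \<subseteq> ?W" for A
  proof -
    have "closedin (top_of_set ?C) (?C - A)"
      using A closedin_diff [of "top_of_set ?C" ?C A] closedin_subtopology_refl by fastforce
    then have "compact (?C - A)"
      by (rule closedin_compact [rotated]) (simp add: compact_Times)
    then have "compact (G ` (?C - A))"
      by (intro compact_continuous_image continuous_on_subset [OF cC]) auto
    moreover have "M - G ` A = G ` (?C - A)"
      using sat A(2) WC unfolding G_window [of u, symmetric] by blast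
    ultimately have "closedin (top_of_set M) (M - G ` A)"
      using G_window [of u] by (auto intro!: closed_subset compact_imp_closed)
    moreover have "G ` A \<subseteq> M" using A(2) WC G_window [of u] by blast
    ultimately show ?thesis by (simp add: openin_closedin_eq)
  qed
  obtain k where k: "homeomorphism ?W (G ` ?W) G k"
  proof (rule homeomorphism_injective_open_map [of ?W G "G ` ?W"])
    show "continuous_on ?W G" by (rule continuous_on_subset [OF cC WC])
    show "inj_on G ?W" using sat WC by (meson inj_onI subsetD)
    fix A assume "openin (top_of_set ?W) A"
    then have "openin (top_of_set ?C) A" "A \<subseteq> ?W"
      using oW openin_trans openin_imp_subset by blast+
    from opn [OF this] show "openin (top_of_set (G ` ?W)) (G ` A)"
      using \<open>A \<subseteq> ?W\<close> opn [OF oW] openin_subset_trans openin_imp_subset by (metis image_mono order_refl)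
  qed auto
  let ?h = "\<lambda>a. vector [snd a, fst a] :: real^2" and ?h' = "\<lambda>x :: real^2. (x $ 2, x $ 1)"
  have h: "homeomorphism ?W ?V ?h ?h'"
  proof (rule homeomorphismI)
    have "?h = (\<lambda>a. \<chi> i. if i = 1 then snd a else fst a)"
      by (auto simp: vec_eq_iff forall_2)
    show "continuous_on ?W ?h"
      unfolding \<open>?h = _\<close> by (rule continuous_on_vec_lambda) (rename_tac i, case_tac "i = 1", auto intro!: continuous_intros)
    show "continuous_on ?V ?h'" by (intro continuous_intros)
  qed (auto simp: vec_eq_iff forall_2)
  have "openin (top_of_set {x :: real^2. 0 \<le> x $ 1}) ?V"
  proof -
    have "open {x :: real^2. x $ 1 < 1 \<and> u - 1/2 < x $ 2 \<and> x $ 2 < u + 1/2}"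
      by (intro open_Collect_conj open_Collect_less continuous_intros)
    moreover have "?V = {x. 0 \<le> x $ 1} \<inter> {x :: real^2. x $ 1 < 1 \<and> u - 1/2 < x $ 2 \<and> x $ 2 < u + 1/2}" by auto
    ultimately show ?thesis by (simp only: openin_open_Int)
  qed
  moreover have "homeomorphism (G ` ?W) ?V (?h \<circ> k) (G \<circ> ?h')"
    using homeomorphism_compose [OF homeomorphism_symD [OF k] h] .
  moreover have "openin (top_of_set M) (G ` ?W)" by (rule opn [OF oW order_refl])
  moreover have "(u, 0) \<in> ?W" by simp
  moreover from this have "(?h \<circ> k) (G (u, 0)) $ 1 = 0"
    using homeomorphism_apply1 [OF k] by simp
  ultimately show ?thesis
    unfolding surface_boundary_def mem_Collect_eq using G_image
    by (intro conjI exI [of _ "G ` ?W"] exI [of _ ?V] exI [of _ "?h \<circ> k"] exI [of _ "G \<circ> ?h'"]) auto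
qed

text \<open>A chart at such a point would turn a planar neighbourhood into an open subset of the plane that meets the
  boundary line of the half-plane but lies on one side of it.\<close>

lemma interior_not_boundary:
  assumes y: "0 < y" "y < 1"
  shows "G (u, y) \<notin> surface_boundary M"
proof
  assume "G (u, y) \<in> surface_boundary M"
  then obtain U V f g where U: "openin (top_of_set M) U" "G (u, y) \<in> U"
    and V: "openin (top_of_set {x :: real^2. 0 \<le> x $ 1}) V"
    and h: "homeomorphism U V f g" and f0: "(f (G (u, y)) :: real^2) $ 1 = 0"
    unfolding surface_boundary_def by blast
  let ?B = "{u - 1/2<..<u + 1/2} \<times> {0<..<1} :: (real \<times> real) set"
  have B: "?B \<subseteq> strip" by auto
  have cB: "continuous_on ?B G" by (rule continuous_on_subset [OF continuous_G B])
  define S where "S = ?B \<inter> G -` U"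
  have "openin (top_of_set ?B) S"
    unfolding S_def by (rule continuous_openin_preimage [OF cB _ U(1)]) (use B G_image in blast)
  then have oS: "open S" by (simp add: openin_open_eq open_Times)
  have "open ((f \<circ> G) ` S)"
  proof (rule invariance_of_domain_gen [OF oS])
    have GS: "G ` S \<subseteq> U" by (auto simp: S_def)
    show "continuous_on S (f \<circ> G)"
      by (intro continuous_on_compose continuous_on_subset [OF cB]
          continuous_on_subset [OF homeomorphism_cont1 [OF h] GS]) (auto simp: S_def)
    have "inj_on f U" using h by (metis homeomorphism_apply1 inj_on_inverseI)
    moreover have "inj_on G S"
    proof (rule inj_onI)
      fix a b assume "a \<in> S" "b \<in> S" "G a = G b"
      then show "a = b" by (intro G_inj_close) (auto simp: S_def mem_Times_iff abs_if)
    qed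
    ultimately show "inj_on (f \<circ> G) S" using GS by (meson comp_inj_on inj_on_subset)
  qed simp
  moreover have "(u, y) \<in> S" using y U by (auto simp: S_def)
  then have "f (G (u, y)) \<in> (f \<circ> G) ` S" by force
  ultimately obtain e where e: "e > 0" "ball (f (G (u, y))) e \<subseteq> (f \<circ> G) ` S"
    using openE by blast
  have "f (G (u, y)) - (e / 2) *\<^sub>R axis 1 1 \<in> ball (f (G (u, y))) e"
    using e by (simp add: dist_norm norm_axis_1)
  moreover have "(f \<circ> G) ` S \<subseteq> V"
    using homeomorphism_image1 [OF h] by (auto simp: S_def)
  ultimately have "f (G (u, y)) - (e / 2) *\<^sub>R axis 1 1 \<in> V"
    using e(2) by blast
  then have "0 \<le> (f (G (u, y)) - (e / 2) *\<^sub>R axis 1 1) $ 1"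
    using openin_imp_subset [OF V] by blast
  then show False using f0 e by simp
qed

lemma boundary_iff:
  assumes "a \<in> strip"
  shows "G a \<in> surface_boundary M \<longleftrightarrow> snd a \<in> {0, 1}"
proof -
  obtain u y where a: "a = (u, y)" by (cases a)
  have "G (u, 1) = G (u - 1, 0)"
    using G_deck [of "(u - 1, 0)" 1] by (simp add: deck_def)
  then have "G (u, 0) \<in> surface_boundary M" "G (u, 1) \<in> surface_boundary M"
    using edge_in_boundary [of u] edge_in_boundary [of "u - 1"] by simp_all
  moreover have "y = 0 \<or> y = 1 \<or> 0 < y \<and> y < 1" using assms a by auto
  ultimately show ?thesis
    using interior_not_boundary [of y u] a by auto
qed

end

section \<open>Lifting the circle coordinate\<close>

lemma cis_2pi_eq_iff: "cis (2 * pi * x) = cis (2 * pi * y) \<longleftrightarrow> x - y \<in> \<int>"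
proof -
  have "cis (2 * pi * x) = cis (2 * pi * y) \<longleftrightarrow> cis (2 * pi * x) / cis (2 * pi * y) = 1"
    by simp
  also have "\<dots> \<longleftrightarrow> cos (2 * pi * (x - y)) = 1 \<and> sin (2 * pi * (x - y)) = 0"
    by (simp add: cis_divide complex_eq_iff right_diff_distrib)
  also have "\<dots> \<longleftrightarrow> cos (2 * pi * (x - y)) = 1"
    by (metis cos_one_sin_zero)
  also have "\<dots> \<longleftrightarrow> x - y \<in> \<int>"
    by (auto simp: cos_one_2pi_int Ints_def)
  finally show ?thesis .
qed

lemma circle_lift:
  fixes f :: "'a::real_normed_vector \<Rightarrow> complex"
  assumes "continuous_on S f" "convex S" "\<And>x. x \<in> S \<Longrightarrow> cmod (f x) = 1"
  obtains \<tau> where "continuous_on S \<tau>" "\<And>x. x \<in> S \<Longrightarrow> f x = cis (2 * pi * \<tau> x)"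
proof -
  obtain g where g: "continuous_on S g" "\<And>x. x \<in> S \<Longrightarrow> f x = exp (g x)"
    using continuous_logarithm_on_contractible [OF assms(1) convex_imp_contractible [OF assms(2)]] assms(3)
    by (metis norm_zero zero_neq_one)
  show thesis
  proof (rule that [of "\<lambda>x. Im (g x) / (2 * pi)"])
    show "continuous_on S (\<lambda>x. Im (g x) / (2 * pi))"
      by (intro continuous_intros g) auto
    show "f x = cis (2 * pi * (Im (g x) / (2 * pi)))" if "x \<in> S" for x
    proof -
      have "exp (Re (g x)) = 1" using assms(3) [OF that] g(2) [OF that] by simp
      then show ?thesis using g(2) [OF that] by (simp add: exp_eq_polar)
    qed
  qed
qed

lemma integer_valued_constant:
  fixes f :: "'a::topological_space \<Rightarrow> real"
  assumes "connected S" "continuous_on S f" "\<And>x. x \<in> S \<Longrightarrow> f x \<in> \<int>" "a \<in> S"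
  obtains c :: int where "\<And>x. x \<in> S \<Longrightarrow> f x = of_int c"
proof -
  have "f constant_on S"
  proof (rule continuous_discrete_range_constant [OF assms(1,2)])
    fix x assume x: "x \<in> S"
    have "1 \<le> norm (f y - f x)" if "y \<in> S" "f y \<noteq> f x" for y
      using Ints_nonzero_abs_ge1 [of "f y - f x"] assms(3) x that by simp
    then show "\<exists>e>0. \<forall>y. y \<in> S \<and> f y \<noteq> f x \<longrightarrow> e \<le> norm (f y - f x)"
      by (intro exI [of _ 1]) auto
  qed
  then obtain r where r: "\<And>x. x \<in> S \<Longrightarrow> f x = r" unfolding constant_on_def by blast
  moreover obtain c where "r = of_int c"
    using assms(3) [OF assms(4)] r [OF assms(4)] by (auto elim: Ints_cases)
  ultimately show thesis using that by blast
qed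

lemma IVT_either:
  fixes f :: "real \<Rightarrow> real"
  assumes "continuous_on {a..b} f" "a \<le> b" "f a \<le> v \<and> v \<le> f b \<or> f b \<le> v \<and> v \<le> f a"
  obtains x where "a \<le> x" "x \<le> b" "f x = v"
  using IVT' [of f a v b] IVT2' [of f b v a] assms by metis

text \<open>Proper maps are closed: a convergent sequence of values comes from a compact piece of
  \<open>S\<close>.\<close>

lemma closed_image_proper:
  fixes f :: "'a::euclidean_space \<Rightarrow> 'b::euclidean_space"
  assumes "continuous_on S f" "closed S" "\<And>r. bounded {x \<in> S. norm (f x) \<le> r}"
  shows "closed (f ` S)"
  unfolding closed_sequential_limits
proof (intro allI impI, elim conjE)
  fix y l assume y: "\<forall>i. y i \<in> f ` S" "y \<longlonglongrightarrow> l"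
  obtain r where r: "\<And>i. norm (y i) \<le> r"
    using convergent_imp_Bseq [of y] y(2) by (auto simp: Bseq_def convergent_def)
  let ?T = "S \<inter> f -` cball 0 r"
  have "closed ?T"
    using continuous_closed_preimage [OF assms(1,2)] by blast
  moreover have "bounded ?T"
    by (rule bounded_subset [OF assms(3) [of r]]) auto
  ultimately have "compact (f ` ?T)"
    by (intro compact_continuous_image continuous_on_subset [OF assms(1)]) (auto simp: compact_eq_bounded_closed)
  moreover have "y i \<in> f ` ?T" for i
    using y(1) r [of i] by (metis (no_types, lifting) IntI dist_0_norm imageE imageI mem_cball vimageI)
  ultimately show "l \<in> f ` S"
    using closed_sequentially [OF compact_imp_closed] y(2) by blast
qed

text \<open>\<open>(Z, H)\<close> are coordinates of the ball, with \<open>Z\<close> parallel to the plane of the equator, and \<open>W\<close> is the coordinate on the circle.\<close>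

locale moebius_filling =
  fixes n :: nat and Z :: "real \<times> real \<Rightarrow> complex" and H :: "real \<times> real \<Rightarrow> real" and W :: "real \<times> real \<Rightarrow> complex"
  assumes n: "n \<ge> 2"
    and continuous_Z: "continuous_on strip Z"
    and continuous_H: "continuous_on strip H"
    and continuous_W: "continuous_on strip W"
    and W_norm: "a \<in> strip \<Longrightarrow> cmod (W a) = 1"
    and in_ball: "a \<in> strip \<Longrightarrow> (cmod (Z a))\<^sup>2 + (H a)\<^sup>2 \<le> 1"
    and same_point: "a \<in> strip \<Longrightarrow> b \<in> strip \<Longrightarrow> Z a = Z b \<and> H a = H b \<and> W a = W b \<longleftrightarrow> (\<exists>k. b = deck k a)"
    and on_sphere: "a \<in> strip \<Longrightarrow> (cmod (Z a))\<^sup>2 + (H a)\<^sup>2 = 1 \<Longrightarrow> snd a \<in> {0, 1}"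
    and on_edge: "snd a \<in> {0, 1} \<Longrightarrow> cmod (Z a) = 1 \<and> H a = 0 \<and> W a = Z a ^ (2 * n)"

text \<open>\<open>\<tau>\<close> is the height in the universal cover of the solid product.
  \<open>\<tau>_deck\<close> says that the core winds \<open>d * n\<close> times around the circle,
  and \<open>\<tau>_edge\<close> fixes the integer by which \<open>\<tau>\<close> could still be
  shifted.\<close>

locale moebius_lift = moebius_filling +
  fixes \<tau> :: "real \<times> real \<Rightarrow> real" and d :: int
  assumes d: "d = 1 \<or> d = - 1"
    and continuous_\<tau>: "continuous_on strip \<tau>"
    and W_\<tau>: "a \<in> strip \<Longrightarrow> W a = cis (2 * pi * \<tau> a)"
    and \<tau>_deck: "a \<in> strip \<Longrightarrow> \<tau> (deck k a) = \<tau> a + of_int (k * d * int n)"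
    and \<tau>_edge: "Z (u, 0) = cis (pi * \<tau> (u, 0) / n)"

text \<open>If \<open>d\<close> vanished, the lift \<open>\<theta>\<close> of the edge would take some value twice within one period; if \<open>\<bar>d\<bar> \<ge> 2\<close>, it
  would return to the starting point of the circle too early.\<close>

lemma (in moebius_filling) lift_exists:
  obtains \<tau> d where "moebius_lift n Z H W \<tau> d"
proof -
  have cst: "convex strip" "connected strip" by (auto intro!: convex_Times convex_connected)
  obtain \<sigma> where c\<sigma>: "continuous_on strip \<sigma>" and \<sigma>: "\<And>a. a \<in> strip \<Longrightarrow> W a = cis (2 * pi * \<sigma> a)"
    using circle_lift [OF continuous_W cst(1) W_norm] by metis
  have "continuous_on strip (\<lambda>a. \<sigma> (deck 1 a) - \<sigma> a)"
    by (intro continuous_intros continuous_on_compose2 [OF c\<sigma> continuous_on_deck] c\<sigma>) (auto simp: deck_def)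
  moreover have "\<sigma> (deck 1 a) - \<sigma> a \<in> \<int>" if "a \<in> strip" for a
    using same_point [of a "deck 1 a"] \<sigma> that deck_strip [of 1 a] by (auto simp: cis_2pi_eq_iff [symmetric])
  ultimately obtain c where c: "\<And>a. a \<in> strip \<Longrightarrow> \<sigma> (deck 1 a) - \<sigma> a = of_int c"
    by (rule integer_valued_constant [OF cst(2), of _ "(0, 0)"]) auto
  have deck: "\<sigma> (deck k a) = \<sigma> a + of_int (k * c)" if a: "a \<in> strip" for k a
  proof (induction k rule: int_induct [of _ 0])
    case (step1 i)
    then show ?case using c [of "deck i a"] a deck_strip [of i a] by (simp add: deck_add algebra_simps)
  next
    case (step2 i)
    then show ?case using c [of "deck (i - 1) a"] a deck_strip [of "i - 1" a] by (simp add: deck_add algebra_simps)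
  qed simp
  have "continuous_on UNIV (\<lambda>u. Z (u, 0))"
    by (rule continuous_on_compose2 [OF continuous_Z]) (auto intro!: continuous_intros)
  then obtain \<theta> where c\<theta>: "continuous_on UNIV \<theta>" and \<theta>': "\<And>u. u \<in> UNIV \<Longrightarrow> Z (u, 0) = cis (2 * pi * \<theta> u)"
    by (rule circle_lift) (use on_edge in auto)
  note \<theta> = \<theta>' [OF UNIV_I]
  have "continuous_on UNIV (\<lambda>u. \<sigma> (u, 0) - 2 * n * \<theta> u)"
    by (intro continuous_intros c\<theta> continuous_on_compose2 [OF c\<sigma>]) auto
  moreover have "\<sigma> (u, 0) - 2 * n * \<theta> u \<in> \<int>" for u
  proof -
    have "cis (2 * pi * \<sigma> (u, 0)) = cis (2 * pi * \<theta> u) ^ (2 * n)"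
      using \<sigma> [of "(u, 0)"] on_edge [of "(u, 0)"] \<theta> by simp
    also have "\<dots> = cis (2 * pi * (2 * n * \<theta> u))"
      by (simp add: Complex.DeMoivre mult.assoc mult.left_commute)
    finally show ?thesis by (simp only: cis_2pi_eq_iff)
  qed
  ultimately obtain N where N: "\<And>u. u \<in> UNIV \<Longrightarrow> \<sigma> (u, 0) - 2 * n * \<theta> u = of_int N"
    by (rule integer_valued_constant [OF connected_UNIV, of _ 0]) auto
  have inj: "\<exists>k. even k \<and> v = u + of_int k" if "\<theta> u - \<theta> v \<in> \<int>" for u v
  proof -
    have "Z (u, 0) = Z (v, 0)" using that by (simp add: \<theta> cis_2pi_eq_iff)
    then have "\<exists>k. (v, 0) = deck k (u, 0)"
      using same_point [of "(u, 0)" "(v, 0)"] on_edge [of "(u, 0)"] on_edge [of "(v, 0)"] by simp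
    then show ?thesis by (auto simp: deck_def split: if_splits)
  qed
  \<comment> \<open>The boundary circle is the edge \<open>(u, 0)\<close> modulo translation by 2,
    and \<open>D\<close> is its degree along the equator. It covers the core twice, whence
    \<open>n * D = c\<close>.\<close>
  define D where "D = \<theta> 2 - \<theta> 0"
  have nD: "real n * D = of_int c"
    using N [of 0] N [of 2] deck [of "(0, 0)" 2] by (simp add: deck_def D_def algebra_simps)
  have "Z (2, 0) = Z (0, 0)"
    using same_point [of "(0, 0)" "deck 2 (0, 0)"] by (auto simp: deck_def)
  then have "D \<in> \<int>" by (simp add: \<theta> cis_2pi_eq_iff D_def)
  then obtain d where d: "D = of_int d" by (auto elim: Ints_cases)
  have ivt: "\<exists>x. a \<le> x \<and> x \<le> b \<and> \<theta> x = v"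
    if "a \<le> b" "\<theta> a \<le> v \<and> v \<le> \<theta> b \<or> \<theta> b \<le> v \<and> v \<le> \<theta> a" for a b v
    using IVT_either [OF continuous_on_subset [OF c\<theta>] that] by (metis subset_UNIV)
  have even02: "k = 0 \<or> k = 2" if "even k" "0 \<le> real_of_int k" "real_of_int k \<le> 2" for k
    using that by (auto elim!: evenE)
  have "d \<noteq> 0"
  proof
    assume "d = 0"
    then have 02: "\<theta> 2 = \<theta> 0" using d by (simp add: D_def)
    let ?v = "(\<theta> 0 + \<theta> 1) / 2"
    obtain s where s: "0 \<le> s" "s \<le> 1" "\<theta> s = ?v" using ivt [of 0 1 ?v] linear [of "\<theta> 0" "\<theta> 1"] by auto
    obtain t where t: "1 \<le> t" "t \<le> 2" "\<theta> t = ?v" using ivt [of 1 2 ?v] linear [of "\<theta> 0" "\<theta> 1"] 02 by auto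
    have "\<theta> s - \<theta> t = 0" using s(3) t(3) by linarith
    then have "\<theta> s - \<theta> t \<in> \<int>" by (simp only: Ints_0)
    from inj [OF this] obtain k where k: "even k" "t = s + of_int k" by blast
    have "k = 0 \<or> k = 2" by (rule even02 [OF k(1)]) (use k s t in linarith)+
    then have "s = 1 \<or> s = 0" using k(2) s(1,2) t(1,2) by auto
    then have "\<theta> 0 = \<theta> 1" using s(3) by auto
    then have "\<theta> 0 - \<theta> 1 \<in> \<int>" by simp
    then show False using inj [of 0 1] by auto
  qed
  moreover have "\<bar>d\<bar> < 2"
  proof (rule ccontr)
    assume d2: "\<not> \<bar>d\<bar> < 2"
    let ?v = "\<theta> 0 + of_int (sgn d)"
    have 2: "\<theta> 2 = \<theta> 0 + of_int d" using d by (simp add: D_def)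
    have "0 \<le> sgn d \<and> sgn d \<le> d \<or> d \<le> sgn d \<and> sgn d \<le> 0" using d2 by (auto simp: sgn_if)
    then have "\<theta> 0 \<le> ?v \<and> ?v \<le> \<theta> 2 \<or> \<theta> 2 \<le> ?v \<and> ?v \<le> \<theta> 0"
      unfolding 2 by (simp only: add_le_cancel_left le_add_same_cancel1 add_le_same_cancel1 of_int_le_iff of_int_0_le_iff of_int_le_0_iff)
    then obtain s where s: "0 \<le> s" "s \<le> 2" "\<theta> s = ?v"
      using ivt [of 0 2 ?v] by auto
    then have "\<theta> 0 - \<theta> s \<in> \<int>" by simp
    from inj [OF this] obtain k where k: "even k" "s = of_int k" by auto
    have "k = 0 \<or> k = 2" by (rule even02 [OF k(1)]) (use k s in simp_all)
    then have "of_int (sgn d) = (0 :: real) \<or> of_int (sgn d) = real_of_int d"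
      using k(2) s(3) 2 by auto
    then show False
      using d2 by (auto simp: sgn_if split: if_splits)
  qed
  ultimately have d1: "d = 1 \<or> d = - 1" by linarith
  have cd: "c = d * int n"
  proof -
    have "real_of_int c = real_of_int (d * int n)" using nD d by (simp add: mult.commute)
    then show ?thesis by (simp only: of_int_eq_iff)
  qed
  show thesis
  \<comment> \<open>Subtracting \<open>N\<close> puts the edge exactly at the angle pi
    \<open>\<tau>\<close> / n, so that untwisting sends it to the constant 1.\<close>
  proof (rule that [of "\<lambda>a. \<sigma> a - of_int N" d], unfold_locales)
    show "continuous_on strip (\<lambda>a. \<sigma> a - of_int N)" by (intro continuous_intros c\<sigma>)
    show "W a = cis (2 * pi * (\<sigma> a - of_int N))" if "a \<in> strip" for a
      using \<sigma> [OF that] by (simp add: cis_2pi_eq_iff)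
    show "\<sigma> (deck k a) - of_int N = \<sigma> a - of_int N + of_int (k * d * int n)" if "a \<in> strip" for k a
      using deck [OF that] cd by (simp add: mult.assoc)
    show "Z (u, 0) = cis (pi * (\<sigma> (u, 0) - of_int N) / n)" for u
    proof -
      have "pi * (\<sigma> (u, 0) - of_int N) / n = 2 * pi * \<theta> u"
        using N [of u] n by (simp add: field_simps)
      then show ?thesis using \<theta> by simp
    qed
  qed (use d1 in auto)
qed

section \<open>The planes in 4-space\<close>

context moebius_lift
begin

text \<open>The lifted strip, untwisted: by \<open>\<tau>_edge\<close> its edge 0 becomes the
  vertical line over 1, and by the deck transformation its edge 1 the one over -1.\<close>

definition chart :: "real \<times> real \<Rightarrow> space4" where
  "chart a = (cis (- pi * \<tau> a / n) * Z a, H a, \<tau> a)"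

definition base_plane :: "space4 set" where
  "base_plane = chart ` strip \<union> {p. fst (snd p) = 0 \<and> Im (fst p) = 0 \<and> 1 \<le> \<bar>Re (fst p)\<bar>}"

definition half_strip :: "(real \<times> real) set" where
  "half_strip = {0..} \<times> UNIV"

text \<open>A parametrisation of the base plane without the open half plane beyond 1. The first
  argument is the coordinate across the strip; beyond 1 it stretches the edge over -1 radially, and
  \<open>min\<close> and \<open>max\<close> merge both cases into one continuous formula.\<close>

definition extended :: "real \<times> real \<Rightarrow> space4" where
  "extended q = (of_real (max 1 (fst q)) * fst (chart (snd q, min 1 (fst q))), snd (chart (snd q, min 1 (fst q))))"

definition plane :: "int \<Rightarrow> space4 set" where
  "plane k = {p. screw n (- k) p \<in> base_plane}"

lemma chart_simps [simp]: "cmod (fst (chart a)) = cmod (Z a)" "fst (snd (chart a)) = H a" "snd (snd (chart a)) = \<tau> a"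
  by (simp_all add: chart_def norm_mult)

lemma continuous_chart: "continuous_on strip chart"
proof -
  have "chart = (\<lambda>a. (exp (\<i> * of_real (- pi * \<tau> a / n)) * Z a, H a, \<tau> a))"
    by (simp add: fun_eq_iff chart_def cis_conv_exp)
  then show ?thesis
    using n by (auto intro!: continuous_intros continuous_\<tau> continuous_Z continuous_H)
qed

lemma chart_deck:
  assumes "a \<in> strip"
  shows "chart (deck k a) = screw n (k * d * int n) (chart a)"
proof -
  have "Z (deck k a) = Z a" "H (deck k a) = H a"
    using same_point [of a "deck k a"] assms deck_strip by auto
  moreover have "- pi * \<tau> (deck k a) / n = - pi * of_int (k * d * int n) / n + - pi * \<tau> a / n"
    by (simp add: \<tau>_deck [OF assms] add_divide_distrib distrib_left diff_divide_distrib)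
  ultimately have "cis (- pi * \<tau> (deck k a) / n) * Z (deck k a) = dirn n (k * d * int n) * (cis (- pi * \<tau> a / n) * Z a)"
    "H (deck k a) = H a"
    unfolding dirn_def by (simp_all only: cis_mult [symmetric] mult.assoc)
  then show ?thesis
    by (simp only: chart_def screw_def fst_conv snd_conv \<tau>_deck [OF assms])
qed

text \<open>Points related by the screw motion lie over one point of the band, hence differ by a
  deck transformation, and these change the height by multiples of \<open>n\<close>. This keeps the
  \<open>n\<close> translates apart.\<close>

lemma chart_screw:
  assumes "a \<in> strip" "b \<in> strip" "chart a = screw n m (chart b)"
  obtains j where "b = deck j a" "m = - j * d * int n"
proof -
  have t: "\<tau> a = \<tau> b + of_int m" and h: "H a = H b"
    and z: "cis (- pi * \<tau> a / n) * Z a = cis (- pi * of_int m / n) * (cis (- pi * \<tau> b / n) * Z b)"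
    using assms(3) unfolding chart_def screw_def dirn_def fst_conv snd_conv prod.inject by blast+
  have "- pi * \<tau> a / n = - pi * of_int m / n + - pi * \<tau> b / n"
    by (simp add: t add_divide_distrib distrib_left diff_divide_distrib)
  then have "cis (- pi * \<tau> a / n) = cis (- pi * of_int m / n) * cis (- pi * \<tau> b / n)"
    by (simp only: cis_mult)
  then have "cis (- pi * \<tau> a / n) * Z a = cis (- pi * \<tau> a / n) * Z b"
    using z by (simp only: mult.assoc)
  then have "Z a = Z b" by simp
  moreover have "W a = W b"
    using W_\<tau> [OF assms(1)] W_\<tau> [OF assms(2)] by (simp add: cis_2pi_eq_iff t)
  ultimately obtain j where j: "b = deck j a"
    using same_point [OF assms(1,2)] h by blast
  have "real_of_int m = real_of_int (- j * d * int n)"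
    using \<tau>_deck [OF assms(1), of j] t j by simp
  then have "m = - j * d * int n" by (simp only: of_int_eq_iff)
  then show thesis using that j by blast
qed

lemma inj_chart: "inj_on chart strip"
proof (rule inj_onI)
  fix a b assume ab: "a \<in> strip" "b \<in> strip" "chart a = chart b"
  then obtain j where "b = deck j a" "0 = - j * d * int n"
    using chart_screw [of a b 0] by (auto simp: screw_0)
  then show "a = b" using d n by auto
qed

lemma chart_edge_0: "chart (u, 0) = (1, 0, \<tau> (u, 0))"
  using on_edge [of "(u, 0)"] by (simp add: chart_def \<tau>_edge cis_mult)

lemma dirn_half_turn: "dirn n (d * int n) = - 1" "dirn n (int n) = - 1"
proof -
  have "cis (- pi) = - 1" by (simp add: complex_eq_iff)
  then show "dirn n (d * int n) = - 1" "dirn n (int n) = - 1"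
    using d n by (auto simp: dirn_def)
qed

lemma chart_edge_1: "chart (u, 1) = (- 1, 0, \<tau> (u, 1))"
proof -
  have "deck 1 (u - 1, 0) = (u, 1)" by (simp add: deck_def)
  then have "chart (u, 1) = screw n (d * int n) (chart (u - 1, 0))"
    using chart_deck [of "(u - 1, 0)" 1] by simp
  also have "fst \<dots> = - 1" by (simp add: chart_edge_0 screw_def dirn_half_turn)
  finally show ?thesis
    using on_edge [of "(u, 1)"] by (simp add: prod_eq_iff)
qed

lemma chart_sphere:
  assumes "a \<in> strip" "(cmod (Z a))\<^sup>2 + (H a)\<^sup>2 \<ge> 1"
  shows "H a = 0" "Im (fst (chart a)) = 0" "\<bar>Re (fst (chart a))\<bar> = 1"
proof -
  have "snd a \<in> {0, 1}"
    by (rule on_sphere [OF assms(1) antisym [OF in_ball [OF assms(1)] assms(2)]])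
  moreover obtain u y where "a = (u, y)" by (cases a)
  ultimately have "chart a = (1, 0, \<tau> a) \<or> chart a = (- 1, 0, \<tau> a)"
    using chart_edge_0 [of u] chart_edge_1 [of u] by auto
  then show "Im (fst (chart a)) = 0" "\<bar>Re (fst (chart a))\<bar> = 1" by auto
  show "H a = 0" using on_edge \<open>snd a \<in> {0, 1}\<close> by blast
qed

text \<open>The difference is invariant under deck transformations, so its bound on the compact unit
  square holds everywhere.\<close>

lemma \<tau>_bound: obtains C where "\<And>a. a \<in> strip \<Longrightarrow> \<bar>\<tau> a - real_of_int d * real n * fst a\<bar> \<le> C"
proof -
  let ?f = "\<lambda>a. \<tau> a - real_of_int d * real n * fst a"
  let ?Q = "{0..1} \<times> {0..1} :: (real \<times> real) set"
  have "compact (?f ` ?Q)"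
  proof (rule compact_continuous_image)
    have "continuous_on ?Q \<tau>" by (rule continuous_on_subset [OF continuous_\<tau>]) auto
    then show "continuous_on ?Q ?f" by (intro continuous_intros)
  qed (simp add: compact_Times)
  then obtain C where C: "\<forall>x\<in>?f ` ?Q. \<bar>x\<bar> \<le> C"
    using compact_imp_bounded bounded_real by blast
  have "\<bar>?f a\<bar> \<le> C" if a: "a \<in> strip" for a
  proof -
    let ?k = "- \<lfloor>fst a\<rfloor>"
    have "0 \<le> fst (deck ?k a)" "fst (deck ?k a) \<le> 1" unfolding fst_deck by linarith+
    then have "deck ?k a \<in> ?Q" using deck_strip' [OF a, of ?k] by (simp add: mem_Times_iff)
    then have "\<bar>?f (deck ?k a)\<bar> \<le> C" by (rule C [rule_format, OF imageI])
    moreover have "?f (deck ?k a) = ?f a"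
      by (simp add: \<tau>_deck [OF a] algebra_simps)
    ultimately show ?thesis by simp
  qed
  then show thesis by (rule that)
qed

lemma \<tau>_surj:
  assumes "y \<in> {0..1}"
  obtains u where "\<tau> (u, y) = t"
proof -
  obtain C where C: "\<And>a. a \<in> strip \<Longrightarrow> \<bar>\<tau> a - real_of_int d * real n * fst a\<bar> \<le> C" by (rule \<tau>_bound) blast
  \<comment> \<open>At \<open>r\<close> and \<open>- r\<close> the linear approximation to
    \<open>\<tau>\<close> has absolute value at least \<bar>t\<bar> + C, so \<open>t\<close> lies
    between the two values of \<open>\<tau>\<close>.\<close>
  define r :: real where "r = \<bar>t\<bar> + C"
  have C0: "C \<ge> 0" using C [of "(0, 0)"] by simp
  have nr: "r \<le> n * r" using mult_right_mono [of 1 "real n" r] n C0 by (simp add: r_def)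
  have *: "\<bar>\<tau> (s, y) - real_of_int d * real n * s\<bar> \<le> C" for s using C [of "(s, y)"] assms by simp
  have "continuous_on {- r..r} (\<lambda>s. \<tau> (s, y))"
    by (rule continuous_on_compose2 [OF continuous_\<tau>]) (use assms in \<open>auto intro!: continuous_intros\<close>)
  then obtain u where "\<tau> (u, y) = t"
  proof (rule IVT_either)
    show "- r \<le> r" using C0 by (simp add: r_def)
    show "\<tau> (- r, y) \<le> t \<and> t \<le> \<tau> (r, y) \<or> \<tau> (r, y) \<le> t \<and> t \<le> \<tau> (- r, y)"
      using d
    proof
      assume "d = 1"
      then have "\<bar>\<tau> (r, y) - n * r\<bar> \<le> C" "\<bar>\<tau> (- r, y) + n * r\<bar> \<le> C"
        using * [of r] * [of "- r"] by simp_all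
      then have "\<tau> (- r, y) \<le> t \<and> t \<le> \<tau> (r, y)"
        using nr r_def by linarith
      then show ?thesis ..
    next
      assume "d = - 1"
      then have "\<bar>\<tau> (r, y) + n * r\<bar> \<le> C" "\<bar>\<tau> (- r, y) - n * r\<bar> \<le> C"
        using * [of r] * [of "- r"] by simp_all
      then have "\<tau> (r, y) \<le> t \<and> t \<le> \<tau> (- r, y)"
        using nr r_def by linarith
      then show ?thesis ..
    qed
  qed
  then show thesis by (rule that)
qed

lemma extended_le: "fst q \<le> 1 \<Longrightarrow> extended q = chart (snd q, fst q)"
  by (simp add: extended_def)

lemma extended_ge: "1 \<le> fst q \<Longrightarrow> extended q = (- of_real (fst q), 0, \<tau> (snd q, 1))"
  by (simp add: extended_def chart_edge_1)

lemma continuous_extended: "continuous_on half_strip extended"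
proof -
  have "continuous_on half_strip (\<lambda>q. chart (snd q, min 1 (fst q)))"
  proof (rule continuous_on_compose2 [OF continuous_chart])
    show "continuous_on half_strip (\<lambda>q. (snd q, min 1 (fst q)))" by (intro continuous_intros)
    show "(\<lambda>q. (snd q, min 1 (fst q))) ` half_strip \<subseteq> strip" by (auto simp: half_strip_def)
  qed
  moreover have "continuous_on half_strip (\<lambda>q. complex_of_real (max 1 (fst q)))"
    by (intro continuous_intros)
  ultimately show ?thesis
    unfolding extended_def by (intro continuous_on_Pair continuous_on_mult continuous_on_fst continuous_on_snd)
qed

lemma Z_le_1: "a \<in> strip \<Longrightarrow> cmod (Z a) \<le> 1"
proof (rule power2_le_imp_le)
  show "(cmod (Z a))\<^sup>2 \<le> 1\<^sup>2" if "a \<in> strip"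
    using in_ball [OF that] zero_le_power2 [of "H a"] by (simp only: one_power2)
qed simp

lemma cmod_extended:
  assumes "q \<in> half_strip"
  shows "fst q \<le> 1 \<Longrightarrow> cmod (fst (extended q)) \<le> 1" "1 \<le> fst q \<Longrightarrow> cmod (fst (extended q)) = fst q"
  using assms Z_le_1 [of "(snd q, fst q)"] by (auto simp: extended_le extended_ge half_strip_def)

lemma inj_extended: "inj_on extended half_strip"
proof (rule inj_onI)
  fix q r assume qr: "q \<in> half_strip" "r \<in> half_strip" and eq: "extended q = extended r"
  note c = cmod_extended [OF qr(1)] cmod_extended [OF qr(2)]
  show "q = r"
  proof (cases "fst q \<le> 1 \<and> fst r \<le> 1")
    case True
    then show ?thesis
      using inj_onD [OF inj_chart, of "(snd q, fst q)" "(snd r, fst r)"] eq qr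
      by (auto simp: extended_le half_strip_def prod_eq_iff)
  next
    case False
    then have 1: "1 \<le> fst q" "1 \<le> fst r" "fst q = fst r"
      using c unfolding eq by argo+
    then have "chart (snd q, 1) = chart (snd r, 1)"
      using eq by (simp add: extended_ge chart_edge_1)
    then show ?thesis
      using inj_onD [OF inj_chart, of "(snd q, 1)" "(snd r, 1)"] 1 by (simp add: prod_eq_iff)
  qed
qed

text \<open>The distance from the axis controls the coordinate across the strip, and the height
  controls the other one through \<open>\<tau>_bound\<close>.\<close>

lemma proper_extended: "bounded {q \<in> half_strip. norm (extended q) \<le> r}"
proof -
  obtain C where C: "\<And>a. a \<in> strip \<Longrightarrow> \<bar>\<tau> a - real_of_int d * real n * fst a\<bar> \<le> C" by (rule \<tau>_bound) blast
  have "{q \<in> half_strip. norm (extended q) \<le> r} \<subseteq> {0..max 1 r} \<times> {- (r + C)..r + C}"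
  proof (rule subsetI)
    fix q assume "q \<in> {q \<in> half_strip. norm (extended q) \<le> r}"
    then have q: "q \<in> half_strip" and r: "norm (extended q) \<le> r" by simp_all
    have "cmod (fst (extended q)) \<le> r" "\<bar>snd (snd (extended q))\<bar> \<le> r"
      using r norm_fst_le [of "fst (extended q)" "snd (extended q)"]
        norm_snd_le [of "snd (extended q)" "fst (extended q)"] norm_snd_le [of "snd (snd (extended q))" "fst (snd (extended q))"]
      by simp_all
    then have 1: "fst q \<le> max 1 r" "\<bar>\<tau> (snd q, min 1 (fst q))\<bar> \<le> r"
      using cmod_extended(2) [OF q] by (cases "1 \<le> fst q", simp_all) (simp add: extended_def)+
    have "(snd q, min 1 (fst q)) \<in> strip" using q by (auto simp: half_strip_def)
    from C [OF this] 1(2) have "\<bar>real_of_int d * real n * snd q\<bar> \<le> r + C" by simp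
    moreover have "\<bar>real_of_int d * real n * snd q\<bar> = n * \<bar>snd q\<bar>" using d by (auto simp: abs_mult)
    moreover have "\<bar>snd q\<bar> \<le> n * \<bar>snd q\<bar>" using mult_right_mono [of 1 "real n" "\<bar>snd q\<bar>"] n by simp
    ultimately have "\<bar>snd q\<bar> \<le> r + C" by linarith
    then show "q \<in> {0..max 1 r} \<times> {- (r + C)..r + C}"
      using 1(1) q by (simp add: half_strip_def mem_Times_iff abs_le_iff)
  qed
  then show ?thesis
    by (rule bounded_subset [rotated]) (simp add: bounded_Times)
qed

lemma closed_half_strip: "closed half_strip"
  by (simp add: half_strip_def closed_Times)

lemma closed_extended:
  assumes "closed U" "U \<subseteq> half_strip"
  shows "closed (extended ` U)"
proof (rule closed_image_proper [OF continuous_on_subset [OF continuous_extended assms(2)] assms(1)])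
  show "bounded {q \<in> U. norm (extended q) \<le> r}" for r
    by (rule bounded_subset [OF proper_extended [of r]]) (use assms(2) in auto)
qed

text \<open>On each edge \<open>\<tau>\<close> takes all real values, so the whole lines over 1 and
  -1 and all of the outer half plane beyond -1 are reached.\<close>

lemma base_plane_minus_ray: "base_plane - ray 1 = extended ` half_strip"
proof
  show "extended ` half_strip \<subseteq> base_plane - ray 1"
  proof (rule image_subsetI)
    fix q assume "q \<in> half_strip"
    moreover obtain s u where su: "q = (s, u)" by (cases q)
    ultimately have q: "(s, u) \<in> half_strip" by simp
    have "extended (s, u) \<in> base_plane - ray 1"
    proof (cases "s \<le> 1")
      case True
      then have "(u, s) \<in> strip" using q by (auto simp: half_strip_def)
      moreover from this have "Re (fst (chart (u, s))) \<le> 1"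
        using complex_Re_le_cmod [of "fst (chart (u, s))"] Z_le_1 [of "(u, s)"] unfolding chart_simps by linarith
      ultimately show ?thesis using True by (auto simp: extended_le base_plane_def ray_def along_def)
    qed (auto simp: extended_ge base_plane_def ray_def along_def)
    then show "extended q \<in> base_plane - ray 1" by (simp only: su)
  qed
next
  show "base_plane - ray 1 \<subseteq> extended ` half_strip"
  proof
    fix p assume p: "p \<in> base_plane - ray 1"
    consider a where "a \<in> strip" "p = chart a" | "fst (snd p) = 0" "Im (fst p) = 0" "1 \<le> \<bar>Re (fst p)\<bar>" 
      using p by (auto simp: base_plane_def)
    then show "p \<in> extended ` half_strip"
    proof cases
      case 1
      then show ?thesis
        by (intro image_eqI [of _ _ "(snd a, fst a)"]) (auto simp: extended_le half_strip_def mem_Times_iff)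
    next
      case 2
      then have "\<not> Re (fst p) > 1"
        using p by (auto simp: ray_def along_def across_def complex_eq_iff)
      then consider "Re (fst p) = 1" | "Re (fst p) \<le> - 1" using 2 by linarith
      then show ?thesis
      proof cases
        case a: 1
        obtain u where "\<tau> (u, 0) = snd (snd p)" using \<tau>_surj [of 0] by auto
        then show ?thesis using a 2
          by (intro image_eqI [of _ _ "(0, u)"])
            (auto simp: extended_le chart_edge_0 half_strip_def prod_eq_iff complex_eq_iff)
      next
        case a: 2
        obtain u where "\<tau> (u, 1) = snd (snd p)" using \<tau>_surj [of 1] by auto
        then show ?thesis using a 2
          by (intro image_eqI [of _ _ "(- Re (fst p), u)"])
            (auto simp: extended_ge half_strip_def prod_eq_iff complex_eq_iff)
      qed
    qed
  qed
qed

lemma closed_base_plane: "closed base_plane"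
proof -
  let ?R = "{p :: space4. fst (snd p) = 0 \<and> Im (fst p) = 0 \<and> 1 \<le> Re (fst p)}"
  have "ray 1 \<subseteq> ?R" "?R \<subseteq> base_plane"
    by (auto simp: ray_def along_def across_def complex_eq_iff base_plane_def)
  then have "base_plane = extended ` half_strip \<union> ?R"
    unfolding base_plane_minus_ray [symmetric] by auto
  moreover have "closed ?R"
    by (intro closed_Collect_conj closed_Collect_eq closed_Collect_le continuous_intros)
  ultimately show ?thesis
    using closed_extended [OF closed_half_strip order_refl] by (simp only: closed_Un)
qed

lemma base_plane_outside:
  assumes "(cmod z)\<^sup>2 + h\<^sup>2 \<ge> 1"
  shows "(z, h, t) \<in> base_plane \<longleftrightarrow> h = 0 \<and> Im z = 0"
proof
  assume "(z, h, t) \<in> base_plane"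
  then consider a where "a \<in> strip" "(z, h, t) = chart a" | "h = 0" "Im z = 0" 
    by (auto simp: base_plane_def)
  then show "h = 0 \<and> Im z = 0"
  proof cases
    case 1
    then have "cmod z = cmod (Z a)" "h = H a" "fst (chart a) = z" using chart_simps by (metis fst_conv snd_conv)+
    then show ?thesis using chart_sphere [OF 1(1)] assms by simp
  qed simp
next
  assume h: "h = 0 \<and> Im z = 0"
  then have "1\<^sup>2 \<le> \<bar>Re z\<bar>\<^sup>2" using assms by (simp add: cmod_power2)
  then have "1 \<le> \<bar>Re z\<bar>" by (rule power2_le_imp_le) simp
  then show "(z, h, t) \<in> base_plane" using h by (simp add: base_plane_def)
qed

text \<open>On the charted strip this screw motion is \<open>deck d\<close>, and it exchanges the
  two outer half planes because \<open>dirn n (int n) = - 1\<close>.\<close>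

lemma base_plane_period: "screw n (int n) p \<in> base_plane \<longleftrightarrow> p \<in> base_plane"
proof -
  have dd: "d * d = 1" using d by auto
  have chart: "screw n (i * int n) p \<in> chart ` strip" if "p \<in> chart ` strip" for i p
  proof -
    from that obtain a where a: "p = chart a" "a \<in> strip" by (rule imageE)
    have e: "i * d * d * int n = i * int n" using dd by (simp only: mult.assoc mult_1_right)
    have "screw n (i * int n) p = chart (deck (i * d) a)"
      using chart_deck [OF a(2), of "i * d"] unfolding a(1) e by (rule sym)
    then show ?thesis by (rule image_eqI) (simp only: deck_strip a(2))
  qed
  have "screw n (int n) p \<in> chart ` strip \<longleftrightarrow> p \<in> chart ` strip"
    using chart [of p 1] chart [of "screw n (int n) p" "- 1"] unfolding screw_screw by (auto simp only: mult_1_left mult_minus1 screw_0 add.left_inverse)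
  then show ?thesis
    unfolding base_plane_def Un_iff by (simp add: screw_def dirn_half_turn)
qed

text \<open>Outside the open ball the angle of the rotation decides; inside, both points lie on the
  charted strip and \<open>chart_screw\<close> applies.\<close>

lemma base_plane_screw:
  assumes "p \<in> base_plane" "screw n m p \<in> base_plane"
  shows "int n dvd m"
proof (cases "(cmod (fst p))\<^sup>2 + (fst (snd p))\<^sup>2 \<ge> 1")
  case True
  let ?z = "fst p"
  have h: "fst (snd p) = 0" "Im ?z = 0"
    using assms(1) base_plane_outside [OF True, of "snd (snd p)"] by simp_all
  have "Im (dirn n m * ?z) = 0"
    using assms(2) base_plane_outside [of "dirn n m * ?z" "fst (snd p)"] True by (simp add: screw_def norm_mult)
  moreover have "Re ?z \<noteq> 0" using True h by (auto simp: cmod_power2)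
  ultimately have "sin (pi * of_int m / n) = 0"
    using h by (simp add: dirn_def)
  then obtain i :: int where "pi * of_int m / n = of_int i * pi" by (auto simp: sin_zero_iff_int2)
  then have "real_of_int m = real_of_int (i * int n)" using n by (simp add: field_simps)
  then have "m = i * int n" by (simp only: of_int_eq_iff)
  then show ?thesis by simp
next
  case False
  have in_chart: "q \<in> chart ` strip" if "q \<in> base_plane" "\<not> (cmod (fst q))\<^sup>2 + (fst (snd q))\<^sup>2 \<ge> 1" for q
  proof (rule ccontr)
    assume "q \<notin> chart ` strip"
    then have "Im (fst q) = 0" "1 \<le> \<bar>Re (fst q)\<bar>" using that(1) by (auto simp: base_plane_def)
    then have "1 \<le> (Re (fst q))\<^sup>2" by (metis abs_1 abs_le_square_iff one_power2)
    then show False using that(2) \<open>Im (fst q) = 0\<close> by (simp add: cmod_power2 add_increasing2)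
  qed
  obtain b where b: "b \<in> strip" "p = chart b" using in_chart [OF assms(1) False] by blast
  have "\<not> (cmod (fst (screw n m p)))\<^sup>2 + (fst (snd (screw n m p)))\<^sup>2 \<ge> 1"
    using False by (simp add: screw_def norm_mult)
  then obtain a where a: "a \<in> strip" "screw n m p = chart a" using in_chart [OF assms(2)] by blast
  obtain j where "m = - j * d * int n" using chart_screw [OF a(1) b(1)] a(2) b(2) by metis
  then show ?thesis by simp
qed

lemma dirn_minus: "dirn n (- k) = cnj (dirn n k)"
  by (simp add: dirn_def cis_cnj)

theorem plane_system_plane: "plane_system n plane"
proof
  show "2 \<le> n" by (rule n)
  show "closed (plane k)" for k
  proof -
    have "plane k = screw n (- k) -` base_plane" by (auto simp: plane_def)
    then show ?thesis
      using closed_vimage [OF closed_base_plane continuous_on_screw] by simp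
  qed
  show "plane (k + int n) = plane k" for k
  proof -
    have "screw n (- k) p = screw n (int n) (screw n (- (k + int n)) p)" for p
      by (simp add: screw_screw)
    then show ?thesis by (auto simp: plane_def base_plane_period)
  qed
  show "plane k \<inter> plane l = {}" if "\<not> int n dvd k - l" for k l
  proof -
    have "int n dvd k - l" if "p \<in> plane k" "p \<in> plane l" for p
      using base_plane_screw [of "screw n (- k) p" "k - l"] that by (simp add: plane_def screw_screw)
    then show ?thesis using that by blast
  qed
  show "(z, h, t) \<in> plane k \<longleftrightarrow> h = 0 \<and> Im (z * cnj (dirn n k)) = 0" if "(cmod z)\<^sup>2 + h\<^sup>2 \<ge> 1" for z h t k
    using base_plane_outside [of "cnj (dirn n k) * z" h] that
    by (simp add: plane_def screw_def dirn_minus norm_mult mult.commute)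
  show "screw n 1 p \<in> plane (k + 1) \<longleftrightarrow> p \<in> plane k" for p k
    by (simp add: plane_def screw_screw)
  show "(plane k - ray (dirn n k)) homeomorphic ({0..} \<times> UNIV :: (real \<times> real) set)" for k
  proof -
    have ray: "screw n (- k) p \<in> ray 1 \<longleftrightarrow> p \<in> ray (dirn n k)" for p
      by (simp add: ray_def along_def across_def screw_def dirn_minus mult.commute)
    have "homeomorphism (plane k - ray (dirn n k)) (base_plane - ray 1) (screw n (- k)) (screw n k)"
    proof (rule homeomorphismI)
      show "screw n (- k) ` (plane k - ray (dirn n k)) \<subseteq> base_plane - ray 1"
        using ray by (auto simp: plane_def)
      show "screw n k ` (base_plane - ray 1) \<subseteq> plane k - ray (dirn n k)"
        using ray [of "screw n k p" for p] by (auto simp: plane_def screw_screw screw_0)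
    qed (auto simp: screw_screw screw_0 continuous_on_screw)
    then have 1: "(plane k - ray (dirn n k)) homeomorphic (base_plane - ray 1)"
      using homeomorphic_def by blast
    obtain g where "homeomorphism half_strip (extended ` half_strip) extended g"
    proof (rule homeomorphism_injective_closed_map [OF continuous_extended refl inj_extended])
      fix U assume "closedin (top_of_set half_strip) U"
      then have "closed U" "U \<subseteq> half_strip"
        by (auto intro: closedin_closed_trans closed_half_strip dest: closedin_imp_subset)
      then show "closedin (top_of_set (extended ` half_strip)) (extended ` U)"
        by (intro closed_subset closed_extended image_mono)
    qed
    then have "half_strip homeomorphic (extended ` half_strip)"
      unfolding homeomorphic_def by blast
    then have "(plane k - ray (dirn n k)) homeomorphic half_strip"
      using 1 homeomorphic_trans homeomorphic_sym unfolding base_plane_minus_ray by blast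
    then show ?thesis unfolding half_strip_def .
  qed
qed

end

lemma (in moebius_filling) impossible: False
proof -
  obtain \<tau> d where "moebius_lift n Z H W \<tau> d" by (rule lift_exists)
  from plane_system.inconsistent [OF moebius_lift.plane_system_plane [OF this]] show False .
qed

section \<open>From a band bounded by the torus knot to the filling\<close>

lemma norm_real3: "(norm (x :: real^3))\<^sup>2 = (cmod (Complex (x $ 1) (x $ 2)))\<^sup>2 + (x $ 3)\<^sup>2"
  by (simp add: norm_vec_def L2_set_def sum_3 cmod_power2)

lemma torus_knot_point:
  fixes x :: "real^3"
  assumes "(x, w) \<in> torus_knot 1 (2 * int n)"
  shows "cmod (Complex (x $ 1) (x $ 2)) = 1" "x $ 3 = 0" "w = Complex (x $ 1) (x $ 2) ^ (2 * n)"
proof -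
  obtain t where t: "x = sphere_of_complex (exp (2 * of_real pi * \<i> * of_int 1 * of_real t))"
      "w = exp (2 * of_real pi * \<i> * of_int (2 * int n) * of_real t)"
    using assms unfolding torus_knot_def by blast
  have e: "exp (2 * of_real pi * \<i> * of_int k * of_real t) = cis (2 * pi * of_int k * t)" for k
    by (simp add: cis_conv_exp mult_ac)
  have x: "x = sphere_of_complex (cis (2 * pi * t))" and w: "w = cis (2 * pi * of_int (2 * int n) * t)"
    using t unfolding e by simp_all
  have 1: "Complex (x $ 1) (x $ 2) = cis (2 * pi * t)"
    by (simp add: x sphere_of_complex_def complex_eq_iff)
  show "cmod (Complex (x $ 1) (x $ 2)) = 1" by (simp add: 1)
  show "x $ 3 = 0" by (simp add: x sphere_of_complex_def)
  show "w = Complex (x $ 1) (x $ 2) ^ (2 * n)"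
    unfolding 1 w Complex.DeMoivre by (simp add: mult_ac)
qed

lemma no_moebius_band:
  assumes "n \<ge> 2"
  shows "\<not> bounds_locally_flat_moebius_band D3_times_S1 S2_times_S1 (torus_knot 1 (2 * int n))"
proof
  assume "bounds_locally_flat_moebius_band D3_times_S1 S2_times_S1 (torus_knot 1 (2 * int n))"
  then obtain M where M: "M \<subseteq> D3_times_S1" "moebius_band homeomorphic_space top_of_set M"
      "surface_boundary M = M \<inter> S2_times_S1" "M \<inter> S2_times_S1 = torus_knot 1 (2 * int n)"
    unfolding bounds_locally_flat_moebius_band_def by blast
  obtain G where "moebius_strip M G" by (rule moebius_strip_exists [OF M(2)])
  then interpret moebius_strip M G .
  let ?Z = "\<lambda>a. Complex (fst (G a) $ 1) (fst (G a) $ 2)" and ?H = "\<lambda>a. fst (G a) $ 3" and ?W = "\<lambda>a. snd (G a)"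
  have in_M: "G a \<in> D3_times_S1" if "a \<in> strip" for a
    using M(1) G_image that by blast
  have norm_le: "(norm (fst (G a)))\<^sup>2 \<le> 1" if "a \<in> strip" for a
    using in_M [OF that] by (simp add: mem_Times_iff power_le_one)
  have edge: "G a \<in> torus_knot 1 (2 * int n) \<longleftrightarrow> snd a \<in> {0, 1}" if "a \<in> strip" for a
    using boundary_iff [OF that] M(3,4) by simp
  have "moebius_filling n ?Z ?H ?W"
  proof
    have c: "continuous_on strip (\<lambda>a. fst (G a) $ i)" for i
      by (intro continuous_intros continuous_G)
    show "continuous_on strip ?Z" unfolding Complex_eq by (intro continuous_intros c)
    show "continuous_on strip ?H" by (rule c)
    show "continuous_on strip ?W" by (rule continuous_on_snd [OF continuous_G])
    show "cmod (?W a) = 1" if "a \<in> strip" for a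
      using in_M [OF that] by (simp add: mem_Times_iff)
    show "(cmod (?Z a))\<^sup>2 + (?H a)\<^sup>2 \<le> 1" if "a \<in> strip" for a
      using norm_le [OF that] by (simp only: norm_real3)
    show "?Z a = ?Z b \<and> ?H a = ?H b \<and> ?W a = ?W b \<longleftrightarrow> (\<exists>k. b = deck k a)" if "a \<in> strip" "b \<in> strip" for a b
    proof -
      have "?Z a = ?Z b \<and> ?H a = ?H b \<and> ?W a = ?W b \<longleftrightarrow> G a = G b"
        by (auto simp: prod_eq_iff vec_eq_iff forall_3)
      then show ?thesis using G_eq [OF that] by simp
    qed
    show "snd a \<in> {0, 1}" if "a \<in> strip" "(cmod (?Z a))\<^sup>2 + (?H a)\<^sup>2 = 1" for a
    proof -
      have "norm (fst (G a)) = 1 \<or> norm (fst (G a)) = - 1"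
        using that(2) by (simp add: norm_real3 [symmetric] power2_eq_1_iff)
      then have "norm (fst (G a)) = 1"
        using norm_ge_zero [of "fst (G a)"] by linarith
      then have "G a \<in> M \<inter> S2_times_S1"
        using in_M [OF that(1)] G_image that(1) by (auto simp: mem_Times_iff)
      then show ?thesis using edge [OF that(1)] M(4) by simp
    qed
    show "cmod (?Z a) = 1 \<and> ?H a = 0 \<and> ?W a = ?Z a ^ (2 * n)" if "snd a \<in> {0, 1}" for a
    proof -
      have "(fst (G a), snd (G a)) \<in> torus_knot 1 (2 * int n)"
        using edge [of a] that by (auto simp: mem_Times_iff)
      from torus_knot_point [OF this] show ?thesis by blast
    qed
  qed (rule assms)
  then show False by (rule moebius_filling.impossible)
qed

theorem theorem1p2:
  fixes n :: nat
  assumes "n > 0"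
    and "\<not> (\<exists>m :: nat. n = m\<^sup>2)"
  shows "\<not> bounds_locally_flat_moebius_band D3_times_S1 S2_times_S1 (torus_knot 1 (2 * int n))"
proof (rule no_moebius_band)
  \<comment> \<open>The number 1 is a square.\<close>
  show "2 \<le> n" using assms by (metis One_nat_def Suc_leI le_neq_implies_less numeral_2_eq_2 one_power2)
qed

end
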